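(* If $G$ is a Berge graph admitting a skew partition, then either $G$ admits a balanced skew partition, or one of $G,\overline G$ contains as an induced subgraph a long prism, or a double diamond, or $L(K_{3,3}\setminus e)$.
   Context: Graphs are finite and simple; Berge: all holes (induced cycles of length $\ge4$) and antiholes (induced subgraphs whose complement is a hole) are even. Paths are induced subgraphs that are paths; antipaths are induced subgraphs whose complement is a path; lengths count edges. Skew partition: partition $(A,B)$ of $V(G)$ with $G|A$ disconnected and $\overline G|B$ disconnected; it is balanced if there is no odd path between nonadjacent vertices of $B$ with interior in $A$ and no odd antipath between adjacent vertices of $A$ with interior in $B$. A prism is a graph consisting of two vertex-disjoint triangles $\{a_1,a_2,a_3\}$, $\{b_1,b_2,b_3\}$ and three paths $P_1,P_2,P_3$, $P_i$ with ends $a_i,b_i$, such that for $i\ne j$ the only edges between $V(P_i)$ and $V(P_j)$ are $a_ia_j$ and $b_ib_j$; it is long if at least one $P_i$ has length $>1$. The double diamond is the graph on $a_1,\dots,a_4,b_1,\dots,b_4$ in which every two $a_i$ are adjacent except $a_3a_4$, every two $b_i$ are adjacent except $b_3b_4$, $a_ib_i$ is an edge for $1\le i\le4$, and there are no other edges. $L(K_{3,3}\setminus e)$ is the line graph of the graph obtained from $K_{3,3}$ by deleting one edge. *)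

theory Defs
  imports Main
begin

definition graph :: "'a set \<Rightarrow> ('a \<Rightarrow> 'a \<Rightarrow> bool) \<Rightarrow> bool" where
  "graph V E \<longleftrightarrow> finite V \<and> (\<forall>x y. E x y \<longrightarrow> x \<in> V \<and> y \<in> V)
     \<and> (\<forall>x y. E x y \<longrightarrow> E y x) \<and> (\<forall>x. \<not> E x x)"

definition compl :: "'a set \<Rightarrow> ('a \<Rightarrow> 'a \<Rightarrow> bool) \<Rightarrow> 'a \<Rightarrow> 'a \<Rightarrow> bool" where
  "compl V E x y \<longleftrightarrow> x \<in> V \<and> y \<in> V \<and> x \<noteq> y \<and> \<not> E x y"

definition is_hole :: "'a set \<Rightarrow> ('a \<Rightarrow> 'a \<Rightarrow> bool) \<Rightarrow> 'a list \<Rightarrow> bool" where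
  "is_hole V E xs \<longleftrightarrow> length xs \<ge> 4 \<and> distinct xs \<and> set xs \<subseteq> V \<and>
     (\<forall>i < length xs. \<forall>j < length xs.
        E (xs ! i) (xs ! j) \<longleftrightarrow> (j = Suc i mod length xs \<or> i = Suc j mod length xs))"

text \<open>Antihole: induced subgraph whose complement is a hole, i.e. a hole of the
complement graph (complementation commutes with taking induced subgraphs).\<close>
definition is_antihole :: "'a set \<Rightarrow> ('a \<Rightarrow> 'a \<Rightarrow> bool) \<Rightarrow> 'a list \<Rightarrow> bool" where
  "is_antihole V E xs \<longleftrightarrow> is_hole V (compl V E) xs"

definition berge :: "'a set \<Rightarrow> ('a \<Rightarrow> 'a \<Rightarrow> bool) \<Rightarrow> bool" where
  "berge V E \<longleftrightarrow> (\<forall>xs. is_hole V E xs \<longrightarrow> even (length xs))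
               \<and> (\<forall>xs. is_antihole V E xs \<longrightarrow> even (length xs))"

text \<open>Induced path, listed in order; its length is length xs - 1.\<close>
definition induced_path :: "'a set \<Rightarrow> ('a \<Rightarrow> 'a \<Rightarrow> bool) \<Rightarrow> 'a list \<Rightarrow> bool" where
  "induced_path V E xs \<longleftrightarrow> xs \<noteq> [] \<and> distinct xs \<and> set xs \<subseteq> V \<and>
     (\<forall>i < length xs. \<forall>j < length xs. E (xs ! i) (xs ! j) \<longleftrightarrow> (j = Suc i \<or> i = Suc j))"

definition induced_antipath :: "'a set \<Rightarrow> ('a \<Rightarrow> 'a \<Rightarrow> bool) \<Rightarrow> 'a list \<Rightarrow> bool" where
  "induced_antipath V E xs \<longleftrightarrow> induced_path V (compl V E) xs"

definition interior :: "'a list \<Rightarrow> 'a set" where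
  "interior xs = set (butlast (tl xs))"

definition disconnected_on :: "('a \<Rightarrow> 'a \<Rightarrow> bool) \<Rightarrow> 'a set \<Rightarrow> bool" where
  "disconnected_on E S \<longleftrightarrow> (\<exists>X Y. X \<noteq> {} \<and> Y \<noteq> {} \<and> X \<inter> Y = {} \<and> X \<union> Y = S
        \<and> (\<forall>x\<in>X. \<forall>y\<in>Y. \<not> E x y))"

definition skew_partition :: "'a set \<Rightarrow> ('a \<Rightarrow> 'a \<Rightarrow> bool) \<Rightarrow> 'a set \<Rightarrow> 'a set \<Rightarrow> bool" where
  "skew_partition V E A B \<longleftrightarrow> A \<inter> B = {} \<and> A \<union> B = V
      \<and> disconnected_on E A \<and> disconnected_on (compl V E) B"

definition balanced_skew_partition :: "'a set \<Rightarrow> ('a \<Rightarrow> 'a \<Rightarrow> bool) \<Rightarrow> 'a set \<Rightarrow> 'a set \<Rightarrow> bool" where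
  "balanced_skew_partition V E A B \<longleftrightarrow> skew_partition V E A B
     \<and> \<not> (\<exists>xs. induced_path V E xs \<and> hd xs \<in> B \<and> last xs \<in> B \<and> hd xs \<noteq> last xs
              \<and> \<not> E (hd xs) (last xs) \<and> interior xs \<subseteq> A \<and> odd (length xs - 1))
     \<and> \<not> (\<exists>xs. induced_antipath V E xs \<and> hd xs \<in> A \<and> last xs \<in> A
              \<and> E (hd xs) (last xs) \<and> interior xs \<subseteq> B \<and> odd (length xs - 1))"

text \<open>G contains a prism as an induced subgraph: three vertex-disjoint induced paths
P1,P2,P3 (a_i = hd P_i, b_i = last P_i, a_i \<noteq> b_i since the triangles are disjoint),
such that between V(P_i) and V(P_j) (i \<noteq> j) the only edges are a_i a_j and b_i b_j.
Long: some P_i has length > 1.\<close>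
definition prism_paths :: "'a set \<Rightarrow> ('a \<Rightarrow> 'a \<Rightarrow> bool) \<Rightarrow> 'a list \<Rightarrow> 'a list \<Rightarrow> 'a list \<Rightarrow> bool" where
  "prism_paths V E P1 P2 P3 \<longleftrightarrow>
     (\<forall>P\<in>{P1,P2,P3}. induced_path V E P \<and> length P \<ge> 2) \<and>
     distinct (P1 @ P2 @ P3) \<and>
     (\<forall>P\<in>{P1,P2,P3}. \<forall>Q\<in>{P1,P2,P3}. P \<noteq> Q \<longrightarrow>
        (\<forall>u\<in>set P. \<forall>v\<in>set Q. E u v \<longleftrightarrow>
            ((u = hd P \<and> v = hd Q) \<or> (u = last P \<and> v = last Q))))"

definition has_long_prism :: "'a set \<Rightarrow> ('a \<Rightarrow> 'a \<Rightarrow> bool) \<Rightarrow> bool" where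
  "has_long_prism V E \<longleftrightarrow> (\<exists>P1 P2 P3. prism_paths V E P1 P2 P3 \<and>
       (length P1 > 2 \<or> length P2 > 2 \<or> length P3 > 2))"

definition contains_induced :: "'b set \<Rightarrow> ('b \<Rightarrow> 'b \<Rightarrow> bool) \<Rightarrow> 'a set \<Rightarrow> ('a \<Rightarrow> 'a \<Rightarrow> bool) \<Rightarrow> bool" where
  "contains_induced HV HE V E \<longleftrightarrow> (\<exists>f. inj_on f HV \<and> f ` HV \<subseteq> V \<and>
       (\<forall>x\<in>HV. \<forall>y\<in>HV. E (f x) (f y) \<longleftrightarrow> HE x y))"

text \<open>Double diamond: a_i = i (i = 1..4), b_i = i + 4.\<close>
definition dd_V :: "nat set" where "dd_V = {1..8}"

definition dd_E :: "nat \<Rightarrow> nat \<Rightarrow> bool" where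
  "dd_E x y \<longleftrightarrow> x \<in> dd_V \<and> y \<in> dd_V \<and> x \<noteq> y \<and>
     ((x \<le> 4 \<and> y \<le> 4 \<and> {x,y} \<noteq> {3,4}) \<or>
      (x > 4 \<and> y > 4 \<and> {x,y} \<noteq> {7,8}) \<or>
      y = x + 4 \<or> x = y + 4)"

text \<open>L(K_{3,3} minus an edge): K_{3,3} has parts {x0,x1,x2}, {y0,y1,y2}; the edge
x_i y_j is the pair (i,j); the edge x2 y2 is deleted. Two edges are adjacent in the
line graph iff they are distinct and share an end.\<close>
definition lk_V :: "(nat \<times> nat) set" where
  "lk_V = ({0,1,2} \<times> {0,1,2}) - {(2,2)}"

definition lk_E :: "nat \<times> nat \<Rightarrow> nat \<times> nat \<Rightarrow> bool" where
  "lk_E e f \<longleftrightarrow> e \<in> lk_V \<and> f \<in> lk_V \<and> e \<noteq> f \<and> (fst e = fst f \<or> snd e = snd f)"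

end

(*
Choose a skew partition (A, B), split as (A\<^sub>1, A\<^sub>2, B\<^sub>1, B\<^sub>2) with A\<^sub>1 anticomplete to A\<^sub>2 and B\<^sub>1 complete to B\<^sub>2,
and assume there is no long prism in the graph or its complement. The main tool is the
Roussel-Rubio lemma: if X is anticonnected and P is an odd path of length at least 3 whose ends,
but no internal vertices, are X-complete, then P has length 3 and an odd antipath with interior in X
joins its two internal vertices (the remaining "leap" outcome is a long prism).

If some vertex of B has no neighbour in a component of A, or dually, then a balanced skew partition
is found by an extremal choice. Otherwise an odd path with ends in B\<^sub>1 and interior in A\<^sub>1 has
length 3, and applying the Roussel-Rubio lemma three more times, alternately in the graph and its
complement, yields two vertices in each of A\<^sub>1, A\<^sub>2, B\<^sub>1, B\<^sub>2. Parity of 5-holes and 5-antiholes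
leaves two possibilities for the edges between the pairs in A\<^sub>2 and B\<^sub>2: one is the double diamond,
the other is L(K_{3,3} - e).
*)
theory Submission
  imports Defs
begin

section \<open>Paths and connectivity\<close>

text \<open>What drives the proof is a match of hypotheses. Once no vertex of \<open>B\<close>
  misses a component of \<open>A\<close>, and dually, an odd path with ends in
  \<open>B\<^sub>1\<close> and interior in \<open>A\<^sub>1\<close> has ends complete to any
  anticomponent \<open>Y\<close> of \<open>B\<^sub>2\<close> and no internal vertex complete to it.
  So Roussel-Rubio applies with \<open>X = Y\<close>, and the antipath that it returns meets the
  complementary hypotheses for a component of \<open>A\<^sub>2\<close>. Components and
  anticomponents, not arbitrary halves, are carried around because the lemma needs \<open>X\<close>
  anticonnected.

  Roussel-Rubio itself rests on counting: if consecutive \<open>X\<close>-complete vertices of a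
  path with \<open>X\<close>-complete ends are adjacent or at even distance, the number of
  \<open>X\<close>-complete edges has the parity of the length. In a minimal counterexample this
  number is odd for \<open>X - {x}\<close> and for \<open>X - {y}\<close>, and would also be odd for
  both kinds together, although it is the sum of the two. The obstacle is a gap whose ends are of
  different kinds; when \<open>X = {x, y}\<close> and the gap spans the whole interior of the path,
  no odd hole arises but a long prism.\<close>

definition seg :: "'a list \<Rightarrow> nat \<Rightarrow> nat \<Rightarrow> 'a list" where
  "seg P i j = map ((!) P) [i..<Suc j]"

lemma length_seg [simp]: "length (seg P i j) = Suc j - i"
  by (simp add: seg_def del: upt_Suc)

lemma seg_nth [simp]: "k < Suc j - i \<Longrightarrow> seg P i j ! k = P ! (i + k)"
  unfolding seg_def by (subst nth_map) (auto simp del: upt_Suc)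

lemma set_seg: "set (seg P i j) = (!) P ` {i..j}"
  by (simp add: seg_def atLeastLessThanSuc_atLeastAtMost del: upt_Suc)

lemma seg_not_Nil [simp]: "i \<le> j \<Longrightarrow> seg P i j \<noteq> []"
  by (simp add: seg_def)

lemma hd_seg [simp]: "i \<le> j \<Longrightarrow> hd (seg P i j) = P ! i"
  by (simp add: hd_conv_nth)

lemma last_seg [simp]: "i \<le> j \<Longrightarrow> last (seg P i j) = P ! j"
  by (simp add: last_conv_nth)

lemma set_interior: "interior P = {P ! i | i. 0 < i \<and> Suc i < length P}"
proof -
  have "butlast (tl P) = map (\<lambda>i. P ! Suc i) [0..<length P - 2]"
    by (intro nth_equalityI) (auto simp: nth_butlast nth_tl)
  then have "interior P = {P ! Suc i | i. i < length P - 2}"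
    by (auto simp: interior_def)
  also have "\<dots> = {P ! i | i. 0 < i \<and> Suc i < length P}"
  proof (intro set_eqI iffI)
    fix v assume "v \<in> {P ! Suc i | i. i < length P - 2}"
    then obtain i where "i < length P - 2" "v = P ! Suc i" by auto
    then show "v \<in> {P ! i | i. 0 < i \<and> Suc i < length P}"
      by (auto intro!: exI[of _ "Suc i"])
  next
    fix v assume "v \<in> {P ! i | i. 0 < i \<and> Suc i < length P}"
    then obtain i where "0 < i" "Suc i < length P" "v = P ! i" by auto
    then show "v \<in> {P ! Suc i | i. i < length P - 2}"
      by (auto intro!: exI[of _ "i - 1"])
  qed
  finally show ?thesis .
qed

lemma induced_path_adj:
  "induced_path V E P \<Longrightarrow> i < length P \<Longrightarrow> j < length P \<Longrightarrow>
     E (P ! i) (P ! j) \<longleftrightarrow> j = Suc i \<or> i = Suc j"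
  by (simp add: induced_path_def)

lemma induced_path_eq:
  "induced_path V E P \<Longrightarrow> i < length P \<Longrightarrow> j < length P \<Longrightarrow> P ! i = P ! j \<longleftrightarrow> i = j"
  by (simp add: induced_path_def nth_eq_iff_index_eq)

lemma induced_path_seg:
  assumes "induced_path V E P" "i \<le> j" "j < length P"
  shows "induced_path V E (seg P i j)"
  unfolding induced_path_def
proof (intro conjI allI impI)
  show "distinct (seg P i j)"
    using assms by (auto simp: distinct_conv_nth induced_path_eq)
  show "set (seg P i j) \<subseteq> V"
    using assms by (auto simp: set_seg induced_path_def)
qed (use assms in \<open>auto simp: induced_path_adj\<close>)

lemma interior_seg: "interior (seg P i j) = {P ! k | k. i < k \<and> k < j}"
proof (intro set_eqI iffI)
  fix v assume "v \<in> interior (seg P i j)"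
  then obtain k where "0 < k" "Suc k < Suc j - i" "v = P ! (i + k)"
    by (auto simp: set_interior)
  then show "v \<in> {P ! k | k. i < k \<and> k < j}" by (auto intro!: exI[of _ "i + k"])
next
  fix v assume "v \<in> {P ! k | k. i < k \<and> k < j}"
  then obtain k where "i < k" "k < j" "v = P ! k" by auto
  then show "v \<in> interior (seg P i j)"
    by (auto simp: set_interior intro!: exI[of _ "k - i"])
qed

lemma induced_path_rev:
  assumes "induced_path V E P"
  shows "induced_path V E (rev P)"
  unfolding induced_path_def
proof (intro conjI allI impI)
  fix i j assume "i < length (rev P)" "j < length (rev P)"
  then show "E (rev P ! i) (rev P ! j) \<longleftrightarrow> j = Suc i \<or> i = Suc j"
    using assms by (auto simp: rev_nth induced_path_adj)
qed (use assms in \<open>auto simp: induced_path_def\<close>)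

lemma induced_path_length3:
  assumes "induced_path V E P" "hd P \<noteq> last P" "\<not> E (hd P) (last P)"
  shows "3 \<le> length P"
proof (rule ccontr)
  assume "\<not> 3 \<le> length P"
  then have "length P = 0 \<or> length P = 1 \<or> length P = 2" by arith
  moreover have "length P \<noteq> 0" using assms by (auto simp: induced_path_def)
  moreover have "length P \<noteq> 1" using assms by (auto simp: length_Suc_conv)
  moreover have "length P \<noteq> 2"
    using assms induced_path_adj[OF assms(1), of 0 1] \<open>length P \<noteq> 0\<close>
    by (auto simp: hd_conv_nth last_conv_nth)
  ultimately show False by blast
qed

lemma list4: "length P = 4 \<Longrightarrow> P = [P!0, P!1, P!2, P!3]"
  by (auto simp: numeral_eq_Suc length_Suc_conv)

locale sgraph =
  fixes V :: "'a set" and E :: "'a \<Rightarrow> 'a \<Rightarrow> bool"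
  assumes graph: "graph V E"
begin

abbreviation "co \<equiv> compl V E"

lemma fin: "finite V" and sym: "E x y \<Longrightarrow> E y x" and irr: "\<not> E x x"
  and inV: "E x y \<Longrightarrow> x \<in> V" "E x y \<Longrightarrow> y \<in> V"
  using graph unfolding graph_def by simp_all

lemma sym_iff: "E x y \<longleftrightarrow> E y x"
  by (rule iffI; erule sym)

lemma sgraph_co: "sgraph V co"
proof
  show "graph V co"
    unfolding graph_def compl_def using fin sym by blast
qed

lemma co_co: "compl V co = E"
  by (intro ext) (use irr inV in \<open>auto simp: compl_def\<close>)

lemma induced_path_Cons:
  assumes P: "induced_path V E P" and w: "w \<in> V" "w \<notin> set P"
    and adj: "\<And>v. v \<in> set P \<Longrightarrow> E w v \<longleftrightarrow> v = hd P"
  shows "induced_path V E (w # P)"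
  unfolding induced_path_def
proof (intro conjI allI impI)
  have ne: "P \<noteq> []" using P by (simp add: induced_path_def)
  have a: "E w (P ! k) \<longleftrightarrow> k = 0" if "k < length P" for k
    using adj[of "P ! k"] that ne induced_path_eq[OF P that, of 0] by (auto simp: hd_conv_nth)
  have a': "E (P ! k) w \<longleftrightarrow> k = 0" if "k < length P" for k
    using a[OF that] sym_iff[of "P ! k" w] by simp
  fix i j assume "i < length (w # P)" "j < length (w # P)"
  then show "E ((w # P) ! i) ((w # P) ! j) \<longleftrightarrow> j = Suc i \<or> i = Suc j"
    using a a' induced_path_adj[OF P] irr by (cases i; cases j) auto
qed (use assms in \<open>auto simp: induced_path_def\<close>)

text \<open>A cycle is handled by cutting it at a vertex \<open>w\<close> whose neighbours on the
  remaining path \<open>P\<close> are just its two ends. Three vertices on \<open>P\<close> are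
  required because \<open>is_hole\<close> excludes triangles.\<close>

lemma hole_of_path:
  assumes P: "induced_path V E P" "3 \<le> length P" and w: "w \<in> V" "w \<notin> set P"
    and adj: "\<And>v. v \<in> set P \<Longrightarrow> E w v \<longleftrightarrow> v = hd P \<or> v = last P"
  shows "is_hole V E (w # P)"
  unfolding is_hole_def
proof (intro conjI allI impI)
  have ne: "P \<noteq> []" using P by (simp add: induced_path_def)
  have a: "E w (P ! k) \<longleftrightarrow> k = 0 \<or> Suc k = length P" if "k < length P" for k
    using adj[of "P ! k"] that ne induced_path_eq[OF P(1) that, of 0]
      induced_path_eq[OF P(1) that, of "length P - 1"]
    by (auto simp: hd_conv_nth last_conv_nth)
  have a': "E (P ! k) w \<longleftrightarrow> k = 0 \<or> Suc k = length P" if "k < length P" for k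
    using a[OF that] sym_iff[of "P ! k" w] by simp
  \<comment> \<open>Position 0 of \<open>w # P\<close> is \<open>w\<close>, so the last vertex of
    \<open>P\<close> sits at position \<open>length P\<close>, the only one whose successor wraps
    around.\<close>
  have m: "Suc k mod length (w # P) = (if k = length P then 0 else Suc k)"
    if "k < length (w # P)" for k
    using that by (auto simp: mod_Suc)
  fix i j assume ij: "i < length (w # P)" "j < length (w # P)"
  show "E ((w # P) ! i) ((w # P) ! j) \<longleftrightarrow>
      j = Suc i mod length (w # P) \<or> i = Suc j mod length (w # P)"
  proof (cases i)
    case 0
    show ?thesis
    proof (cases j)
      case 0
      then show ?thesis using \<open>i = 0\<close> irr P(2) ne
          unfolding m[OF ij(1)] m[OF ij(2)] by (simp split: if_splits)
    next
      case (Suc j')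
      then show ?thesis using \<open>i = 0\<close> a[of j'] ij P(2)
          unfolding m[OF ij(1)] m[OF ij(2)] by (auto simp: mod_Suc)
    qed
  next
    case (Suc i')
    show ?thesis
    proof (cases j)
      case 0
      then show ?thesis using \<open>i = Suc i'\<close> a'[of i'] ij P(2)
          unfolding m[OF ij(1)] m[OF ij(2)] by (auto simp: mod_Suc)
    next
      case (Suc j')
      then have ij': "i' < length P" "j' < length P" using \<open>i = Suc i'\<close> ij by simp_all
      then have "E (P ! i') (P ! j') \<longleftrightarrow> j' = Suc i' \<or> i' = Suc j'"
        by (rule induced_path_adj[OF P(1)])
      moreover have "Suc j' = (if Suc i' = length P then 0 else Suc (Suc i')) \<or>
          Suc i' = (if Suc j' = length P then 0 else Suc (Suc j')) \<longleftrightarrow> j' = Suc i' \<or> i' = Suc j'"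
        using ij' P(2) by (cases "Suc i' = length P"; cases "Suc j' = length P"; simp only: if_True if_False; arith)
      ultimately show ?thesis
        unfolding m[OF ij(1)] m[OF ij(2)] unfolding \<open>i = Suc i'\<close> \<open>j = Suc j'\<close>
        by (simp only: nth_Cons_Suc)
    qed
  qed
next
  show "distinct (w # P)" "set (w # P) \<subseteq> V" "4 \<le> length (w # P)"
    using P w by (simp_all add: induced_path_def)
qed

end

section \<open>Connected sets, components and paths inside connected sets\<close>

lemma disconnected_onE:
  assumes "disconnected_on E S"
  obtains X Y where "X \<noteq> {}" "Y \<noteq> {}" "X \<inter> Y = {}" "S = X \<union> Y" "\<forall>x\<in>X. \<forall>y\<in>Y. \<not> E x y"
proof -
  obtain X Y where "X \<noteq> {} \<and> Y \<noteq> {} \<and> X \<inter> Y = {} \<and> X \<union> Y = S \<and> (\<forall>x\<in>X. \<forall>y\<in>Y. \<not> E x y)"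
    using assms unfolding disconnected_on_def by (elim exE)
  then show thesis by (intro that[of X Y]) auto
qed

lemma disconnected_onI:
  assumes "X \<noteq> {}" "Y \<noteq> {}" "X \<inter> Y = {}" "S = X \<union> Y" "\<And>x y. x \<in> X \<Longrightarrow> y \<in> Y \<Longrightarrow> \<not> E x y"
  shows "disconnected_on E S"
  unfolding disconnected_on_def by (intro exI[of _ X] exI[of _ Y]) (use assms in auto)

lemma connected_on_cut:
  assumes "\<not> disconnected_on E S" "R \<subseteq> S" "R \<noteq> {}" "R \<noteq> S"
  obtains r v where "r \<in> R" "v \<in> S - R" "E r v"
proof -
  have "\<not> (\<forall>r\<in>R. \<forall>v\<in>S - R. \<not> E r v)"
  proof
    assume "\<forall>r\<in>R. \<forall>v\<in>S - R. \<not> E r v"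
    then have "disconnected_on E S"
      by (intro disconnected_onI[of R "S - R"]) (use assms in auto)
    then show False using assms(1) by simp
  qed
  then show thesis using that by auto
qed

lemma not_disconnected_on_singleton [simp]: "\<not> disconnected_on E {x}"
proof
  assume "disconnected_on E {x}"
  then obtain X Y where "X \<noteq> {}" "Y \<noteq> {}" "X \<inter> Y = {}" "{x} = X \<union> Y"
    by (rule disconnected_onE)
  then show False by (metis Un_upper1 Un_upper2 Int_absorb subset_singletonD)
qed

context sgraph
begin

lemma connected_on_insert:
  assumes "\<not> disconnected_on E S" "s \<in> S" "E z s"
  shows "\<not> disconnected_on E (insert z S)"
proof
  assume "disconnected_on E (insert z S)"
  then obtain X Y where XY: "X \<noteq> {}" "Y \<noteq> {}" "X \<inter> Y = {}" "insert z S = X \<union> Y"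
    "\<forall>x\<in>X. \<forall>y\<in>Y. \<not> E x y"
    by (rule disconnected_onE)
  show False
  proof (cases "z \<in> S")
    case True
    then show ?thesis using assms(1) disconnected_onI[of X Y S] XY by (simp add: insert_absorb)
  next
    case z: False
    have "X \<inter> S = {} \<or> Y \<inter> S = {}"
    proof (rule ccontr)
      assume *: "\<not> ?thesis"
      have "disconnected_on E S"
      proof (rule disconnected_onI)
        show "S = X \<inter> S \<union> Y \<inter> S" using XY(4) by auto
      qed (use XY * in auto)
      then show False using assms(1) by simp
    qed
    then show False
    proof
      assume "X \<inter> S = {}"
      then have "z \<in> X" "s \<in> Y" using XY(1,4) assms(2) by auto
      then show False using XY(5) assms(3) by auto
    next
      assume "Y \<inter> S = {}"
      then have "z \<in> Y" "s \<in> X" using XY(2,4) assms(2) by auto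
      then show False using XY(5) sym[OF assms(3)] by auto
    qed
  qed
qed

text \<open>A maximal connected subset of \<open>S\<close> containing \<open>s\<close> sees nothing
  of the rest of \<open>S\<close>, since a neighbour could be added by
  \<open>connected_on_insert\<close>. In the complement this yields anticomponents.\<close>

lemma connected_on_component:
  assumes "S \<subseteq> V" "s \<in> S"
  obtains K where "s \<in> K" "K \<subseteq> S" "\<not> disconnected_on E K" "\<And>x y. x \<in> K \<Longrightarrow> y \<in> S - K \<Longrightarrow> \<not> E x y"
proof -
  define F where "F = {K. s \<in> K \<and> K \<subseteq> S \<and> \<not> disconnected_on E K}"
  have "finite S" using assms fin finite_subset by blast
  moreover have "F \<subseteq> Pow S" by (auto simp: F_def)
  ultimately have "finite F" by (meson finite_Pow_iff finite_subset)
  moreover have "F \<noteq> {}" using assms by (auto simp: F_def intro!: exI[of _ "{s}"])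
  ultimately obtain K where K: "K \<in> F" "\<And>L. L \<in> F \<Longrightarrow> K \<subseteq> L \<Longrightarrow> L = K"
    using finite_has_maximal[of F] by metis
  have "\<not> E x y" if "x \<in> K" "y \<in> S - K" for x y
  proof
    assume "E x y"
    then have "insert y K \<in> F"
      using connected_on_insert[of K x y] that K(1) sym by (auto simp: F_def)
    then show False using K(2)[of "insert y K"] that by blast
  qed
  then show ?thesis using K(1) that by (auto simp: F_def)
qed

lemma connected_on_path:
  assumes "induced_path V E P"
  shows "\<not> disconnected_on E (set P)"
proof
  assume "disconnected_on E (set P)"
  then obtain X Y where XY: "X \<noteq> {}" "Y \<noteq> {}" "X \<inter> Y = {}" "set P = X \<union> Y"
    "\<forall>x\<in>X. \<forall>y\<in>Y. \<not> E x y"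
    by (rule disconnected_onE)
  have step: "P ! i \<in> X \<longleftrightarrow> P ! Suc i \<in> X" if "Suc i < length P" for i
  proof -
    have "P ! i \<in> X \<union> Y" "P ! Suc i \<in> X \<union> Y"
      using that XY(4) by (metis Suc_lessD nth_mem)+
    moreover have "E (P ! i) (P ! Suc i)"
      using that induced_path_adj[OF assms, of i "Suc i"] by simp
    ultimately show ?thesis using XY(3,5) sym by blast
  qed
  have "P ! i \<in> X \<longleftrightarrow> P ! 0 \<in> X" if "i < length P" for i
    using that by (induction i) (auto simp: step)
  then have "(\<forall>v\<in>set P. v \<in> X) \<or> (\<forall>v\<in>set P. v \<notin> X)"
    by (metis in_set_conv_nth)
  then show False using XY(1-4) by blast
qed

lemma connected_on_interior:
  assumes "induced_path V E P"
  shows "\<not> disconnected_on E (interior P)"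
proof (cases "length P \<le> 2")
  case True
  then have "interior P = {}" by (auto simp: set_interior)
  \<comment> \<open>\<open>disconnected_on\<close> asks for two nonempty parts, so an empty interior
    counts as connected.\<close>
  then show ?thesis by (auto simp: disconnected_on_def)
next
  case False
  then have "interior P = set (seg P 1 (length P - 2))"
    unfolding set_interior set_seg by force
  then show ?thesis
    using connected_on_path[OF induced_path_seg[OF assms, of 1 "length P - 2"]] False by simp
qed

text \<open>\<open>R\<close> collects the vertices that an induced path from \<open>x\<close> inside
  \<open>S\<close> reaches. If an edge left \<open>R\<close>, the path to its inner end, cut at the
  first neighbour of the outer end \<open>v\<close>, could be prolonged by \<open>v\<close> without
  creating a chord.\<close>

lemma connected_on_obtain_path:
  assumes S: "\<not> disconnected_on E S" "S \<subseteq> V" and xy: "x \<in> S" "y \<in> S"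
  obtains P where "induced_path V E P" "hd P = x" "last P = y" "set P \<subseteq> S"
proof -
  define R where "R = {v \<in> S. \<exists>P. induced_path V E P \<and> hd P = x \<and> last P = v \<and> set P \<subseteq> S}"
  have "induced_path V E [x]"
    using xy S by (auto simp: induced_path_def irr)
  then have "x \<in> R" using xy by (auto simp: R_def intro!: exI[of _ "[x]"])
  have "R = S"
  proof (rule ccontr)
    assume "R \<noteq> S"
    then obtain r v where rv: "r \<in> R" "v \<in> S - R" "E r v"
      using connected_on_cut[OF S(1), of R] \<open>x \<in> R\<close> unfolding R_def by blast
    obtain P where P: "induced_path V E P" "hd P = x" "last P = r" "set P \<subseteq> S"
      using rv(1) by (auto simp: R_def)
    have ne: "P \<noteq> []" using P(1) by (simp add: induced_path_def)
    define i where "i = (LEAST i. i < length P \<and> E (P ! i) v)"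
    have ex: "length P - 1 < length P \<and> E (P ! (length P - 1)) v"
      using ne P(3) rv(3) by (simp add: last_conv_nth)
    then have i: "i < length P" "E (P ! i) v"
      using LeastI[of "\<lambda>i. i < length P \<and> E (P ! i) v"] unfolding i_def by blast+
    have least: "\<not> E (P ! k) v" if "k < i" for k
      using not_less_Least[of k "\<lambda>i. i < length P \<and> E (P ! i) v"] that i(1) unfolding i_def by auto
    have "v \<notin> set P"
    proof
      assume "v \<in> set P"
      then obtain k where k: "k < length P" "v = P ! k" by (auto simp: in_set_conv_nth)
      have "induced_path V E (seg P 0 k)" by (rule induced_path_seg[OF P(1)]) (use k in auto)
      moreover have "set (seg P 0 k) \<subseteq> S" using P(4) k by (auto simp: set_seg)
      ultimately have "v \<in> R" using k rv(2) P(2) ne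
        unfolding R_def by (auto simp: hd_conv_nth intro!: exI[of _ "seg P 0 k"])
      then show False using rv(2) by blast
    qed
    have seg: "induced_path V E (seg P 0 i)" by (rule induced_path_seg[OF P(1)]) (use i in auto)
    have "induced_path V E (v # rev (seg P 0 i))"
    proof (rule induced_path_Cons[OF induced_path_rev[OF seg]])
      show "v \<in> V" using rv(2) S(2) by blast
      show "v \<notin> set (rev (seg P 0 i))" using \<open>v \<notin> set P\<close> i by (auto simp: set_seg)
      fix u assume "u \<in> set (rev (seg P 0 i))"
      then obtain k where k: "k \<le> i" "u = P ! k" by (auto simp: set_seg)
      have "E v u \<longleftrightarrow> k = i" using k i least[of k] sym by (cases "k = i") auto
      then show "E v u \<longleftrightarrow> u = hd (rev (seg P 0 i))"
        using k i induced_path_eq[OF P(1), of k i] by (simp add: hd_rev)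
    qed
    then have "induced_path V E (rev (v # rev (seg P 0 i)))" by (rule induced_path_rev)
    moreover have "set (rev (v # rev (seg P 0 i))) \<subseteq> S"
      using P(4) i rv(2) by (auto simp: set_seg)
    moreover have "hd (rev (v # rev (seg P 0 i))) = x" "last (rev (v # rev (seg P 0 i))) = v"
      using P(2) ne by (simp_all add: hd_append hd_conv_nth)
    ultimately have "v \<in> R" using rv(2) unfolding R_def by blast
    then show False using rv(2) by blast
  qed
  then show ?thesis using xy(2) that by (auto simp: R_def)
qed

text \<open>Growing \<open>S\<close> inside \<open>X\<close> by one adjacent vertex at a time keeps
  it connected; the last vertex added can be removed from \<open>X\<close>. In the complement this
  supplies the vertices that are dropped from \<open>X\<close> in the Roussel-Rubio
  induction.\<close>

lemma connected_on_remove: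
  assumes "finite X" "\<not> disconnected_on E X" "S \<subseteq> X" "S \<noteq> {}" "S \<noteq> X" "\<not> disconnected_on E S"
  obtains z where "z \<in> X - S" "\<not> disconnected_on E (X - {z})"
  using assms(3-6)
proof (induction "card (X - S)" arbitrary: S thesis rule: less_induct)
  case less
  obtain r z where z: "r \<in> S" "z \<in> X - S" "E r z"
    using connected_on_cut[OF assms(2) less.prems(2,3,4)] .
  have c: "\<not> disconnected_on E (insert z S)"
    using connected_on_insert[OF less.prems(5) z(1)] z(3) sym by blast
  show ?case
  proof (cases "insert z S = X")
    case True
    then have "X - {z} = S" using z by blast
    then show ?thesis using less.prems z by metis
  next
    case False
    have "X - insert z S \<subset> X - S" using z by blast
    then have "card (X - insert z S) < card (X - S)"
      using assms(1) by (intro psubset_card_mono) auto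
    from less.hyps[OF this _ _ _ False c] z less.prems show ?thesis by blast
  qed
qed

end

section \<open>Prisms, and the parity of holes in Berge graphs\<close>

lemma prism_pathsI:
  fixes E :: "'a \<Rightarrow> 'a \<Rightarrow> bool"
  assumes "graph V E"
    and paths: "induced_path V E P" "induced_path V E Q" "induced_path V E R"
    and len: "2 \<le> length P" "2 \<le> length Q" "2 \<le> length R"
    and disj: "distinct (P @ Q @ R)"
    and PQ: "\<And>u v. u \<in> set P \<Longrightarrow> v \<in> set Q \<Longrightarrow> E u v \<longleftrightarrow> (u = hd P \<and> v = hd Q) \<or> (u = last P \<and> v = last Q)"
    and PR: "\<And>u v. u \<in> set P \<Longrightarrow> v \<in> set R \<Longrightarrow> E u v \<longleftrightarrow> (u = hd P \<and> v = hd R) \<or> (u = last P \<and> v = last R)"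
    and QR: "\<And>u v. u \<in> set Q \<Longrightarrow> v \<in> set R \<Longrightarrow> E u v \<longleftrightarrow> (u = hd Q \<and> v = hd R) \<or> (u = last Q \<and> v = last R)"
  shows "prism_paths V E P Q R"
proof -
  interpret sgraph V E by unfold_locales (rule assms(1))
  define r where "r = (\<lambda>A B. \<forall>u\<in>set A. \<forall>v\<in>set B.
    E u v \<longleftrightarrow> (u = hd A \<and> v = hd B) \<or> (u = last A \<and> v = last B))"
  have swap: "r B A" if "r A B" for A B
    unfolding r_def
  proof (intro ballI)
    fix u v assume "u \<in> set B" "v \<in> set A"
    then show "E u v \<longleftrightarrow> (u = hd B \<and> v = hd A) \<or> (u = last B \<and> v = last A)"
      using that sym_iff[of u v] by (auto simp: r_def)
  qed
  have "r P Q" "r P R" "r Q R" using PQ PR QR by (simp_all add: r_def)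
  then have "\<forall>A\<in>{P, Q, R}. \<forall>B\<in>{P, Q, R}. A \<noteq> B \<longrightarrow> r A B" using swap by simp
  then show ?thesis
    unfolding prism_paths_def r_def using paths len disj by simp
qed

locale berge_graph = sgraph +
  assumes berge: "berge V E"
begin

lemma berge_graph_co: "berge_graph V co"
proof -
  interpret co: sgraph V co by (rule sgraph_co)
  show ?thesis
    by unfold_locales (use berge in \<open>simp add: berge_def is_antihole_def co_co\<close>)
qed

text \<open>The hole \<open>w # P\<close> has one vertex more than \<open>P\<close>, and holes are
  even. Interpreted in the complement, the same fact excludes odd antiholes; all contradictions from
  odd holes and antiholes are obtained through it.\<close>

lemma odd_apex:
  assumes "induced_path V E P" "3 \<le> length P" "w \<in> V" "w \<notin> set P"
    and "\<And>v. v \<in> set P \<Longrightarrow> E w v \<longleftrightarrow> v = hd P \<or> v = last P"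
  shows "odd (length P)"
  using hole_of_path[OF assms] berge by (auto simp: berge_def)

end

section \<open>The Roussel-Rubio lemma without long prisms\<close>

lemma set_path_cases: "v \<in> set P \<Longrightarrow> v = hd P \<or> v = last P \<or> v \<in> interior P"
proof -
  assume "v \<in> set P"
  then obtain i where i: "i < length P" "v = P ! i" by (auto simp: in_set_conv_nth)
  then have "P \<noteq> []" by auto
  consider "i = 0" | "Suc i = length P" | "0 < i" "Suc i < length P" using i(1) by linarith
  then show ?thesis
  proof cases
    case 2
    then have "i = length P - 1" by simp
    then show ?thesis using i \<open>P \<noteq> []\<close> by (simp add: last_conv_nth)
  qed (use i \<open>P \<noteq> []\<close> in \<open>auto simp: hd_conv_nth set_interior\<close>)
qed

lemma induced_path_hd_last:
  assumes "induced_path V E P"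
  shows "hd P = P ! 0" "last P = P ! (length P - 1)" "0 < length P"
  using assms by (auto simp: induced_path_def hd_conv_nth last_conv_nth)

definition complete_to :: "('a \<Rightarrow> 'a \<Rightarrow> bool) \<Rightarrow> 'a \<Rightarrow> 'a set \<Rightarrow> bool" where
  "complete_to E v X \<longleftrightarrow> (\<forall>x\<in>X. E v x)"

text \<open>Paths are vertex lists, so an odd path has even list length.\<close>

definition roussel_rubio :: "'a set \<Rightarrow> ('a \<Rightarrow> 'a \<Rightarrow> bool) \<Rightarrow> 'a set \<Rightarrow> bool" where
  "roussel_rubio V E X \<longleftrightarrow> (\<forall>P. induced_path V E P \<longrightarrow> set P \<inter> X = {} \<longrightarrow>
     even (length P) \<longrightarrow> 4 \<le> length P \<longrightarrow> complete_to E (hd P) X \<longrightarrow> complete_to E (last P) X \<longrightarrow>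
     (\<forall>v\<in>interior P. \<not> complete_to E v X) \<longrightarrow>
     length P = 4 \<and> (\<exists>Q. induced_path V (compl V E) Q \<and> hd Q = P ! 1 \<and> last Q = P ! 2 \<and>
       interior Q \<subseteq> X \<and> even (length Q)))"

section \<open>Parity of the number of complete edges along a path\<close>

text \<open>When \<open>c k\<close> says that \<open>P ! k\<close> is complete to a given set, this
  is the number of complete edges of \<open>P\<close> between positions \<open>i\<close> and
  \<open>j\<close>.\<close>

definition count_pairs :: "(nat \<Rightarrow> bool) \<Rightarrow> nat \<Rightarrow> nat \<Rightarrow> nat" where
  "count_pairs c i j = card {k. i \<le> k \<and> k < j \<and> c k \<and> c (Suc k)}"

lemma finite_pairs [simp]: "finite {k::nat. i \<le> k \<and> k < j \<and> p k}"
  by (rule finite_subset[of _ "{..<j}"]) auto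

lemma count_pairs_split:
  assumes "i \<le> m" "m \<le> j"
  shows "count_pairs c i j = count_pairs c i m + count_pairs c m j"
proof -
  let ?S = "\<lambda>i j. {k. i \<le> k \<and> k < j \<and> c k \<and> c (Suc k)}"
  have "?S i j = ?S i m \<union> ?S m j"
    using assms by (intro set_eqI) (simp, linarith)
  moreover have *: "?S i m \<inter> ?S m j = {}"
  proof (rule equals0I)
    fix y assume "y \<in> ?S i m \<inter> ?S m j"
    then have "y < m" "m \<le> y" by simp_all
    then show False by simp
  qed
  moreover have "card (?S i m \<union> ?S m j) = card (?S i m) + card (?S m j)"
    using finite_pairs finite_pairs * by (rule card_Un_disjoint)
  ultimately show ?thesis
    unfolding count_pairs_def by (simp only:)
qed

lemma count_pairs_eq_0: "(\<And>k. i \<le> k \<Longrightarrow> k < j \<Longrightarrow> \<not> (c k \<and> c (Suc k))) \<Longrightarrow> count_pairs c i j = 0"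
  by (auto simp: count_pairs_def)

lemma count_pairs_refl: "count_pairs c a a = 0"
  by (rule count_pairs_eq_0) simp

text \<open>The positions satisfying \<open>d\<close> cut the interval into gaps, so a relation that
  composes along increasing positions need only be checked on gaps. Both parity arguments for
  \<open>count_pairs\<close> have this form.\<close>

lemma gap_induct [consumes 3, case_names refl trans gap]:
  fixes i j :: nat
  assumes "i \<le> j" "d i" "d j"
    and refl: "\<And>a. R a a"
    and trans: "\<And>a b c. a \<le> b \<Longrightarrow> b \<le> c \<Longrightarrow> R a b \<Longrightarrow> R b c \<Longrightarrow> R a c"
    and gap: "\<And>a b. i \<le> a \<Longrightarrow> a < b \<Longrightarrow> b \<le> j \<Longrightarrow> d a \<Longrightarrow> d b \<Longrightarrow>
      (\<And>k. a < k \<Longrightarrow> k < b \<Longrightarrow> \<not> d k) \<Longrightarrow> R a b"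
  shows "R i j"
proof -
  have "R i m" if "i \<le> m" "m \<le> j" "d m" for m
    using that
  proof (induction m rule: less_induct)
    case (less m)
    show ?case
    proof (cases "m = i")
      case False
      define a where "a = Max {k. i \<le> k \<and> k < m \<and> d k}"
      have "i \<in> {k. i \<le> k \<and> k < m \<and> d k}" using False less.prems assms by auto
      then have a: "a \<in> {k. i \<le> k \<and> k < m \<and> d k}"
        unfolding a_def by (intro Max_in) auto
      have "\<not> d k" if "a < k" "k < m" for k
      proof
        assume "d k"
        then have "k \<le> a" unfolding a_def using that a by (intro Max_ge) auto
        then show False using that by simp
      qed
      then have "R a m" using gap a less.prems by simp
      moreover have "R i a" using less.IH[of a] a less.prems by simp
      ultimately show ?thesis using trans a by auto
    qed (simp add: refl)
  qed
  then show ?thesis using assms by simp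
qed

text \<open>A gap of length 1 contributes one edge; a longer gap contributes none and has even
  length. So every gap adds the same parity to the count and to the distance.\<close>

lemma count_pairs_parity:
  assumes "i \<le> j" "c i" "c j"
    and gap: "\<And>a b. i \<le> a \<Longrightarrow> a < b \<Longrightarrow> b \<le> j \<Longrightarrow> c a \<Longrightarrow> c b \<Longrightarrow>
      (\<And>k. a < k \<Longrightarrow> k < b \<Longrightarrow> \<not> c k) \<Longrightarrow> b = Suc a \<or> even (b - a)"
  shows "even (count_pairs c i j) \<longleftrightarrow> even (j - i)"
  using assms(1-3)
proof (induction rule: gap_induct)
  case (refl a)
  then show ?case by (simp add: count_pairs_refl)
next
  case (trans a b d)
  then show ?case by (auto simp: count_pairs_split[of a b d])
next
  case (gap a b)
  show ?case
  proof (cases "b = Suc a")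
    case True
    then have "{k. a \<le> k \<and> k < b \<and> c k \<and> c (Suc k)} = {a}" using gap by auto
    then show ?thesis using True by (simp add: count_pairs_def)
  next
    case False
    have "count_pairs c a b = 0"
    proof (rule count_pairs_eq_0)
      fix k assume "a \<le> k" "k < b"
      then show "\<not> (c k \<and> c (Suc k))" using gap(6)[of k] gap(6)[of "Suc k"] False by (cases "k = a") auto
    qed
    then show ?thesis using assms(4)[of a b] gap False by auto
  qed
qed

lemma count_pairs_even:
  assumes "i \<le> j" "d i" "d j"
    and "\<And>a b. i \<le> a \<Longrightarrow> a < b \<Longrightarrow> b \<le> j \<Longrightarrow> d a \<Longrightarrow> d b \<Longrightarrow>
      (\<And>k. a < k \<Longrightarrow> k < b \<Longrightarrow> \<not> d k) \<Longrightarrow> even (count_pairs c a b)"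
  shows "even (count_pairs c i j)"
  using assms(1-3)
proof (induction rule: gap_induct)
  case (refl a)
  then show ?case by (simp add: count_pairs_refl)
next
  case (trans a b d)
  then show ?case by (simp add: count_pairs_split[of a b d])
next
  case (gap a b)
  then show ?case using assms(4)[of a b] by blast
qed

section \<open>Consequences of the Roussel-Rubio property of smaller sets\<close>

context berge_graph
begin

lemma co_iff: "x \<in> V \<Longrightarrow> y \<in> V \<Longrightarrow> co x y \<longleftrightarrow> x \<noteq> y \<and> \<not> E x y"
  by (auto simp: compl_def)

lemma path_inV: "induced_path V E P \<Longrightarrow> i < length P \<Longrightarrow> P ! i \<in> V"
  by (auto simp: induced_path_def)

text \<open>In the one outcome that the property leaves, length 3, the antipath \<open>Q\<close>
  closes with \<open>w\<close> to an antihole, because \<open>w\<close> is complete to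
  \<open>X\<close> and nonadjacent to both ends of \<open>Q\<close>. The parity of \<open>Q\<close>
  makes this antihole odd.\<close>

lemma roussel_rubio_contra:
  assumes RR: "roussel_rubio V E X" and X: "X \<subseteq> V"
    and P: "induced_path V E P" "set P \<inter> X = {}" "even (length P)" "4 \<le> length P"
      "complete_to E (hd P) X" "complete_to E (last P) X" "\<And>v. v \<in> interior P \<Longrightarrow> \<not> complete_to E v X"
    and w: "length P = 4 \<Longrightarrow> \<exists>w\<in>V. complete_to E w X \<and> w \<noteq> P ! 1 \<and> w \<noteq> P ! 2 \<and> \<not> E w (P ! 1) \<and> \<not> E w (P ! 2)"
  shows False
proof -
  interpret co: berge_graph V co by (rule berge_graph_co)
  obtain Q where len: "length P = 4" and Q: "induced_path V co Q" "hd Q = P ! 1" "last Q = P ! 2"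
      "interior Q \<subseteq> X" "even (length Q)"
    using RR P unfolding roussel_rubio_def by blast
  obtain w where w: "w \<in> V" "complete_to E w X" "w \<noteq> P ! 1" "w \<noteq> P ! 2" "\<not> E w (P ! 1)" "\<not> E w (P ! 2)"
    using w[OF len] by blast
  have V: "P ! 1 \<in> V" "P ! 2 \<in> V" using path_inV[OF P(1)] len by auto
  have "E (P ! 1) (P ! 2)" using induced_path_adj[OF P(1), of 1 2] len by simp
  then have "3 \<le> length Q"
    using Q irr by (intro induced_path_length3[OF Q(1)]) (auto simp: compl_def)
  moreover have "w \<notin> set Q"
    using set_path_cases[of w Q] Q w irr by (auto simp: complete_to_def)
  moreover have "co w v \<longleftrightarrow> v = hd Q \<or> v = last Q" if "v \<in> set Q" for v
  proof (cases "v = hd Q \<or> v = last Q")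
    case True
    then show ?thesis using w V Q(2,3) by (auto simp: co_iff)
  next
    case False
    then have "v \<in> X" using set_path_cases[OF that] Q(4) by blast
    then show ?thesis using w(2) False by (auto simp: complete_to_def compl_def)
  qed
  ultimately have "odd (length Q)"
    using w(1) Q(1) by (intro co.odd_apex[of Q w])
  then show False using Q(5) by simp
qed

text \<open>A gap of odd length at least 3 is a path to which the property applies. If the length is
  exactly 3, an end of the long path \<open>P\<close> away from the inner vertices of the gap is the
  extra vertex that \<open>roussel_rubio_contra\<close> asks for.\<close>

lemma roussel_rubio_gap:
  assumes RR: "roussel_rubio V E X" and X: "X \<subseteq> V"
    and P: "induced_path V E P" "set P \<inter> X = {}" "6 \<le> length P"
    and ends: "complete_to E (P ! 0) X" "complete_to E (P ! (length P - 1)) X"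
    and ij: "i < j" "j < length P" "complete_to E (P ! i) X" "complete_to E (P ! j) X"
    and btw: "\<And>k. i < k \<Longrightarrow> k < j \<Longrightarrow> \<not> complete_to E (P ! k) X"
  shows "j = Suc i \<or> even (j - i)"
proof (rule ccontr)
  assume neg: "\<not> ?thesis"
  then have len: "even (Suc j - i)" "4 \<le> Suc j - i" using ij(1) by presburger+
  show False
  proof (rule roussel_rubio_contra[OF RR X, of "seg P i j"])
    show "induced_path V E (seg P i j)" using induced_path_seg[OF P(1)] ij by simp
    show "set (seg P i j) \<inter> X = {}"
    proof -
      have "set (seg P i j) \<subseteq> set P" using ij by (auto simp: set_seg)
      then show ?thesis using P(2) by blast
    qed
    show "\<not> complete_to E v X" if "v \<in> interior (seg P i j)" for v
      using that btw by (auto simp: interior_seg)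
    assume "length (seg P i j) = 4"
    then have j: "j = i + 3" using ij by simp
    \<comment> \<open>The vertex must be nonadjacent to positions \<open>i + 1\<close> and
      \<open>i + 2\<close>. Position 0 works unless \<open>i = 0\<close>, and then the other end is
      far away since \<open>P\<close> has at least six vertices.\<close>
    define w where "w = (if i = 0 then length P - 1 else 0)"
    have w: "w < length P" "w \<noteq> i" "w \<noteq> i + 1" "w \<noteq> i + 2" "w \<noteq> i + 3"
      using P(3) j ij by (auto simp: w_def)
    moreover have "i + 2 \<noteq> Suc w" "i + 1 \<noteq> Suc w" using w P(3) by (auto simp: w_def)
    moreover have "i + 2 < length P" "i + 1 < length P" using ij j by simp_all
    ultimately have "\<not> E (P ! w) (P ! (i + 1))" "\<not> E (P ! w) (P ! (i + 2))"
      using induced_path_adj[OF P(1), of w "i + 1"] induced_path_adj[OF P(1), of w "i + 2"] by auto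
    moreover have "complete_to E (P ! w) X" using ends by (simp add: w_def)
    moreover note w
    ultimately show "\<exists>w\<in>V. complete_to E w X \<and> w \<noteq> seg P i j ! 1 \<and> w \<noteq> seg P i j ! 2 \<and>
        \<not> E w (seg P i j ! 1) \<and> \<not> E w (seg P i j ! 2)"
      using j ij path_inV[OF P(1)] induced_path_eq[OF P(1), of w]
      by (intro bexI[of _ "P ! w"]) auto
  qed (use ij len in auto)
qed

text \<open>Between consecutive neighbours of \<open>t\<close>, the path closes up with \<open>t\<close> to an even hole; the
  first and the last \<open>(X - {t})\<close>-complete vertex of such a gap are at even distance from its ends,
  because otherwise an odd path through \<open>t\<close> and an end of \<open>P\<close> contradicts the property for
  \<open>X - {t}\<close>. Hence the number of \<open>(X - {t})\<close>-complete edges would be even, but it is odd.\<close>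

lemma penultimate_complete:
  assumes RR: "roussel_rubio V E (X - {t})" and X: "X \<subseteq> V" "t \<in> X" "\<exists>x\<in>X - {t}. \<not> E t x"
    and P: "induced_path V E P" "set P \<inter> X = {}" "even (length P)" "6 \<le> length P"
    and ends: "complete_to E (P ! 0) X" "complete_to E (P ! (length P - 1)) X"
    and int: "\<And>k. 0 < k \<Longrightarrow> Suc k < length P \<Longrightarrow> \<not> complete_to E (P ! k) X"
  shows "complete_to E (P ! 1) (X - {t}) \<or> complete_to E (P ! (length P - 2)) (X - {t})"
proof (rule ccontr)
  assume neg: "\<not> ?thesis"
  define n where "n = length P"
  define g where "g k \<longleftrightarrow> k < n \<and> complete_to E (P ! k) (X - {t})" for k
  define d where "d k \<longleftrightarrow> E t (P ! k)" for k
  have n: "6 \<le> n" "even n" using P by (simp_all add: n_def)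
  have tV: "t \<in> V" "t \<notin> set P" using X P by auto
  have neq: "t \<noteq> P ! k" if "k < n" for k using tV that by (auto simp: n_def)
  have adj: "E (P ! i) (P ! j) \<longleftrightarrow> j = Suc i \<or> i = Suc j" if "i < n" "j < n" for i j
    using induced_path_adj[OF P(1)] that by (simp add: n_def)
  have eqP: "P ! i = P ! j \<longleftrightarrow> i = j" if "i < n" "j < n" for i j
    using induced_path_eq[OF P(1)] that by (simp add: n_def)
  have PV: "P ! i \<in> V" if "i < n" for i using path_inV[OF P(1)] that by (simp add: n_def)
  have PX: "P ! i \<notin> X" if "i < n" for i
    using P(2) nth_mem[of i P] that unfolding n_def by blast
  have notin_seg: "P ! e \<notin> set (seg P i j)" if "e < n" "j < n" "e < i \<or> j < e" for e i j
  proof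
    assume "P ! e \<in> set (seg P i j)"
    then obtain k where "i \<le> k" "k \<le> j" "P ! e = P ! k" by (auto simp: set_seg)
    then show False using eqP[of e k] that by auto
  qed
  have seg: "induced_path V E (seg P i j)" if "i \<le> j" "j < n" for i j
    using induced_path_seg[OF P(1)] that by (simp add: n_def)
  have sub: "X - {t} \<subseteq> V" using X by blast
  have tnc: "\<not> complete_to E t (X - {t})" using X(3) by (auto simp: complete_to_def)
  have d0: "d 0" "d (n - 1)" using ends X(2) sym by (auto simp: d_def complete_to_def n_def)
  have g0: "g 0" "g (n - 1)" using ends n by (auto simp: g_def complete_to_def n_def)
  have g1: "\<not> g 1" "\<not> g (n - 2)" using neg by (auto simp: g_def n_def)
  have gd: "k = 0 \<or> k = n - 1" if "g k" "d k" for k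
  proof -
    have "complete_to E (P ! k) X"
      using that sym X(2) by (auto simp: g_def d_def complete_to_def)
    then show ?thesis using int[of k] that by (fastforce simp: g_def n_def)
  qed
  have gap: "j = Suc i \<or> even (j - i)"
    if "i < j" "g i" "g j" "\<And>k. i < k \<Longrightarrow> k < j \<Longrightarrow> \<not> g k" for i j
  proof (rule roussel_rubio_gap[OF RR sub P(1) _ P(4)])
    show "\<not> complete_to E (P ! k) (X - {t})" if "i < k" "k < j" for k
      using \<open>\<And>k. i < k \<Longrightarrow> k < j \<Longrightarrow> \<not> g k\<close>[OF that] that \<open>g j\<close> by (auto simp: g_def)
  qed (use that g0 P(2) in \<open>auto simp: g_def n_def\<close>)
  have btw: "\<exists>k. u < k \<and> k < v \<and> g k" if "u < v" "g u" "g v" "odd (v - u)" "v \<noteq> Suc u" for u v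
    using gap[of u v] that by blast
  \<comment> \<open>The forbidden path is \<open>P ! e\<close>, \<open>t\<close>, \<open>R\<close>:
    its two ends are complete to \<open>X - {t}\<close>, while \<open>t\<close> and the rest of
    \<open>R\<close> are not. The assumption \<open>w\<close> supplies the extra vertex when this
    path has only four vertices.\<close>
  have contra: False
    if R: "induced_path V E R" "set R \<subseteq> set P" "hd R = P ! b" "last R = P ! v" "b < n" "g v"
      "even (length R)" "2 \<le> length R"
      and int': "\<And>u. u \<in> set R \<Longrightarrow> u \<noteq> last R \<Longrightarrow> \<not> complete_to E u (X - {t})"
      and tR: "\<And>u. u \<in> set R \<Longrightarrow> E t u \<longleftrightarrow> u = hd R"
      and e: "e < n" "g e" "d e" "P ! e \<notin> set R" "\<And>u. u \<in> set R \<Longrightarrow> \<not> E (P ! e) u"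
      and w: "length R = 2 \<Longrightarrow> \<exists>k. g k \<and> \<not> d k \<and> k \<noteq> b \<and> \<not> E (P ! k) (P ! b)"
    for R b v e
  proof (rule roussel_rubio_contra[OF RR sub, of "P ! e # t # R"])
    have ne: "R \<noteq> []" using R by auto
    have dist: "distinct R" using R(1) by (simp add: induced_path_def)
    have tR': "t \<notin> set R" using tV R(2) by blast
    have "induced_path V E (t # R)"
      by (rule induced_path_Cons[OF R(1) tV(1) tR' tR])
    then show "induced_path V E (P ! e # t # R)"
      by (rule induced_path_Cons) (use e neq[of e] PV sym irr in \<open>auto simp: d_def\<close>)
    show "set (P ! e # t # R) \<inter> (X - {t}) = {}"
      using PX[of e] e(1) R(2) P(2) by auto
    show "even (length (P ! e # t # R))" "4 \<le> length (P ! e # t # R)" using R by simp_all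
    show "complete_to E (hd (P ! e # t # R)) (X - {t})" using e by (simp add: g_def)
    show "complete_to E (last (P ! e # t # R)) (X - {t})" using R ne by (simp add: g_def)
    show "\<not> complete_to E u (X - {t})" if "u \<in> interior (P ! e # t # R)" for u
    proof -
      have "u = t \<or> u \<in> set (butlast R)" using that ne by (auto simp: interior_def)
      moreover have "u \<in> set R \<and> u \<noteq> last R" if "u \<in> set (butlast R)"
      proof -
        have "R = butlast R @ [last R]" using ne by simp
        then have "distinct (butlast R @ [last R])" using dist by simp
        then show ?thesis using that in_set_butlastD by fastforce
      qed
      ultimately show ?thesis using tnc int' by blast
    qed
    assume "length (P ! e # t # R) = 4"
    then obtain k where k: "g k" "\<not> d k" "k \<noteq> b" "\<not> E (P ! k) (P ! b)" using w by auto
    then have "k < n" by (simp add: g_def)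
    then show "\<exists>w\<in>V. complete_to E w (X - {t}) \<and> w \<noteq> (P ! e # t # R) ! 1 \<and> w \<noteq> (P ! e # t # R) ! 2 \<and>
        \<not> E w ((P ! e # t # R) ! 1) \<and> \<not> E w ((P ! e # t # R) ! 2)"
      using k R(3,5) ne PV[of k] neq[of k] eqP[of k b] sym[of "P ! k" t]
      by (intro bexI[of _ "P ! k"]) (auto simp: g_def d_def hd_conv_nth)
  qed
  have even_gap: "even (count_pairs g a b)"
    if ab: "a < b" "b \<le> n - 1" "d a" "d b" and nd: "\<And>k. a < k \<Longrightarrow> k < b \<Longrightarrow> \<not> d k" for a b
  proof (cases "b = Suc a")
    case True
    have "count_pairs g a b = 0"
    proof (rule count_pairs_eq_0)
      fix k assume "a \<le> k" "k < b"
      then have "k = a" using True by simp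
      then show "\<not> (g k \<and> g (Suc k))" using gd[of a] gd[of b] True ab n by auto
    qed
    then show ?thesis by simp
  next
    case False
    have b: "b < n" using ab n by simp
    have "odd (length (seg P a b))"
    proof (rule odd_apex[OF seg _ tV(1)])
      show "t \<notin> set (seg P a b)" using tV(2) b by (auto simp: set_seg n_def)
      fix u assume "u \<in> set (seg P a b)"
      then obtain k where k: "a \<le> k" "k \<le> b" "u = P ! k" by (auto simp: set_seg)
      then have "d k \<longleftrightarrow> k = a \<or> k = b" using nd[of k] ab by (cases "k = a"; cases "k = b") auto
      then show "E t u \<longleftrightarrow> u = hd (seg P a b) \<or> u = last (seg P a b)"
        using k b ab eqP[of k a] eqP[of k b] by (simp add: d_def)
    qed (use ab b False in auto)
    then have ba: "even (b - a)" using ab by simp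
    define S where "S = {k. a \<le> k \<and> k \<le> b \<and> g k}"
    have fS: "finite S" by (rule finite_subset[of _ "{..b}"]) (auto simp: S_def)
    show ?thesis
    proof (cases "\<exists>k. a \<le> k \<and> k < b \<and> g k \<and> g (Suc k)")
      case False
      then have "count_pairs g a b = 0" by (intro count_pairs_eq_0) blast
      then show ?thesis by simp
    next
      case True
      then obtain k where k: "a \<le> k" "k < b" "g k" "g (Suc k)" by blast
      define u where "u = Min S"
      define v where "v = Max S"
      have kS: "k \<in> S" "Suc k \<in> S" using k by (simp_all add: S_def)
      have uS: "u \<in> S" and vS: "v \<in> S"
        unfolding u_def v_def using kS fS by (auto intro!: Min_in Max_in)
      have "u \<le> k" "Suc k \<le> v" unfolding u_def v_def using kS fS by auto
      then have uv: "u < v" by simp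
      have before: "\<not> g j" if "a \<le> j" "j < u" for j
      proof
        assume "g j"
        then have "j \<in> S" using that uv vS by (auto simp: S_def)
        then show False using that Min_le[OF fS] unfolding u_def by force
      qed
      have after: "\<not> g j" if "v < j" "j \<le> b" for j
      proof
        assume "g j"
        then have "j \<in> S" using that uv uS by (auto simp: S_def)
        then show False using that Max_ge[OF fS] unfolding v_def by force
      qed
      have gu: "g u" "a \<le> u" and gv: "g v" "v \<le> b" using uS vS by (simp_all add: S_def)
      \<comment> \<open>Here the negated conclusion enters: since positions 1 and
        \<open>n - 2\<close> are not complete to \<open>X - {t}\<close>, the last complete vertex
        \<open>v\<close> is nonadjacent to the end 0 and the first one \<open>u\<close> to the end
        \<open>n - 1\<close>. So these ends can start the forbidden paths.\<close>
      have v2: "2 \<le> v" using uv g1(1) gv by (cases "v = 1") auto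
      have u3: "u + 3 \<le> n" using uv g1(2) gu gv b n by (cases "u = n - 2") auto
      have bv: "even (b - v)"
      proof (rule ccontr)
        assume odd: "odd (b - v)"
        then have "v < b" by (cases "v < b") auto
        then have "b \<noteq> n - 1" using after[of b] g0 by auto
        show False
        proof (rule contra[of "rev (seg P v b)" b v 0])
          show "induced_path V E (rev (seg P v b))" using induced_path_rev[OF seg] gv b by simp
          show "set (rev (seg P v b)) \<subseteq> set P" using b by (auto simp: set_seg n_def)
          show "\<not> complete_to E w (X - {t})" if w: "w \<in> set (rev (seg P v b))" "w \<noteq> last (rev (seg P v b))" for w
          proof -
            obtain j where "v \<le> j" "j \<le> b" "w = P ! j" using w(1) by (auto simp: set_seg)
            moreover have "j \<noteq> v" using calculation w(2) gv by (auto simp: last_rev)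
            ultimately show ?thesis using after[of j] b by (auto simp: g_def)
          qed
          show "E t w \<longleftrightarrow> w = hd (rev (seg P v b))" if w: "w \<in> set (rev (seg P v b))" for w
          proof -
            obtain j where j: "v \<le> j" "j \<le> b" "w = P ! j" using w by (auto simp: set_seg)
            then have "d j \<longleftrightarrow> j = b" using nd[of j] uv gu ab by (cases "j = b") auto
            then show ?thesis using j b eqP[of j b] gv by (auto simp: d_def hd_rev)
          qed
          show "P ! 0 \<notin> set (rev (seg P v b))" using v2 b notin_seg[of 0 b v] by simp
          show "\<not> E (P ! 0) w" if w: "w \<in> set (rev (seg P v b))" for w
            using w v2 b adj[of 0] by (auto simp: set_seg)
          assume "length (rev (seg P v b)) = 2"
          then have b': "b = Suc v" using gv by simp
          show "\<exists>k. g k \<and> \<not> d k \<and> k \<noteq> b \<and> \<not> E (P ! k) (P ! b)"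
          \<comment> \<open>The extra vertex must be nonadjacent to \<open>t\<close> and to
            \<open>P ! b\<close>. The vertex at \<open>u\<close> qualifies unless it is a neighbour
            of \<open>t\<close>; then \<open>u = a = 0\<close>, the distance from \<open>u\<close>
            to \<open>v\<close> is odd, and \<open>btw\<close> gives a complete vertex strictly
            between them.\<close>
          proof (cases "d u")
            case False
            then show ?thesis using gu uv b' b adj[of u b] by (intro exI[of _ u]) auto
          next
            case True
            then have "u = a" using nd[of u] gu uv gv by (cases "u = a") auto
            moreover have "u = 0" using gd[OF gu(1) True] u3 by auto
            moreover have "b - a = (b - v) + (v - a)" using uv gu gv by simp
            ultimately have "odd (v - u)" "v \<noteq> Suc u" using odd ba v2 by (metis even_add, simp)
            then obtain j where j: "u < j" "j < v" "g j"
              using btw[OF uv gu(1) gv(1)] by blast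
            then show ?thesis using nd[of j] gu b' b adj[of j b] by (intro exI[of _ j]) auto
          qed
        qed (use gv g0 d0 b n odd \<open>v < b\<close> in \<open>auto simp: hd_rev last_rev\<close>)
      qed
      have ua: "even (u - a)"
      proof (rule ccontr)
        assume odd: "odd (u - a)"
        then have "a < u" by (cases "a < u") auto
        show False
        proof (rule contra[of "seg P a u" a u "n - 1"])
          show "induced_path V E (seg P a u)" using seg gu u3 by simp
          show "set (seg P a u) \<subseteq> set P" using u3 by (auto simp: set_seg n_def)
          show "\<not> complete_to E w (X - {t})" if w: "w \<in> set (seg P a u)" "w \<noteq> last (seg P a u)" for w
          proof -
            obtain j where "a \<le> j" "j \<le> u" "w = P ! j" using w(1) by (auto simp: set_seg)
            moreover have "j \<noteq> u" using calculation w(2) gu by auto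
            ultimately show ?thesis using before[of j] u3 by (auto simp: g_def)
          qed
          show "E t w \<longleftrightarrow> w = hd (seg P a u)" if w: "w \<in> set (seg P a u)" for w
          proof -
            obtain j where j: "a \<le> j" "j \<le> u" "w = P ! j" using w by (auto simp: set_seg)
            then have "d j \<longleftrightarrow> j = a" using nd[of j] uv gv ab by (cases "j = a") auto
            then show ?thesis using j u3 eqP[of j a] gu by (auto simp: d_def)
          qed
          show "P ! (n - 1) \<notin> set (seg P a u)" using u3 by (intro notin_seg) auto
          show "\<not> E (P ! (n - 1)) w" if w: "w \<in> set (seg P a u)" for w
            using w u3 adj[of "n - 1"] by (auto simp: set_seg)
          assume "length (seg P a u) = 2"
          then have u': "u = Suc a" using gu by simp
          show "\<exists>k. g k \<and> \<not> d k \<and> k \<noteq> a \<and> \<not> E (P ! k) (P ! a)"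
          proof (cases "d v")
            case False
            then show ?thesis using gv uv u' b adj[of v a] by (intro exI[of _ v]) auto
          next
            case True
            have "v = b" using True nd[of v] gu uv gv by (cases "v = b") auto
            have "v = n - 1" using gd[OF gv(1) True] v2 by auto
            have "v - a = (v - u) + (u - a)" using uv gu by simp
            have "v \<noteq> Suc u" using \<open>v = n - 1\<close> u3 by linarith
            moreover have "odd (v - u)" using odd ba \<open>v = b\<close> \<open>v - a = (v - u) + (u - a)\<close>
              by (metis even_add)
            ultimately obtain j where j: "u < j" "j < v" "g j"
              using btw[OF uv gu(1) gv(1)] by blast
            then show ?thesis using nd[of j] gv u' b adj[of j a] by (intro exI[of _ j]) auto
          qed
        qed (use gu g0 d0 b n odd ab u3 \<open>a < u\<close> in auto)
      qed
      have "even (count_pairs g u v) \<longleftrightarrow> even (v - u)"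
        by (rule count_pairs_parity) (use gu gv uv gap in auto)
      moreover have "even (v - u)" using bv ua ba uv gu gv by presburger
      moreover have "count_pairs g a u = 0"
        by (rule count_pairs_eq_0) (use before in auto)
      moreover have "count_pairs g v b = 0"
        by (rule count_pairs_eq_0) (use after in auto)
      moreover have "count_pairs g a b = count_pairs g a u + (count_pairs g u v + count_pairs g v b)"
        using gu gv uv by (simp add: count_pairs_split[of a u b] count_pairs_split[of u v b])
      ultimately show ?thesis by simp
    qed
  qed
  have "even (count_pairs g 0 (n - 1))"
    by (rule count_pairs_even[where d = d]) (use d0 even_gap in auto)
  moreover have "even (count_pairs g 0 (n - 1)) \<longleftrightarrow> even (n - 1 - 0)"
    by (rule count_pairs_parity) (use g0 gap in auto)
  ultimately show False using n by simp
qed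

text \<open>Rules out the last shape of a counterexample: \<open>X\<close> is a single antipath from
  \<open>x\<close> to \<open>y\<close>, the second vertex of \<open>P\<close> misses only
  \<open>x\<close> and the penultimate one only \<open>y\<close>. Edges complete to
  \<open>X - {x}\<close> and edges complete to \<open>X - {y}\<close> are both odd in number, and no
  edge is of both kinds or joins the two kinds, so together they are even in number. Checking the
  gaps of the union gives an odd number instead.\<close>

lemma no_antipath_counterexample:
  assumes X: "X \<subseteq> V" and Q: "induced_path V co Q" "set Q = X" "hd Q = x" "last Q = y" "x \<noteq> y"
    and RRx: "roussel_rubio V E (X - {x})" and RRy: "roussel_rubio V E (X - {y})"
    and RRxy: "X - {x, y} \<noteq> {} \<Longrightarrow> roussel_rubio V E (X - {x, y})"
    and P: "induced_path V E P" "set P \<inter> X = {}" "even (length P)" "6 \<le> length P"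
    and ends: "complete_to E (P ! 0) X" "complete_to E (P ! (length P - 1)) X"
    and int: "\<And>k. 0 < k \<Longrightarrow> Suc k < length P \<Longrightarrow> \<not> complete_to E (P ! k) X"
    and second: "complete_to E (P ! 1) (X - {x})" "complete_to E (P ! (length P - 2)) (X - {y})"
    and nlp: "\<not> has_long_prism V E"
  shows False
proof -
  interpret co: berge_graph V co by (rule berge_graph_co)
  define n where "n = length P"
  define sx where "sx k \<longleftrightarrow> k < n \<and> complete_to E (P ! k) (X - {x})" for k
  define sy where "sy k \<longleftrightarrow> k < n \<and> complete_to E (P ! k) (X - {y})" for k
  have n: "6 \<le> n" "even n" using P by (simp_all add: n_def)
  have adj: "E (P ! i) (P ! j) \<longleftrightarrow> j = Suc i \<or> i = Suc j" if "i < n" "j < n" for i j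
    using induced_path_adj[OF P(1)] that by (simp add: n_def)
  have eqP: "P ! i = P ! j \<longleftrightarrow> i = j" if "i < n" "j < n" for i j
    using induced_path_eq[OF P(1)] that by (simp add: n_def)
  have PV: "P ! i \<in> V" if "i < n" for i using path_inV[OF P(1)] that by (simp add: n_def)
  have PX: "P ! i \<notin> X" if "i < n" for i
    using P(2) nth_mem[of i P] that unfolding n_def by blast
  have notin_seg: "P ! e \<notin> set (seg P i j)" if "e < n" "j < n" "e < i \<or> j < e" for e i j
  proof
    assume "P ! e \<in> set (seg P i j)"
    then obtain k where "i \<le> k" "k \<le> j" "P ! e = P ! k" by (auto simp: set_seg)
    then show False using eqP[of e k] that by auto
  qed
  have seg: "induced_path V E (seg P i j)" if "i \<le> j" "j < n" for i j
    using induced_path_seg[OF P(1)] that by (simp add: n_def)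
  have seg_X: "z \<notin> set (seg P i j)" if "z \<in> X" "j < n" for z i j
  proof
    assume "z \<in> set (seg P i j)"
    then obtain k where "k \<le> j" "z = P ! k" by (auto simp: set_seg)
    then show False using PX[of k] that by auto
  qed
  have lenQ: "2 \<le> length Q"
  proof (rule ccontr)
    assume "\<not> 2 \<le> length Q"
    then have "length Q \<le> 1" by simp
    then show False using Q by (cases Q) (auto simp: induced_path_def)
  qed
  then have neQ: "Q \<noteq> []" by auto
  have xy: "x \<in> X" "y \<in> X" using Q neQ hd_in_set last_in_set by blast+
  have XV: "z \<in> V" if "z \<in> X" for z using X that by blast
  have E0: "E (P ! e) z" "\<not> co (P ! e) z" if "e = 0 \<or> e = n - 1" "z \<in> X" for e z
    using ends that by (auto simp: complete_to_def n_def compl_def)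
  have s0: "sx 0" "sx (n - 1)" "sy 0" "sy (n - 1)"
    using ends n by (auto simp: sx_def sy_def complete_to_def n_def)
  have s1: "sx 1" "sy (n - 2)" using second n by (auto simp: sx_def sy_def n_def)
  have nx: "\<not> E (P ! k) x" if "sx k" "0 < k" "k < n - 1" for k
  proof
    assume "E (P ! k) x"
    then have "complete_to E (P ! k) X" using that(1) by (auto simp: sx_def complete_to_def)
    then show False using int[of k] that by (simp add: n_def less_diff_conv)
  qed
  have ny: "\<not> E (P ! k) y" if "sy k" "0 < k" "k < n - 1" for k
  proof
    assume "E (P ! k) y"
    then have "complete_to E (P ! k) X" using that(1) by (auto simp: sy_def complete_to_def)
    then show False using int[of k] that by (simp add: n_def less_diff_conv)
  qed
  have sxE: "E (P ! k) z" if "sx k" "z \<in> X" "z \<noteq> x" for k z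
    using that by (auto simp: sx_def complete_to_def)
  have syE: "E (P ! k) z" if "sy k" "z \<in> X" "z \<noteq> y" for k z
    using that by (auto simp: sy_def complete_to_def)
  have disj: "k = 0 \<or> k = n - 1" if "sx k" "sy k" for k
  proof -
    have "\<not> (0 < k \<and> k < n - 1)" using nx[of k] syE[of k x] that xy Q(5) by blast
    then show ?thesis using that n by (simp add: sx_def) linarith
  qed
  have cox: "co (P ! k) z \<longleftrightarrow> z = x" if "sx k" "0 < k" "k < n - 1" "z \<in> X" for k z
  proof -
    have "k < n" using that(3) by simp
    then have "P ! k \<in> V" "P ! k \<noteq> z" using PV PX that(4) by auto
    then show ?thesis
      using nx[OF that(1-3)] sxE[OF that(1,4)] XV[OF that(4)] by (auto simp: co_iff)
  qed
  have coy: "co (P ! k) z \<longleftrightarrow> z = y" if "sy k" "0 < k" "k < n - 1" "z \<in> X" for k z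
  proof -
    have "k < n" using that(3) by simp
    then have "P ! k \<in> V" "P ! k \<noteq> z" using PV PX that(4) by auto
    then show ?thesis
      using ny[OF that(1-3)] syE[OF that(1,4)] XV[OF that(4)] by (auto simp: co_iff)
  qed
  have xpath: "induced_path V co (P ! k # Q)" if "sx k" "0 < k" "k < n - 1" for k
    by (rule co.induced_path_Cons[OF Q(1)]) (use that PV PX cox Q in auto)
  \<comment> \<open>\<open>P ! (n - 2)\<close> misses only \<open>P ! 1\<close> and \<open>y\<close>
    on the antipath \<open>P ! 1 # Q\<close>, so the three form an antihole with
    \<open>length Q + 2\<close> vertices.\<close>
  have "odd (length (P ! 1 # Q))"
  proof (rule co.odd_apex[OF xpath[OF s1(1)], where w = "P ! (n - 2)"])
    show "P ! (n - 2) \<notin> set (P ! 1 # Q)" using PX[of "n - 2"] eqP[of "n - 2" 1] n Q by auto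
    fix v assume v: "v \<in> set (P ! 1 # Q)"
    show "co (P ! (n - 2)) v \<longleftrightarrow> v = hd (P ! 1 # Q) \<or> v = last (P ! 1 # Q)"
    proof (cases "v = P ! 1")
      case True
      have "n - 2 \<noteq> 1" "n - 2 \<noteq> 2" using n by linarith+
      then have "co (P ! (n - 2)) (P ! 1)"
        using PV[of "n - 2"] PV[of 1] eqP[of "n - 2" 1] adj[of "n - 2" 1] n by (simp add: co_iff)
      then show ?thesis using True by simp
    next
      case False
      then have "v \<in> X" using v Q by simp
      then show ?thesis using coy[OF s1(2), of v] n False neQ Q(4) by simp
    qed
  qed (use n lenQ PV in auto)
  then have even_Q: "even (length Q)" by simp
  \<comment> \<open>If the two were adjacent, the antipath from \<open>P ! j\<close> through
    \<open>y\<close>, ..., \<open>x\<close> to \<open>P ! i\<close> would close, with an end of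
    \<open>P\<close> nonadjacent to both, to an antihole with \<open>length Q + 3\<close> vertices,
    an odd number.\<close>
  have nonadj: "\<not> E (P ! i) (P ! j)" if i: "sx i" "0 < i" "i < n - 1" and j: "sy j" "0 < j" "j < n - 1" for i j
  proof
    assume Eij: "E (P ! i) (P ! j)"
    have lt: "i < n" "j < n" using i(3) j(3) by simp_all
    then have ij: "j = Suc i \<or> i = Suc j" using Eij adj by blast
    have "P ! j \<noteq> P ! i" using Eij irr[of "P ! i"] by metis
    define B where "B = P ! j # rev (P ! i # Q)"
    have B: "induced_path V co B"
      unfolding B_def
    proof (rule co.induced_path_Cons[OF induced_path_rev[OF xpath[OF i]]])
      show "P ! j \<notin> set (rev (P ! i # Q))" using PX[OF lt(2)] \<open>P ! j \<noteq> P ! i\<close> Q by simp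
      fix v assume v: "v \<in> set (rev (P ! i # Q))"
      show "co (P ! j) v \<longleftrightarrow> v = hd (rev (P ! i # Q))"
      proof (cases "v = P ! i")
        case True
        moreover have "P ! i \<noteq> y" using PX[OF lt(1)] xy by auto
        moreover have "\<not> co (P ! j) (P ! i)" using Eij sym by (auto simp: compl_def)
        ultimately show ?thesis using neQ Q(4) by (simp add: hd_rev)
      next
        case False
        then have "v \<in> X" using v Q by simp
        then show ?thesis using coy[OF j, of v] neQ Q(4) by (simp add: hd_rev)
      qed
    qed (use j PV in auto)
    \<comment> \<open>Position 0 is nonadjacent to both vertices unless one of them is at 1; then
      the other is at 2, and position \<open>n - 1\<close> is far from both.\<close>
    define e where "e = (if 2 \<le> i \<and> 2 \<le> j then 0 else n - 1)"
    have e: "e < n" "e = 0 \<or> e = n - 1" "co (P ! e) (P ! i)" "co (P ! e) (P ! j)"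
    proof -
      show e: "e < n" "e = 0 \<or> e = n - 1" using n by (auto simp: e_def)
      have "e \<noteq> i" "e \<noteq> j" "e \<noteq> Suc i" "e \<noteq> Suc j" "i \<noteq> Suc e" "j \<noteq> Suc e"
        using i j ij n by (auto simp: e_def)
      then show "co (P ! e) (P ! i)" "co (P ! e) (P ! j)"
        using adj[OF e(1) lt(1)] adj[OF e(1) lt(2)] eqP[OF e(1) lt(1)] eqP[OF e(1) lt(2)]
          PV[OF e(1)] PV[OF lt(1)] PV[OF lt(2)] by (auto simp: co_iff)
    qed
    have setB: "set B = {P ! i, P ! j} \<union> X" using Q by (auto simp: B_def)
    have "odd (length B)"
    proof (rule co.odd_apex[OF B, where w = "P ! e"])
      show "P ! e \<notin> set B"
        using e(3,4) co.irr PX[OF e(1)] unfolding setB by auto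
      fix v assume v: "v \<in> set B"
      have last: "last B = P ! i" "hd B = P ! j" by (simp_all add: B_def)
      show "co (P ! e) v \<longleftrightarrow> v = hd B \<or> v = last B"
      proof (cases "v \<in> X")
        case True
        then have "v \<noteq> P ! i" "v \<noteq> P ! j" using PX lt by auto
        then show ?thesis using E0(2)[OF e(2) True] last by simp
      next
        case False
        then show ?thesis using v e last unfolding setB by auto
      qed
    qed (use e PV lenQ in \<open>auto simp: B_def\<close>)
    then show False using even_Q by (simp add: B_def)
  qed
  have gapX: "b = Suc a \<or> even (b - a)"
    if RR: "roussel_rubio V E (X - Z)" and ab: "a < b" "b < n"
      "complete_to E (P ! a) (X - Z)" "complete_to E (P ! b) (X - Z)"
      and btw: "\<And>k. a < k \<Longrightarrow> k < b \<Longrightarrow> \<not> complete_to E (P ! k) (X - Z)" for a b Z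
    by (rule roussel_rubio_gap[OF RR _ P(1) _ P(4)])
      (use ends X P(2) ab btw in \<open>auto simp: complete_to_def n_def\<close>)
  have oddx: "odd (count_pairs sx 0 (n - 1))"
  proof -
    have "even (count_pairs sx 0 (n - 1)) \<longleftrightarrow> even (n - 1 - 0)"
      by (rule count_pairs_parity) (use s0 gapX[OF RRx] in \<open>auto simp: sx_def\<close>)
    then show ?thesis using n by simp
  qed
  have oddy: "odd (count_pairs sy 0 (n - 1))"
  proof -
    have "even (count_pairs sy 0 (n - 1)) \<longleftrightarrow> even (n - 1 - 0)"
      by (rule count_pairs_parity) (use s0 gapX[OF RRy] in \<open>auto simp: sy_def\<close>)
    then show ?thesis using n by simp
  qed
  define c where "c k \<longleftrightarrow> sx k \<or> sy k" for k
  have "count_pairs c 0 (n - 1) = count_pairs sx 0 (n - 1) + count_pairs sy 0 (n - 1)"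
  proof -
    let ?S = "\<lambda>c. {k. 0 \<le> k \<and> k < n - 1 \<and> c k \<and> c (Suc k)}"
    have mixed: False if "k < n - 1" "sx k" "\<not> sy k" "sy (Suc k)" "\<not> sx (Suc k)" for k
    proof -
      have "k \<noteq> 0" "Suc k \<noteq> n - 1" using that s0 by metis+
      then have "0 < k" "k < n - 1" "Suc k < n - 1" "k < n" "Suc k < n" using that(1) by simp_all
      then show False using nonadj[of k "Suc k"] adj[of k "Suc k"] that by simp
    qed
    have mixed': False if "k < n - 1" "sy k" "\<not> sx k" "sx (Suc k)" "\<not> sy (Suc k)" for k
    proof -
      have "k \<noteq> 0" "Suc k \<noteq> n - 1" using that s0 by metis+
      then have "0 < k" "k < n - 1" "Suc k < n - 1" "k < n" "Suc k < n" using that(1) by simp_all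
      then show False using nonadj[of "Suc k" k] adj[of "Suc k" k] that by simp
    qed
    have "?S c = ?S sx \<union> ?S sy"
      using mixed mixed' by (auto simp: c_def)
    moreover have *: "?S sx \<inter> ?S sy = {}"
    proof (rule equals0I)
      fix k assume "k \<in> ?S sx \<inter> ?S sy"
      then show False using disj[of k] disj[of "Suc k"] n by auto
    qed
    moreover have "card (?S sx \<union> ?S sy) = card (?S sx) + card (?S sy)"
      using finite_pairs finite_pairs * by (rule card_Un_disjoint)
    ultimately show ?thesis
      unfolding count_pairs_def by (simp only:)
  qed
  then have even_c: "even (count_pairs c 0 (n - 1))" using oddx oddy by simp
  \<comment> \<open>The stretch from \<open>i\<close> to \<open>j\<close>, extended by
    \<open>x'\<close> and \<open>y'\<close>, is a path with ends \<open>x'\<close> and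
    \<open>y'\<close>. An end of \<open>P\<close> that does not touch the stretch sees only these
    two ends and closes an odd hole; \<open>far\<close> provides such an end.\<close>
  have two: False
    if X2: "X = {x', y'}" "\<not> E x' y'" "x' \<noteq> y'" and ij: "0 < i" "i < j" "j < n - 1" "odd (j - i)"
      and i: "E (P ! i) y'" "\<not> E (P ! i) x'" and j: "E (P ! j) x'" "\<not> E (P ! j) y'"
      and btw: "\<And>k. i < k \<Longrightarrow> k < j \<Longrightarrow> \<not> E (P ! k) x' \<and> \<not> E (P ! k) y'"
      and far: "2 \<le> i \<or> j + 3 \<le> n" for x' y' i j
  proof -
    have inV: "x' \<in> V" "y' \<in> V" using X X2 by auto
    have nP: "x' \<notin> set (seg P i j)" "y' \<notin> set (seg P i j)"
      using seg_X X2 ij by simp_all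
    have R: "induced_path V E (y' # seg P i j)"
    proof (rule induced_path_Cons[OF seg inV(2) nP(2)])
      fix v assume "v \<in> set (seg P i j)"
      then obtain k where k: "i \<le> k" "k \<le> j" "v = P ! k" by (auto simp: set_seg)
      then have "E v y' \<longleftrightarrow> k = i" using i j btw[of k] by (cases "k = i"; cases "k = j") auto
      then show "E y' v \<longleftrightarrow> v = hd (seg P i j)"
        using k ij eqP[of k i] sym_iff[of v y'] by simp
    qed (use ij in auto)
    have T: "induced_path V E (x' # rev (y' # seg P i j))"
    proof (rule induced_path_Cons[OF induced_path_rev[OF R] inV(1)])
      show "x' \<notin> set (rev (y' # seg P i j))" using nP X2 by auto
      fix v assume v: "v \<in> set (rev (y' # seg P i j))"
      show "E x' v \<longleftrightarrow> v = hd (rev (y' # seg P i j))"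
      proof (cases "v = y'")
        case True
        have "P ! j \<noteq> y'" using PX[of j] ij X2 by auto
        then show ?thesis using True X2 ij by (simp add: hd_rev)
      next
        case False
        then obtain k where k: "i \<le> k" "k \<le> j" "v = P ! k" using v by (auto simp: set_seg)
        then have "E v x' \<longleftrightarrow> k = j" using i j btw[of k] by (cases "k = i"; cases "k = j") auto
        then show ?thesis using k ij eqP[of k j] sym_iff[of v x'] by (simp add: hd_rev)
      qed
    qed
    define e where "e = (if 2 \<le> i then 0 else n - 1)"
    have e: "e < n" "e = 0 \<or> e = n - 1" using n by (auto simp: e_def)
    have "odd (length (x' # rev (y' # seg P i j)))"
    proof (rule odd_apex[OF T, where w = "P ! e"])
      have ek: "e \<noteq> k" "\<not> E (P ! e) (P ! k)" if "i \<le> k" "k \<le> j" for k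
        using adj[of e k] that ij far n by (auto simp: e_def split: if_splits)
      show "P ! e \<notin> set (x' # rev (y' # seg P i j))"
        using PX[of e] e X2 notin_seg[of e j i] ij far by (auto simp: e_def split: if_splits)
      fix v assume "v \<in> set (x' # rev (y' # seg P i j))"
      then consider "v = x'" | "v = y'" | k where "i \<le> k" "k \<le> j" "v = P ! k"
        by (auto simp: set_seg)
      then show "E (P ! e) v \<longleftrightarrow>
          v = hd (x' # rev (y' # seg P i j)) \<or> v = last (x' # rev (y' # seg P i j))"
      proof cases
        case (3 k)
        then have "v \<noteq> x'" "v \<noteq> y'" using PX[of k] ij X2 by auto
        then show ?thesis using ek[OF 3(1,2)] 3 by simp
      qed (use E0(1)[OF e(2)] X2 in auto)
    qed (use e PV ij in auto)
    then show False using ij by simp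
  qed
  \<comment> \<open>Now the stretch is the whole interior of \<open>P\<close>, so both ends of
    \<open>P\<close> touch it and \<open>two\<close> fails. Instead the triangles
    \<open>P ! 1, P ! 0, y\<close> and \<open>P ! (n - 2), x, P ! (n - 1)\<close> span a long prism:
    this is the leap of Roussel and Rubio.\<close>
  have leap: False
    if X2: "X = {x, y}" "\<not> E x y"
      and k: "\<And>k. 1 \<le> k \<Longrightarrow> k \<le> n - 2 \<Longrightarrow> E (P ! k) y \<longleftrightarrow> k = 1"
        "\<And>k. 1 \<le> k \<Longrightarrow> k \<le> n - 2 \<Longrightarrow> E (P ! k) x \<longleftrightarrow> k = n - 2"
  proof -
    have inV: "x \<in> V" "y \<in> V" using X X2 by auto
    have ne: "x \<noteq> P ! k" "y \<noteq> P ! k" if "k < n" for k using PX[OF that] X2 by auto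
    have Ee: "E (P ! 0) x" "E (P ! 0) y" "E (P ! (n - 1)) x" "E (P ! (n - 1)) y"
      using E0(1) X2 by auto
    note Ee' = Ee[THEN sym]
    have "prism_paths V E (seg P 1 (n - 2)) [P ! 0, x] [y, P ! (n - 1)]"
    proof (rule prism_pathsI[OF graph])
      show "induced_path V E (seg P 1 (n - 2))" using seg n by simp
      have single: "induced_path V E [v]" if "v \<in> V" for v
        using that irr by (simp add: induced_path_def)
      show "induced_path V E [P ! 0, x]"
        by (rule induced_path_Cons[OF single]) (use inV PV[of 0] n ne[of 0] Ee in auto)
      show "induced_path V E [y, P ! (n - 1)]"
        by (rule induced_path_Cons[OF single]) (use inV PV[of "n - 1"] n ne[of "n - 1"] Ee' in auto)
      have "P ! 0 \<notin> set (seg P 1 (n - 2))" "P ! (n - 1) \<notin> set (seg P 1 (n - 2))"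
        using n notin_seg[of 0 "n - 2" 1] notin_seg[of "n - 1" "n - 2" 1] by simp_all
      moreover have "x \<notin> set (seg P 1 (n - 2))" "y \<notin> set (seg P 1 (n - 2))"
        using seg_X X2 n by simp_all
      moreover have "distinct (seg P 1 (n - 2))"
        using seg[of 1 "n - 2"] n by (simp add: induced_path_def)
      ultimately show "distinct (seg P 1 (n - 2) @ [P ! 0, x] @ [y, P ! (n - 1)])"
        using ne[of 0] ne[of "n - 1"] Q(5) eqP[of 0 "n - 1"] n by auto
      show "E u v \<longleftrightarrow> u = hd (seg P 1 (n - 2)) \<and> v = hd [P ! 0, x] \<or>
          u = last (seg P 1 (n - 2)) \<and> v = last [P ! 0, x]"
        if uv: "u \<in> set (seg P 1 (n - 2))" "v \<in> set [P ! 0, x]" for u v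
      proof -
        obtain i where i: "1 \<le> i" "i \<le> n - 2" "u = P ! i" using uv(1) by (auto simp: set_seg)
        have in': "i < n" "0 < n" using i n by simp_all
        have "E u (P ! 0) \<longleftrightarrow> u = P ! 1" "u = P ! (n - 2) \<longleftrightarrow> i = n - 2"
          using adj[OF in'] eqP[OF in'(1), of 1] eqP[OF in'(1), of "n - 2"] i n by auto
        moreover have "E u x \<longleftrightarrow> i = n - 2" using k(2) i by simp
        ultimately show ?thesis using uv(2) n ne[OF in'(2)] by auto
      qed
      show "E u v \<longleftrightarrow> u = hd (seg P 1 (n - 2)) \<and> v = hd [y, P ! (n - 1)] \<or>
          u = last (seg P 1 (n - 2)) \<and> v = last [y, P ! (n - 1)]"
        if uv: "u \<in> set (seg P 1 (n - 2))" "v \<in> set [y, P ! (n - 1)]" for u v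
      proof -
        obtain i where i: "1 \<le> i" "i \<le> n - 2" "u = P ! i" using uv(1) by (auto simp: set_seg)
        have in': "i < n" "n - 1 < n" using i n by simp_all
        have "n - 1 = Suc i \<longleftrightarrow> i = n - 2" "i \<noteq> Suc (n - 1)" using i n by linarith+
        then have "E u (P ! (n - 1)) \<longleftrightarrow> u = P ! (n - 2)" "u = P ! 1 \<longleftrightarrow> i = 1"
          using adj[OF in'] eqP[OF in'(1), of 1] eqP[OF in'(1), of "n - 2"] i n by auto
        moreover have "E u y \<longleftrightarrow> i = 1" using k(1) i by simp
        ultimately show ?thesis using uv(2) n ne[OF in'(2)] by auto
      qed
      show "E u v \<longleftrightarrow> u = hd [P ! 0, x] \<and> v = hd [y, P ! (n - 1)] \<or>
          u = last [P ! 0, x] \<and> v = last [y, P ! (n - 1)]"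
        if uv: "u \<in> set [P ! 0, x]" "v \<in> set [y, P ! (n - 1)]" for u v
        using uv Ee Ee' X2(2) adj[of 0 "n - 1"] n ne[of 0] ne[of "n - 1"] by auto
    qed (use n in auto)
    moreover have "2 < length (seg P 1 (n - 2))" using n by simp
    ultimately show False using nlp unfolding has_long_prism_def by blast
  qed
  \<comment> \<open>Gaps with two ends of the same kind are covered by \<open>gapX\<close>. For
    mixed ends, the property of \<open>X - {x, y}\<close> is used when that set is nonempty, and
    \<open>two\<close> or \<open>leap\<close> otherwise.\<close>
  have gapc: "b = Suc a \<or> even (b - a)"
    if ab: "a < b" "b \<le> n - 1" "c a" "c b" and nc: "\<And>k. a < k \<Longrightarrow> k < b \<Longrightarrow> \<not> c k" for a b
  proof (rule ccontr)
    assume neg: "\<not> ?thesis"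
    have b: "b < n" using ab n by simp
    have "\<not> (sx a \<and> sx b)"
      using gapX[OF RRx ab(1) b] neg nc b by (auto simp: c_def sx_def)
    moreover have "\<not> (sy a \<and> sy b)"
      using gapX[OF RRy ab(1) b] neg nc b by (auto simp: c_def sy_def)
    ultimately have mixed: "sx a \<and> sy b \<and> \<not> sy a \<and> \<not> sx b \<or> sy a \<and> sx b \<and> \<not> sx a \<and> \<not> sy b"
      using ab by (auto simp: c_def)
    then have "a \<noteq> 0" "b \<noteq> n - 1" using s0 by metis+
    then have int_ab: "0 < a" "b < n - 1" using ab(2) by simp_all
    show False
    proof (cases "X - {x, y} = {}")
      case False
      then have "2 < length Q"
      proof -
        have "X = set Q" using Q by simp
        moreover have "set Q = {x, y}" if len: "length Q = 2"
        proof -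
          obtain u v where "Q = [u, v]" using len by (auto simp: numeral_2_eq_2 length_Suc_conv)
          then show ?thesis using Q by auto
        qed
        ultimately show ?thesis using False lenQ by (cases "length Q = 2") auto
      qed
      \<comment> \<open>A vertex complete to the inner part of \<open>Q\<close> and nonadjacent to
        both \<open>x\<close> and \<open>y\<close> would close \<open>Q\<close> to an antihole with
        \<open>length Q + 1\<close> vertices, an odd number. Hence a gap of \<open>c\<close> is also
        a gap for \<open>X - {x, y}\<close>.\<close>
      have ck: "c k" if "a < k" "k < b" "complete_to E (P ! k) (X - {x, y})" for k
      proof (rule ccontr)
        assume "\<not> c k"
        then have no: "\<not> E (P ! k) x" "\<not> E (P ! k) y"
          using that b by (auto simp: c_def sx_def sy_def complete_to_def)
        have "odd (length Q)"
        proof (rule co.odd_apex[OF Q(1), where w = "P ! k"])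
          fix v assume "v \<in> set Q"
          then show "co (P ! k) v \<longleftrightarrow> v = hd Q \<or> v = last Q"
            using no that Q PX[of k] PV[of k] XV[of v] b by (auto simp: co_iff complete_to_def)
        qed (use \<open>2 < length Q\<close> PV[of k] PX[of k] that b Q in auto)
        then show False using even_Q by simp
      qed
      have "b = Suc a \<or> even (b - a)"
      proof (rule gapX[OF RRxy[OF False] ab(1) b])
        show "complete_to E (P ! a) (X - {x, y})" "complete_to E (P ! b) (X - {x, y})"
          using ab by (auto simp: c_def sx_def sy_def complete_to_def)
        show "\<not> complete_to E (P ! k) (X - {x, y})" if "a < k" "k < b" for k
          using ck[OF that] nc[OF that] by blast
      qed
      then show False using neg by blast
    next
      case True
      then have X2: "X = {x, y}" using xy by blast
      have "\<not> E x y"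
      proof
        assume "E x y"
        then have "3 \<le> length Q"
          using Q by (intro induced_path_length3[OF Q(1)]) (auto simp: compl_def)
        moreover have "card (set Q) = length Q"
          using Q(1) by (intro distinct_card) (simp add: induced_path_def)
        ultimately show False using Q(2) X2 Q(5) by simp
      qed
      then have nE: "\<not> E x y" "\<not> E y x" using sym by blast+
      have btw: "\<not> E (P ! k) x \<and> \<not> E (P ! k) y" if "a < k" "k < b" for k
        using nc[OF that] that b X2 by (auto simp: c_def sx_def sy_def complete_to_def)
      from mixed show False
      proof
        assume m: "sx a \<and> sy b \<and> \<not> sy a \<and> \<not> sx b"
        have Ey: "E (P ! a) y" "\<not> E (P ! a) x" "E (P ! b) x" "\<not> E (P ! b) y"
          using m sxE[of a y] syE[of b x] nx[of a] ny[of b] int_ab ab xy Q(5) by auto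
        show False
        proof (cases "2 \<le> a \<or> b + 3 \<le> n")
          case True
          show False
            by (rule two[OF X2 nE(1) Q(5), of a b]) (use int_ab ab neg Ey btw True in auto)
        next
          case False
          then have ends': "a = 1" "b = n - 2" using int_ab b by auto
          show False
          proof (rule leap[OF X2 nE(1)])
            fix k assume k: "1 \<le> k" "k \<le> n - 2"
            show "E (P ! k) y \<longleftrightarrow> k = 1" "E (P ! k) x \<longleftrightarrow> k = n - 2"
              using k Ey btw[of k] ends' ab by (cases "k = 1"; cases "k = n - 2"; auto)+
          qed
        qed
      next
        assume m: "sy a \<and> sx b \<and> \<not> sx a \<and> \<not> sy b"
        have Ex: "E (P ! a) x" "\<not> E (P ! a) y" "E (P ! b) y" "\<not> E (P ! b) x"
          using m syE[of a x] sxE[of b y] ny[of a] nx[of b] int_ab ab xy Q(5) by auto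
        \<comment> \<open>With the kinds in this order the leap cannot occur: position 1 is of the
          kind \<open>sx\<close> and \<open>a\<close> is not, so \<open>2 \<le> a\<close> and the
          end 0 does not touch the stretch.\<close>
        have "a \<noteq> 1" using m s1 by auto
        then show False
          by (intro two[of y x a b]) (use int_ab ab neg Ex btw X2 nE Q(5) in auto)
      qed
    qed
  qed
  have "even (count_pairs c 0 (n - 1)) \<longleftrightarrow> even (n - 1 - 0)"
    by (rule count_pairs_parity) (use s0 gapc in \<open>auto simp: c_def\<close>)
  then show False using even_c n by simp
qed

section \<open>The Roussel-Rubio property by induction on the anticonnected set\<close>

text \<open>Drop from \<open>X\<close> a vertex \<open>t\<close> that leaves it anticonnected.
  Unless the conclusion already holds, the second or the penultimate vertex of \<open>P\<close> is
  complete to \<open>X - {t}\<close>. Two choices of \<open>t\<close> use different vertices of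
  \<open>P\<close>, since otherwise one of them would be \<open>X\<close>-complete; so there are at
  most two choices, and for long paths this forces \<open>X\<close> to be an antipath.\<close>

lemma roussel_rubio_holds:
  assumes nlp: "\<not> has_long_prism V E"
    and "X \<subseteq> V" "X \<noteq> {}" "\<not> disconnected_on co X"
  shows "roussel_rubio V E X"
  using assms(2-4)
proof (induction "card X" arbitrary: X rule: less_induct)
  case (less X)
  interpret co: berge_graph V co by (rule berge_graph_co)
  have finX: "finite X" using less.prems(1) fin finite_subset by blast
  have RR: "roussel_rubio V E Y" if "Y \<subset> X" "Y \<noteq> {}" "\<not> disconnected_on co Y" for Y
    using that less.hyps[of Y] psubset_card_mono[OF finX] less.prems(1) by blast
  show ?case
    unfolding roussel_rubio_def
  proof (rule allI, (rule impI)+)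
    fix P
    assume P: "induced_path V E P" "set P \<inter> X = {}" "even (length P)" "4 \<le> length P"
      and hl: "complete_to E (hd P) X" "complete_to E (last P) X"
      and int: "\<forall>v\<in>interior P. \<not> complete_to E v X"
    let ?goal = "length P = 4 \<and> (\<exists>Q. induced_path V co Q \<and> hd Q = P ! 1 \<and> last Q = P ! 2 \<and>
      interior Q \<subseteq> X \<and> even (length Q))"
    define n where "n = length P"
    have ends: "complete_to E (P ! 0) X" "complete_to E (P ! (n - 1)) X"
      using hl induced_path_hd_last[OF P(1)] by (simp_all add: n_def)
    have int': "\<not> complete_to E (P ! k) X" if "0 < k" "Suc k < n" for k
      using int that by (auto simp: set_interior n_def)
    have PX: "P ! i \<notin> X" if "i < n" for i
      using P(2) nth_mem[of i P] that unfolding n_def by blast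
    have PV: "P ! i \<in> V" if "i < n" for i using path_inV[OF P(1)] that by (simp add: n_def)
    show ?goal
    proof (cases "\<exists>x. X = {x}")
      case True
      then obtain x where x: "X = {x}" by blast
      have "odd (length P)"
      proof (rule odd_apex[OF P(1), where w = x])
        fix v assume v: "v \<in> set P"
        show "E x v \<longleftrightarrow> v = hd P \<or> v = last P"
          using set_path_cases[OF v] hl int x sym_iff[of x v] by (auto simp: complete_to_def)
      qed (use P x less.prems in auto)
      then show ?thesis using P by simp
    next
      case False
      obtain s where "s \<in> X" using less.prems by blast
      then obtain x where x: "x \<in> X - {s}" "\<not> disconnected_on co (X - {x})"
        using co.connected_on_remove[OF finX less.prems(3), of "{s}"] False by auto
      then obtain y where y: "y \<in> X - {x}" "\<not> disconnected_on co (X - {y})"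
        using co.connected_on_remove[OF finX less.prems(3), of "{x}"] False by auto
      have RRt: "roussel_rubio V E (X - {t})" if "t \<in> X" "\<not> disconnected_on co (X - {t})" for t
        using RR[of "X - {t}"] that False by blast
      have nb: "\<exists>z\<in>X - {t}. \<not> E t z" if "t \<in> X" for t
      proof -
        have "{t} \<subseteq> X" "{t} \<noteq> {}" "{t} \<noteq> X" using that False by auto
        then obtain r v where "r \<in> {t}" "v \<in> X - {t}" "co r v"
          by (rule connected_on_cut[OF less.prems(3)])
        then show ?thesis by (auto simp: compl_def)
      qed
      have xy: "x \<in> X" "y \<in> X" "x \<noteq> y" using x y by auto
      obtain Q where Q: "induced_path V co Q" "hd Q = x" "last Q = y" "set Q \<subseteq> X"
        using co.connected_on_obtain_path[OF less.prems(3,1) xy(1,2)] .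
      have neQ: "Q \<noteq> []" using Q(1) by (simp add: induced_path_def)
      have xQ: "x \<in> set Q" "y \<in> set Q" using Q neQ hd_in_set last_in_set by blast+
      have no2: False if "complete_to E (P ! k) (X - {t})" "complete_to E (P ! k) (X - {u})"
        "t \<noteq> u" "0 < k" "Suc k < n" for k t u
      proof -
        have "complete_to E (P ! k) X" using that(1-3) by (auto simp: complete_to_def)
        then show False using int' that by blast
      qed
      show ?thesis
      proof (cases "n = 4")
        case True
        have P_adj: "E (P ! i) (P ! j) \<longleftrightarrow> j = Suc i \<or> i = Suc j" if "i < 4" "j < 4" for i j
          using induced_path_adj[OF P(1)] that True by (simp add: n_def)
        have P_eq: "P ! i = P ! j \<longleftrightarrow> i = j" if "i < 4" "j < 4" for i j
          using induced_path_eq[OF P(1)] that True by (simp add: n_def)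
        have co_P: "co (P ! i) (P ! j) \<longleftrightarrow> i \<noteq> j \<and> j \<noteq> Suc i \<and> i \<noteq> Suc j" if "i < 4" "j < 4" for i j
          using P_adj[OF that] P_eq[OF that] PV[of i] PV[of j] that True by (auto simp: co_iff)
        have ex: "?goal \<or> complete_to E (P ! 1) (X - {t}) \<or> complete_to E (P ! 2) (X - {t})"
          if "t \<in> X" "\<not> disconnected_on co (X - {t})" for t
        proof (rule disjCI)
          assume no: "\<not> (complete_to E (P ! 1) (X - {t}) \<or> complete_to E (P ! 2) (X - {t}))"
          have "\<not> complete_to E v (X - {t})" if "v \<in> interior P" for v
          proof -
            obtain k where "0 < k" "Suc k < 4" "v = P ! k" using \<open>v \<in> interior P\<close> True by (auto simp: set_interior n_def)
            moreover then have "k = 1 \<or> k = 2" by linarith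
            ultimately show ?thesis using no by auto
          qed
          moreover have "complete_to E (hd P) (X - {t})" "complete_to E (last P) (X - {t})"
            using hl by (auto simp: complete_to_def)
          ultimately have "length P = 4 \<and> (\<exists>Q. induced_path V co Q \<and> hd Q = P ! 1 \<and> last Q = P ! 2 \<and>
              interior Q \<subseteq> X - {t} \<and> even (length Q))"
            using RRt[OF that] P unfolding roussel_rubio_def by blast
          then show ?goal by blast
        qed
        show ?goal
        proof (rule ccontr)
          assume neg: "\<not> ?goal"
          have "\<exists>i. (i = 1 \<or> i = 2) \<and> complete_to E (P ! i) (X - {x})"
            using ex[of x] x neg by blast
          then obtain i where i: "i = 1 \<or> i = 2" "complete_to E (P ! i) (X - {x})" by blast
          have "\<exists>j. (j = 1 \<or> j = 2) \<and> complete_to E (P ! j) (X - {y})"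
            using ex[of y] y neg by blast
          then obtain j where j: "j = 1 \<or> j = 2" "complete_to E (P ! j) (X - {y})" by blast
          have "i \<noteq> j" using no2[of i x y] i j xy True by auto
          have lt: "i < n" "j < n" "0 < i" "0 < j" "Suc i < n" "Suc j < n" using i j True by auto
          have cox: "co (P ! i) z \<longleftrightarrow> z = x" if "z \<in> set Q" for z
          proof -
            have "z \<in> X" using that Q by blast
            then have "E (P ! i) z \<longleftrightarrow> z \<noteq> x"
              using i(2) int'[OF lt(3,5)] by (auto simp: complete_to_def)
            then show ?thesis using PV[OF lt(1)] PX[OF lt(1)] \<open>z \<in> X\<close> less.prems(1) by (auto simp: co_iff)
          qed
          have coy: "co (P ! j) z \<longleftrightarrow> z = y" if "z \<in> set Q" for z
          proof -
            have "z \<in> X" using that Q by blast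
            then have "E (P ! j) z \<longleftrightarrow> z \<noteq> y"
              using j(2) int'[OF lt(4,6)] by (auto simp: complete_to_def)
            then show ?thesis using PV[OF lt(2)] PX[OF lt(2)] \<open>z \<in> X\<close> less.prems(1) by (auto simp: co_iff)
          qed
          have PQ: "P ! k \<notin> set Q" if "k < 4" for k using PX[of k] Q(4) that True by blast
          have L1: "induced_path V co (P ! i # Q)"
            by (rule co.induced_path_Cons[OF Q(1)]) (use cox PV lt PQ[of i] Q True in auto)
          \<comment> \<open>Up to orientation this is the wanted antipath between the inner vertices
            of \<open>P\<close>. Its parity comes from the antihole that it forms together with
            \<open>P ! 3\<close> and \<open>P ! 0\<close>.\<close>
          define L where "L = P ! j # rev (P ! i # Q)"
          have L: "induced_path V co L"
            unfolding L_def
          proof (rule co.induced_path_Cons[OF induced_path_rev[OF L1]])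
            show "P ! j \<notin> set (rev (P ! i # Q))"
              using PQ[of j] P_eq[of i j] lt \<open>i \<noteq> j\<close> True by simp
            fix v assume v: "v \<in> set (rev (P ! i # Q))"
            have hd: "hd (rev (P ! i # Q)) = y" using neQ Q by (simp add: hd_rev)
            show "co (P ! j) v \<longleftrightarrow> v = hd (rev (P ! i # Q))"
            proof (cases "v = P ! i")
              case True
              have "\<not> co (P ! j) (P ! i)" using co_P[of j i] i j \<open>i \<noteq> j\<close> by auto
              moreover have "P ! i \<noteq> y" using xQ PQ[of i] lt \<open>n = 4\<close> by auto
              ultimately show ?thesis using True hd by simp
            qed (use v coy hd in auto)
          qed (use lt PV in auto)
          define M where "M = (if j = 1 then L else rev L)"
          have ij: "i = 2 \<and> j = 1 \<or> i = 1 \<and> j = 2" using i j \<open>i \<noteq> j\<close> by auto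
          have M: "induced_path V co M" "hd M = P ! 1" "last M = P ! 2"
            "set M = {P ! 1, P ! 2} \<union> set Q" "length M = length Q + 2" "interior M = set Q"
            using L induced_path_rev[OF L] ij unfolding M_def
            by (auto simp: L_def hd_rev last_rev interior_def)
          have MV: "P ! 3 \<notin> set M" "P ! 0 \<notin> set (P ! 3 # M)"
            using M(4) PQ[of 0] PQ[of 3] P_eq[of 0] P_eq[of 3] by auto
          have coQ: "\<not> co (P ! 0) v" "\<not> co (P ! 3) v" if "v \<in> set Q" for v
            using ends that Q(4) True by (auto simp: complete_to_def compl_def)
          have M3: "induced_path V co (P ! 3 # M)"
          proof (rule co.induced_path_Cons[OF M(1) _ MV(1)])
            fix v assume "v \<in> set M"
            then show "co (P ! 3) v \<longleftrightarrow> v = hd M"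
              using M(2,4) coQ(2)[of v] co_P[of 3 1] co_P[of 3 2] PQ[of 1] P_eq[of 1 2] by auto
          qed (use PV True in auto)
          have "odd (length (P ! 3 # M))"
          proof (rule co.odd_apex[OF M3 _ _ MV(2)])
            fix v assume v: "v \<in> set (P ! 3 # M)"
            have "last (P ! 3 # M) = P ! 2" using M by (auto simp: neQ)
            then show "co (P ! 0) v \<longleftrightarrow> v = hd (P ! 3 # M) \<or> v = last (P ! 3 # M)"
              using v M(4) coQ(1)[of v] co_P[of 0 1] co_P[of 0 2] co_P[of 0 3] PQ[of 2] PQ[of 3]
                P_eq[of 1 2] P_eq[of 1 3] by auto
          qed (use PV True M(5) in auto)
          then have "even (length M)" by simp
          moreover have "interior M \<subseteq> X" using M(6) Q(4) by simp
          moreover have "length P = 4" using True by (simp add: n_def)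
          ultimately show False using neg M(1-3) by blast
        qed
      next
        case False
        then have n6: "6 \<le> length P" using P by (simp add: n_def) presburger
        have pen: "complete_to E (P ! 1) (X - {t}) \<or> complete_to E (P ! (n - 2)) (X - {t})"
          if "t \<in> X" "\<not> disconnected_on co (X - {t})" for t
          using penultimate_complete[OF RRt[OF that] less.prems(1) that(1) nb[OF that(1)] P(1-3) n6]
            ends int' by (simp add: n_def)
        have pos: "0 < (1::nat)" "Suc 1 < n" "0 < n - 2" "Suc (n - 2) < n" using n6 by (simp_all add: n_def)
        \<comment> \<open>A removable vertex \<open>z\<close> outside \<open>Q\<close> would be a
          third choice: two of \<open>x\<close>, \<open>y\<close>, \<open>z\<close> would share
          \<open>P ! 1\<close> or \<open>P ! (n - 2)\<close>, making that vertex
          \<open>X\<close>-complete.\<close>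
        have setQ: "set Q = X"
        proof (rule ccontr)
          assume "set Q \<noteq> X"
          then obtain z where z: "z \<in> X - set Q" "\<not> disconnected_on co (X - {z})"
            using co.connected_on_remove[OF finX less.prems(3) Q(4) _ _ co.connected_on_path[OF Q(1)]] neQ
            by auto
          have "z \<noteq> x" "z \<noteq> y" using z xQ by auto
          then show False
            using pen[of x] pen[of y] pen[of z] x y z xy no2[OF _ _ _ pos(1,2)] no2[OF _ _ _ pos(3,4)]
            by (metis DiffD1)
        qed
        \<comment> \<open>Stated for both orientations of the antipath, because it is not known
          which of \<open>x\<close> and \<open>y\<close> is missed by \<open>P ! 1\<close>.\<close>
        have core: False
          if R: "induced_path V co R" "set R = X" "hd R = u" "last R = v" "u \<noteq> v"
            and uv: "u \<in> X" "v \<in> X" "\<not> disconnected_on co (X - {u})" "\<not> disconnected_on co (X - {v})"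
            and s: "complete_to E (P ! 1) (X - {u})" "complete_to E (P ! (n - 2)) (X - {v})" for R u v
        proof (rule no_antipath_counterexample[OF less.prems(1) R RRt[OF uv(1,3)] RRt[OF uv(2,4)] _ P(1-3) n6])
          assume ne: "X - {u, v} \<noteq> {}"
          have "X - {u, v} = interior R"
          proof -
            have dist: "distinct R" using R(1) by (simp add: induced_path_def)
            have "u \<notin> interior R" "v \<notin> interior R"
            proof -
              have ind: "R ! 0 = u" "R ! (length R - 1) = v" using R induced_path_hd_last[OF R(1)] by auto
              show "u \<notin> interior R"
                using dist ind(1) nth_eq_iff_index_eq[OF dist] by (fastforce simp: set_interior)
              show "v \<notin> interior R"
                using dist ind(2) nth_eq_iff_index_eq[OF dist] by (fastforce simp: set_interior)
            qed
            moreover have "interior R \<subseteq> set R" by (auto simp: set_interior)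
            ultimately show ?thesis using set_path_cases[of _ R] R by blast
          qed
          then show "roussel_rubio V E (X - {u, v})"
            using RR[of "X - {u, v}"] co.connected_on_interior[OF R(1)] ne uv by auto
        qed (use ends int' s nlp in \<open>simp_all add: n_def\<close>)
        have revQ: "induced_path V co (rev Q)" "set (rev Q) = X" "hd (rev Q) = y" "last (rev Q) = x"
          using induced_path_rev[OF Q(1)] setQ Q neQ by (simp_all add: hd_rev last_rev)
        consider "complete_to E (P ! 1) (X - {x})" "complete_to E (P ! (n - 2)) (X - {y})"
          | "complete_to E (P ! 1) (X - {y})" "complete_to E (P ! (n - 2)) (X - {x})"
          using pen[OF xy(1) x(2)] pen[OF xy(2) y(2)] no2[OF _ _ xy(3) pos(1,2)] no2[OF _ _ xy(3) pos(3,4)]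
          by blast
        then have False
          using core[OF Q(1) setQ Q(2,3) xy(3) xy(1,2) x(2) y(2)]
            core[OF revQ xy(3)[symmetric] xy(2,1) y(2) x(2)] by cases blast+
        then show ?thesis ..
      qed
    qed
  qed
qed

end

section \<open>Balanced skew partitions\<close>

text \<open>Ends of an antipath are adjacent iff they are distinct and nonadjacent in the complement; hence the
  antipath half of balance for \<open>(A, B)\<close> is \<open>no_odd_path V (compl V E) B A\<close>.\<close>

definition no_odd_path :: "'a set \<Rightarrow> ('a \<Rightarrow> 'a \<Rightarrow> bool) \<Rightarrow> 'a set \<Rightarrow> 'a set \<Rightarrow> bool" where
  "no_odd_path V E A B \<longleftrightarrow> (\<forall>P. induced_path V E P \<longrightarrow> hd P \<in> B \<longrightarrow> last P \<in> B \<longrightarrow> hd P \<noteq> last P \<longrightarrow>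
     \<not> E (hd P) (last P) \<longrightarrow> interior P \<subseteq> A \<longrightarrow> odd (length P))"

lemma no_odd_pathI:
  assumes "\<And>P. induced_path V E P \<Longrightarrow> hd P \<in> B \<Longrightarrow> last P \<in> B \<Longrightarrow> hd P \<noteq> last P \<Longrightarrow>
    \<not> E (hd P) (last P) \<Longrightarrow> interior P \<subseteq> A \<Longrightarrow> even (length P) \<Longrightarrow> 4 \<le> length P \<Longrightarrow> False"
  shows "no_odd_path V E A B"
  unfolding no_odd_path_def
proof (rule allI, (rule impI)+, rule ccontr)
  fix P assume P: "induced_path V E P" "hd P \<in> B" "last P \<in> B" "hd P \<noteq> last P"
    "\<not> E (hd P) (last P)" "interior P \<subseteq> A" "\<not> odd (length P)"
  have "3 \<le> length P" by (rule induced_path_length3[OF P(1,4,5)])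
  then have "4 \<le> length P" using P(7) by presburger
  then show False using assms P by blast
qed

lemma no_odd_pathD:
  assumes "no_odd_path V E A B" "induced_path V E P" "hd P \<in> B" "last P \<in> B" "hd P \<noteq> last P"
    "\<not> E (hd P) (last P)" "interior P \<subseteq> A"
  shows "odd (length P)"
  using assms unfolding no_odd_path_def by blast

lemma no_odd_path_single_end: "no_odd_path V E A {b}"
  by (rule no_odd_pathI) auto

lemma no_odd_path_single_interior: "no_odd_path V E {a} B"
proof (rule no_odd_pathI)
  fix P assume P: "induced_path V E P" "interior P \<subseteq> {a}" "4 \<le> length P"
  then have "P ! 1 \<in> interior P" "P ! 2 \<in> interior P"
    unfolding set_interior by force+
  then have "P ! 1 = P ! 2" using P(2) by auto
  then show False using induced_path_eq[OF P(1), of 1 2] P(3) by simp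
qed

section \<open>Skew partitions with a fixed split of both sides\<close>

text \<open>With both splits fixed, complementation merely exchanges the two pairs of parts, and
  single parts can be taken to be components or anticomponents.\<close>

definition skew4 :: "'a set \<Rightarrow> ('a \<Rightarrow> 'a \<Rightarrow> bool) \<Rightarrow> 'a set \<Rightarrow> 'a set \<Rightarrow> 'a set \<Rightarrow> 'a set \<Rightarrow> bool" where
  "skew4 V E A\<^sub>1 A\<^sub>2 B\<^sub>1 B\<^sub>2 \<longleftrightarrow>
     A\<^sub>1 \<noteq> {} \<and> A\<^sub>2 \<noteq> {} \<and> B\<^sub>1 \<noteq> {} \<and> B\<^sub>2 \<noteq> {} \<and>
     A\<^sub>1 \<union> A\<^sub>2 \<union> B\<^sub>1 \<union> B\<^sub>2 = V \<and> A\<^sub>1 \<inter> A\<^sub>2 = {} \<and> B\<^sub>1 \<inter> B\<^sub>2 = {} \<and> (A\<^sub>1 \<union> A\<^sub>2) \<inter> (B\<^sub>1 \<union> B\<^sub>2) = {} \<and>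
     (\<forall>a\<in>A\<^sub>1. \<forall>a'\<in>A\<^sub>2. \<not> E a a') \<and> (\<forall>b\<in>B\<^sub>1. \<forall>b'\<in>B\<^sub>2. E b b')"

lemma skew_partition_skew4:
  assumes "skew_partition V E A B"
  obtains A\<^sub>1 A\<^sub>2 B\<^sub>1 B\<^sub>2 where "skew4 V E A\<^sub>1 A\<^sub>2 B\<^sub>1 B\<^sub>2" "A = A\<^sub>1 \<union> A\<^sub>2" "B = B\<^sub>1 \<union> B\<^sub>2"
proof -
  have AB: "disconnected_on E A" "disconnected_on (compl V E) B" "A \<inter> B = {}" "A \<union> B = V"
    using assms by (simp_all add: skew_partition_def)
  obtain A\<^sub>1 A\<^sub>2 where A: "A\<^sub>1 \<noteq> {}" "A\<^sub>2 \<noteq> {}" "A\<^sub>1 \<inter> A\<^sub>2 = {}" "A = A\<^sub>1 \<union> A\<^sub>2" "\<forall>x\<in>A\<^sub>1. \<forall>y\<in>A\<^sub>2. \<not> E x y"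
    using AB(1) by (rule disconnected_onE)
  obtain B\<^sub>1 B\<^sub>2 where B: "B\<^sub>1 \<noteq> {}" "B\<^sub>2 \<noteq> {}" "B\<^sub>1 \<inter> B\<^sub>2 = {}" "B = B\<^sub>1 \<union> B\<^sub>2"
      "\<forall>x\<in>B\<^sub>1. \<forall>y\<in>B\<^sub>2. \<not> compl V E x y"
    using AB(2) by (rule disconnected_onE)
  have "\<forall>x\<in>B\<^sub>1. \<forall>y\<in>B\<^sub>2. E x y"
    using B AB(4) by (auto simp: compl_def)
  then have "skew4 V E A\<^sub>1 A\<^sub>2 B\<^sub>1 B\<^sub>2"
    unfolding skew4_def using A B AB by auto
  then show thesis using A B that by blast
qed

context sgraph
begin

lemma skew4_co:
  assumes S: "skew4 V E A\<^sub>1 A\<^sub>2 B\<^sub>1 B\<^sub>2"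
  shows "skew4 V co B\<^sub>1 B\<^sub>2 A\<^sub>1 A\<^sub>2"
proof -
  have "\<forall>b\<in>B\<^sub>1. \<forall>b'\<in>B\<^sub>2. \<not> co b b'"
    using S by (simp add: skew4_def compl_def)
  moreover have "\<forall>a\<in>A\<^sub>1. \<forall>a'\<in>A\<^sub>2. co a a'"
  proof (intro ballI)
    fix a a' assume "a \<in> A\<^sub>1" "a' \<in> A\<^sub>2"
    then show "co a a'" using S by (auto simp: skew4_def compl_def)
  qed
  moreover have "B\<^sub>1 \<union> B\<^sub>2 \<union> A\<^sub>1 \<union> A\<^sub>2 = V" "(B\<^sub>1 \<union> B\<^sub>2) \<inter> (A\<^sub>1 \<union> A\<^sub>2) = {}"
    using S by (simp_all add: skew4_def ac_simps Int_commute)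
  ultimately show ?thesis using S by (simp add: skew4_def)
qed

lemma skew4_swap_left:
  assumes S: "skew4 V E A\<^sub>1 A\<^sub>2 B\<^sub>1 B\<^sub>2"
  shows "skew4 V E A\<^sub>2 A\<^sub>1 B\<^sub>1 B\<^sub>2"
proof -
  have "\<forall>a\<in>A\<^sub>2. \<forall>a'\<in>A\<^sub>1. \<not> E a a'"
    using S sym_iff by (metis skew4_def)
  then show ?thesis using S by (simp add: skew4_def Un_commute Int_commute)
qed

lemma skew4_swap_right:
  assumes S: "skew4 V E A\<^sub>1 A\<^sub>2 B\<^sub>1 B\<^sub>2"
  shows "skew4 V E A\<^sub>1 A\<^sub>2 B\<^sub>2 B\<^sub>1"
proof -
  have "\<forall>b\<in>B\<^sub>2. \<forall>b'\<in>B\<^sub>1. E b b'"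
    using S sym_iff by (metis skew4_def)
  moreover have "A\<^sub>1 \<union> A\<^sub>2 \<union> B\<^sub>2 \<union> B\<^sub>1 = V"
    using S by (simp add: skew4_def ac_simps)
  ultimately show ?thesis using S by (simp add: skew4_def Un_commute Int_commute)
qed

lemma skew4_partition:
  assumes "skew4 V E A\<^sub>1 A\<^sub>2 B\<^sub>1 B\<^sub>2"
  shows "skew_partition V E (A\<^sub>1 \<union> A\<^sub>2) (B\<^sub>1 \<union> B\<^sub>2)"
  unfolding skew_partition_def
proof (intro conjI)
  show "disconnected_on E (A\<^sub>1 \<union> A\<^sub>2)"
    by (rule disconnected_onI[of A\<^sub>1 A\<^sub>2]) (use assms in \<open>auto simp: skew4_def\<close>)
  show "disconnected_on co (B\<^sub>1 \<union> B\<^sub>2)"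
    by (rule disconnected_onI[of B\<^sub>1 B\<^sub>2]) (use assms in \<open>auto simp: skew4_def compl_def\<close>)
qed (use assms in \<open>auto simp: skew4_def\<close>)

lemma balanced_iff:
  "balanced_skew_partition V E A B \<longleftrightarrow>
     skew_partition V E A B \<and> no_odd_path V E A B \<and> no_odd_path V co B A"
proof -
  \<comment> \<open>Paths are nonempty, so the subtraction in the edge length is not
    truncated.\<close>
  have e: "odd (length P - 1) \<longleftrightarrow> even (length P)" if "induced_path V F P" for P :: "'a list" and F
    using that by (cases P) (auto simp: induced_path_def)
  have "(\<exists>xs. induced_path V E xs \<and> hd xs \<in> B \<and> last xs \<in> B \<and> hd xs \<noteq> last xs
      \<and> \<not> E (hd xs) (last xs) \<and> interior xs \<subseteq> A \<and> odd (length xs - 1)) \<longleftrightarrow> \<not> no_odd_path V E A B"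
    unfolding no_odd_path_def using e[of E] by blast
  moreover have "(\<exists>xs. induced_antipath V E xs \<and> hd xs \<in> A \<and> last xs \<in> A
      \<and> E (hd xs) (last xs) \<and> interior xs \<subseteq> B \<and> odd (length xs - 1)) \<longleftrightarrow> \<not> no_odd_path V co B A"
  proof -
    have "E (hd P) (last P) \<longleftrightarrow> hd P \<noteq> last P \<and> \<not> co (hd P) (last P)" if "induced_path V co P" for P
    proof -
      have "hd P \<in> V" "last P \<in> V" using that by (auto simp: induced_path_def)
      then show ?thesis using irr by (auto simp: compl_def)
    qed
    then show ?thesis
      unfolding no_odd_path_def induced_antipath_def using e[of co] by metis
  qed
  ultimately show ?thesis unfolding balanced_skew_partition_def by blast
qed

lemma balanced_co:
  assumes "balanced_skew_partition V co B A"
  shows "balanced_skew_partition V E A B"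
proof -
  interpret co: sgraph V co by (rule sgraph_co)
  show ?thesis
    using assms unfolding balanced_iff co.balanced_iff co_co
    by (auto simp: skew_partition_def co_co)
qed

text \<open>The interior of a path is connected and so stays inside one part of \<open>A\<close>;
  nonadjacent ends lie in the same part of \<open>B\<close>. Balance thus reduces to single pairs of
  parts.\<close>

lemma no_odd_path_Un:
  assumes "\<forall>a\<in>A\<^sub>1. \<forall>a'\<in>A\<^sub>2. \<not> E a a'" "A\<^sub>1 \<inter> A\<^sub>2 = {}" "\<forall>b\<in>B\<^sub>1. \<forall>b'\<in>B\<^sub>2. E b b'"
    and n: "no_odd_path V E A\<^sub>1 B\<^sub>1" "no_odd_path V E A\<^sub>1 B\<^sub>2" "no_odd_path V E A\<^sub>2 B\<^sub>1" "no_odd_path V E A\<^sub>2 B\<^sub>2"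
  shows "no_odd_path V E (A\<^sub>1 \<union> A\<^sub>2) (B\<^sub>1 \<union> B\<^sub>2)"
proof (rule no_odd_pathI)
  fix P assume P: "induced_path V E P" "hd P \<in> B\<^sub>1 \<union> B\<^sub>2" "last P \<in> B\<^sub>1 \<union> B\<^sub>2" "hd P \<noteq> last P"
    "\<not> E (hd P) (last P)" "interior P \<subseteq> A\<^sub>1 \<union> A\<^sub>2" "even (length P)"
  have "interior P \<subseteq> A\<^sub>1 \<or> interior P \<subseteq> A\<^sub>2"
  proof (rule ccontr)
    assume "\<not> ?thesis"
    then have "disconnected_on E (interior P)"
      by (intro disconnected_onI[of "interior P \<inter> A\<^sub>1" "interior P \<inter> A\<^sub>2"]) (use P(6) assms(1,2) in auto)
    then show False using connected_on_interior[OF P(1)] by simp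
  qed
  moreover have "hd P \<in> B\<^sub>1 \<and> last P \<in> B\<^sub>1 \<or> hd P \<in> B\<^sub>2 \<and> last P \<in> B\<^sub>2"
    using P(2,3,5) assms(3) sym by blast
  ultimately show False
    using n[THEN no_odd_pathD, OF P(1) _ _ P(4,5)] P(7) by blast
qed

lemma balanced_skew4:
  assumes "skew4 V E A\<^sub>1 A\<^sub>2 B\<^sub>1 B\<^sub>2"
    and "no_odd_path V E A\<^sub>1 B\<^sub>1" "no_odd_path V E A\<^sub>1 B\<^sub>2" "no_odd_path V E A\<^sub>2 B\<^sub>1" "no_odd_path V E A\<^sub>2 B\<^sub>2"
    and "no_odd_path V co B\<^sub>1 A\<^sub>1" "no_odd_path V co B\<^sub>1 A\<^sub>2" "no_odd_path V co B\<^sub>2 A\<^sub>1" "no_odd_path V co B\<^sub>2 A\<^sub>2"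
  shows "\<exists>A B. balanced_skew_partition V E A B"
proof -
  interpret co: sgraph V co by (rule sgraph_co)
  have "no_odd_path V E (A\<^sub>1 \<union> A\<^sub>2) (B\<^sub>1 \<union> B\<^sub>2)"
    by (rule no_odd_path_Un) (use assms in \<open>auto simp: skew4_def\<close>)
  moreover have "no_odd_path V co (B\<^sub>1 \<union> B\<^sub>2) (A\<^sub>1 \<union> A\<^sub>2)"
    by (rule co.no_odd_path_Un) (use skew4_co[OF assms(1)] assms in \<open>auto simp: skew4_def\<close>)
  ultimately show ?thesis
    using skew4_partition[OF assms(1)] balanced_iff by blast
qed

lemma induced_path_append:
  assumes "induced_path V E P" "induced_path V E Q" "set P \<inter> set Q = {}"
    and "\<And>u v. u \<in> set P \<Longrightarrow> v \<in> set Q \<Longrightarrow> E u v \<longleftrightarrow> u = last P \<and> v = hd Q"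
  shows "induced_path V E (P @ Q)"
  using assms
proof (induction P)
  case Nil
  then show ?case by simp
next
  case (Cons a P)
  show ?case
  proof (cases "P = []")
    case True
    then show ?thesis
      using Cons.prems induced_path_Cons[OF Cons.prems(2), of a] by (auto simp: induced_path_def)
  next
    case False
    have dist: "a \<notin> set P" "a \<in> V" using Cons.prems(1) by (auto simp: induced_path_def)
    have adj: "E a v \<longleftrightarrow> v = hd P" if v: "v \<in> set P" for v
    proof -
      obtain k where k: "k < length P" "v = P ! k" using v by (auto simp: in_set_conv_nth)
      have "E a v \<longleftrightarrow> k = 0"
        using induced_path_adj[OF Cons.prems(1), of 0 "Suc k"] k by simp
      moreover have "v = hd P \<longleftrightarrow> k = 0"
        using Cons.prems(1) k False by (auto simp: induced_path_def hd_conv_nth nth_eq_iff_index_eq)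
      ultimately show ?thesis by simp
    qed
    have "induced_path V E (seg (a # P) 1 (length P))"
      by (rule induced_path_seg[OF Cons.prems(1)]) (use False in \<open>auto simp: Suc_le_eq\<close>)
    moreover have "seg (a # P) 1 (length P) = P" by (rule nth_equalityI) auto
    ultimately have P: "induced_path V E P" by simp
    have "induced_path V E (P @ Q)"
      by (rule Cons.IH) (use P Cons.prems False in auto)
    then have "induced_path V E (a # (P @ Q))"
    proof (rule induced_path_Cons[OF _ dist(2)])
      show "a \<notin> set (P @ Q)" using dist Cons.prems(3) by auto
      fix v assume "v \<in> set (P @ Q)"
      then consider "v \<in> set P" | "v \<in> set Q" by auto
      then show "E a v \<longleftrightarrow> v = hd (P @ Q)"
      proof cases
        case 1
        then show ?thesis using adj False by simp
      next
        case 2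
        then have "\<not> E a v" using Cons.prems(4)[of a v] dist False by auto
        moreover have "v \<noteq> hd P"
          using 2 hd_in_set[OF False] Cons.prems(3) by (metis disjoint_iff list.set_intros(2))
        ultimately show ?thesis using False by simp
      qed
    qed
    then show ?thesis by simp
  qed
qed

end

section \<open>Excluding odd paths between two parts\<close>

context berge_graph
begin

text \<open>Together with \<open>b\<close>, an odd path with ends in \<open>Y\<close> and interior
  in \<open>K\<close> would form an odd hole.\<close>

lemma no_odd_path_cone:
  assumes "b \<in> V" "\<forall>y\<in>Y. E b y" "\<forall>k\<in>K. \<not> E b k" "b \<notin> K"
  shows "no_odd_path V E K Y"
proof (rule no_odd_pathI)
  fix P assume P: "induced_path V E P" "hd P \<in> Y" "last P \<in> Y" "interior P \<subseteq> K" "even (length P)" "4 \<le> length P"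
  have "odd (length P)"
  proof (rule odd_apex[OF P(1) _ assms(1)])
    show "b \<notin> set P" using set_path_cases[of b P] P assms irr by auto
    show "E b v \<longleftrightarrow> v = hd P \<or> v = last P" if "v \<in> set P" for v
      using set_path_cases[OF that] P assms by auto
  qed (use P in simp)
  then show False using P by simp
qed

text \<open>Nonadjacent vertices of \<open>Y\<close> that are joined by a path through
  \<open>C\<close> are also joined by an induced path through the connected set \<open>K\<close>.
  The two paths form a hole, so their lengths have the same parity.\<close>

lemma no_odd_path_transfer:
  assumes K: "K \<subseteq> V" "\<not> disconnected_on E K" and Y: "\<forall>y\<in>Y. \<exists>k\<in>K. E y k"
    and KC: "\<forall>k\<in>K. \<forall>c\<in>C. \<not> E k c" "K \<inter> C = {}" "K \<inter> Y = {}"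
    and n: "no_odd_path V E K Y"
  shows "no_odd_path V E C Y"
proof (rule no_odd_pathI)
  fix P assume P: "induced_path V E P" "hd P \<in> Y" "last P \<in> Y" "hd P \<noteq> last P" "\<not> E (hd P) (last P)"
    "interior P \<subseteq> C" "even (length P)" "4 \<le> length P"
  define u where "u = hd P"
  define v where "v = last P"
  define p where "p = length P"
  have uv: "u \<in> Y" "v \<in> Y" "u \<noteq> v" "\<not> E u v" "u \<in> V" "v \<in> V"
    using P by (auto simp: u_def v_def induced_path_def)
  have "\<not> disconnected_on E (insert v K)"
    using connected_on_insert[OF K(2)] Y uv(2) by blast
  then have S: "\<not> disconnected_on E (insert u (insert v K))"
    using connected_on_insert[of "insert v K"] Y uv(1) by blast
  obtain R where R: "induced_path V E R" "hd R = u" "last R = v" "set R \<subseteq> insert u (insert v K)"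
    using connected_on_obtain_path[OF S, of u v] K(1) uv by auto
  define m where "m = length R"
  have m3: "3 \<le> m" unfolding m_def by (rule induced_path_length3[OF R(1)]) (use R uv in auto)
  have ends: "R ! 0 = u" "R ! (m - 1) = v" "P ! 0 = u" "P ! (p - 1) = v"
    using induced_path_hd_last[OF R(1)] induced_path_hd_last[OF P(1)] R
    by (simp_all add: m_def p_def u_def v_def)
  have ne: "P \<noteq> []" "R \<noteq> []" using P(1) R(1) by (simp_all add: induced_path_def)
  have RK: "R ! j \<in> K" if "0 < j" "Suc j < m" for j
  proof -
    have "R ! j \<in> set R" using that by (simp add: m_def)
    moreover have "j < length R" "0 < length R" "m - 1 < length R"
      using that unfolding m_def by linarith+
    then have "R ! j \<noteq> R ! 0" "R ! j \<noteq> R ! (m - 1)"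
      using induced_path_eq[OF R(1)] that by auto
    ultimately show ?thesis using R(4) ends by auto
  qed
  have "odd m"
    unfolding m_def
  proof (rule no_odd_pathD[OF n R(1)])
    show "interior R \<subseteq> K" using RK by (auto simp: set_interior m_def)
  qed (use R uv in auto)
  have PC: "P ! i \<in> C" if "0 < i" "Suc i < p" for i
    using P(6) that by (auto simp: set_interior p_def)
  have p4: "4 \<le> p" "even p" using P by (simp_all add: p_def)
  \<comment> \<open>The hole is cut at \<open>u\<close>: \<open>A\<close> is \<open>P\<close>
    without \<open>u\<close>, and \<open>B\<close> runs back from \<open>v\<close> through the
    interior of \<open>R\<close>.\<close>
  define A where "A = seg P 1 (p - 1)"
  define B where "B = rev (seg R 1 (m - 2))"
  have A: "induced_path V E A" unfolding A_def by (rule induced_path_seg[OF P(1)]) (use p4 in \<open>auto simp: p_def\<close>)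
  have B: "induced_path V E B" unfolding B_def
    by (intro induced_path_rev induced_path_seg[OF R(1)]) (use m3 in \<open>auto simp: m_def\<close>)
  have hl: "hd A = P ! 1" "last A = v" "hd B = R ! (m - 2)" "last B = R ! 1" "A \<noteq> []" "B \<noteq> []"
    using p4 m3 ends by (simp_all add: A_def B_def hd_rev last_rev)
  have Ai: "\<exists>i. 1 \<le> i \<and> i < p \<and> w = P ! i" if w: "w \<in> set A" for w
  proof -
    obtain i where "1 \<le> i" "i \<le> p - 1" "w = P ! i" using w by (auto simp: A_def set_seg)
    then show ?thesis using p4 by (intro exI[of _ i]) linarith
  qed
  have Bi: "\<exists>j. 1 \<le> j \<and> Suc j < m \<and> w = R ! j" if w: "w \<in> set B" for w
  proof -
    obtain j where "1 \<le> j" "j \<le> m - 2" "w = R ! j" using w by (auto simp: B_def set_seg)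
    then show ?thesis using m3 by (intro exI[of _ j]) linarith
  qed
  have PK: "P ! i \<notin> K" if i: "i < p" for i
  proof -
    consider "i = 0" | "i = p - 1" | "0 < i" "Suc i < p" using i by linarith
    then show ?thesis using ends uv PC KC(2,3) by cases auto
  qed
  have BK: "set B \<subseteq> K" using Bi RK by fastforce
  have disj: "set A \<inter> set B = {}" using Ai PK BK by fastforce
  have "induced_path V E (A @ B)"
  proof (rule induced_path_append[OF A B disj])
    fix a b assume a: "a \<in> set A" and b: "b \<in> set B"
    obtain i where i: "1 \<le> i" "i < p" "a = P ! i" using Ai[OF a] by blast
    obtain j where j: "1 \<le> j" "Suc j < m" "b = R ! j" using Bi[OF b] by blast
    show "E a b \<longleftrightarrow> a = last A \<and> b = hd B"
    proof (cases "i = p - 1")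
      case True
      then have a': "a = R ! (m - 1)" using i ends by simp
      have "E a b \<longleftrightarrow> j = m - 2"
        unfolding a' j(3) using induced_path_adj[OF R(1), of "m - 1" j] j m3 by (auto simp: m_def)
      moreover have "b = hd B \<longleftrightarrow> j = m - 2"
        unfolding hl j(3) using induced_path_eq[OF R(1), of j "m - 2"] j by (auto simp: m_def)
      ultimately show ?thesis using a' ends hl by simp
    next
      case False
      then have "a \<in> C" using PC i by simp
      then have "\<not> E a b" using KC(1) BK b sym by blast
      moreover have "a \<noteq> v"
        using induced_path_eq[OF P(1), of i "p - 1"] False i ends ne by (auto simp: p_def)
      ultimately show ?thesis using hl by simp
    qed
  qed
  then have "odd (length (A @ B))"
  proof (rule odd_apex[OF _ _ uv(5)])
    show "3 \<le> length (A @ B)" using p4 m3 by (simp add: A_def B_def)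
    show "u \<notin> set (A @ B)"
    proof
      assume "u \<in> set (A @ B)"
      then consider "u \<in> set A" | "u \<in> set B" by auto
      then show False
      proof cases
        case 1
        then obtain i where "1 \<le> i" "i < p" "u = P ! i" using Ai by blast
        then show False using induced_path_eq[OF P(1), of i 0] ends ne by (auto simp: p_def)
      next
        case 2
        then show False using BK KC(3) uv by blast
      qed
    qed
    fix w assume "w \<in> set (A @ B)"
    then consider "w \<in> set A" | "w \<in> set B" by auto
    then show "E u w \<longleftrightarrow> w = hd (A @ B) \<or> w = last (A @ B)"
    proof cases
      case 1
      then obtain i where i: "1 \<le> i" "i < p" "w = P ! i" using Ai by blast
      have "E u w \<longleftrightarrow> i = 1"
        using induced_path_adj[OF P(1), of 0 i] i ends ne by (auto simp: p_def)
      moreover have "w = hd A \<longleftrightarrow> i = 1"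
        using induced_path_eq[OF P(1), of i 1] i hl p4 ne by (auto simp: p_def)
      moreover have "w \<noteq> last B" using 1 disj hl last_in_set by blast
      ultimately show ?thesis using hl by simp
    next
      case 2
      then obtain j where j: "1 \<le> j" "Suc j < m" "w = R ! j" using Bi by blast
      have "E u w \<longleftrightarrow> j = 1"
        using induced_path_adj[OF R(1), of 0 j] j ends ne by (auto simp: m_def)
      moreover have "w = last B \<longleftrightarrow> j = 1"
        using induced_path_eq[OF R(1), of j 1] j hl m3 ne by (auto simp: m_def)
      moreover have "w \<noteq> hd A" using 2 disj hl hd_in_set by blast
      ultimately show ?thesis using hl by simp
    qed
  qed
  moreover have "length (A @ B) + 3 = p + m" using p4 m3 by (simp add: A_def B_def)
  then have "even (length (A @ B) + 3) \<longleftrightarrow> even (p + m)" by (simp only:)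
  ultimately show False using \<open>odd m\<close> p4(2) by simp
qed

end

locale prismless_graph = berge_graph +
  assumes no_prism: "\<not> has_long_prism V E" and no_antiprism: "\<not> has_long_prism V co"
begin

lemma prismless_graph_co: "prismless_graph V co"
proof -
  interpret co: berge_graph V co by (rule berge_graph_co)
  show ?thesis
    by unfold_locales (use no_prism no_antiprism in \<open>simp_all add: co_co\<close>)
qed

text \<open>The form in which Roussel-Rubio is used for skew partitions: ends in a set complete to
  \<open>Y\<close>, interior in a set without \<open>Y\<close>-complete vertices.\<close>

lemma odd_path_antipath:
  assumes Y: "Y \<subseteq> V" "Y \<noteq> {}" "\<not> disconnected_on co Y" "\<forall>b\<in>B. \<forall>y\<in>Y. E b y"
    and A: "\<forall>a\<in>A. \<exists>y\<in>Y. \<not> E a y" "A \<inter> Y = {}"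
    and P: "induced_path V E P" "hd P \<in> B" "last P \<in> B" "interior P \<subseteq> A" "even (length P)" "4 \<le> length P"
  obtains Q where "length P = 4" "induced_path V co Q" "hd Q = P ! 1" "last Q = P ! 2"
    "interior Q \<subseteq> Y" "even (length Q)"
proof -
  have "set P \<inter> Y = {}"
    using set_path_cases[of _ P] P Y(4) A(2) irr by blast
  moreover have "complete_to E (hd P) Y" "complete_to E (last P) Y"
    using P Y by (auto simp: complete_to_def)
  moreover have "\<forall>v\<in>interior P. \<not> complete_to E v Y"
    using P(4) A(1) by (fastforce simp: complete_to_def)
  ultimately show thesis
    using roussel_rubio_holds[OF no_prism Y(1-3)] P(1,5,6) that
    unfolding roussel_rubio_def by blast
qed

text \<open>By Roussel-Rubio an odd path would have length 3, and its two internal vertices,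
  adjacent and in \<open>A\<close>, would be joined by an odd antipath through \<open>Y\<close>,
  which \<open>n\<close> forbids.\<close>

lemma no_odd_path_complete:
  assumes Y: "Y \<subseteq> V" "Y \<noteq> {}" "\<not> disconnected_on co Y" "\<forall>b\<in>B. \<forall>y\<in>Y. E b y"
    and A: "\<forall>a\<in>A. \<exists>y\<in>Y. \<not> E a y" "A \<inter> Y = {}"
    and n: "no_odd_path V co Y A"
  shows "no_odd_path V E A B"
proof (rule no_odd_pathI)
  fix P assume P: "induced_path V E P" "hd P \<in> B" "last P \<in> B" "interior P \<subseteq> A" "even (length P)" "4 \<le> length P"
  obtain Q where Q: "length P = 4" "induced_path V co Q" "hd Q = P ! 1" "last Q = P ! 2"
      "interior Q \<subseteq> Y" "even (length Q)"
    by (rule odd_path_antipath[OF Y A P])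
  have "P ! 1 \<in> interior P" "P ! 2 \<in> interior P" using Q(1) unfolding set_interior by force+
  moreover have "E (P ! 1) (P ! 2)" using induced_path_adj[OF P(1), of 1 2] Q(1) by simp
  then have "P ! 1 \<noteq> P ! 2" "\<not> co (P ! 1) (P ! 2)" using irr by (auto simp: compl_def)
  ultimately have "odd (length Q)"
    using no_odd_pathD[OF n Q(2)] Q P(4) by (simp add: subset_eq)
  then show False using Q by simp
qed

text \<open>The vertex \<open>b\<close> is complete to \<open>Y\<close> and anticomplete to
  \<open>A\<^sub>1\<close>, so it closes odd paths to odd holes and odd antipaths to odd antiholes;
  this settles \<open>A\<^sub>1\<close>. Then \<open>A\<^sub>2\<close> follows: paths by transfer
  from \<open>A\<^sub>1\<close>, antipaths by \<open>no_odd_path_complete\<close> in the complement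
  with \<open>A\<^sub>1\<close> as the anticonnected set.\<close>

lemma no_odd_path_if_loose:
  assumes S: "skew4 V E A\<^sub>1 A\<^sub>2 C Y" and A: "\<not> disconnected_on E A\<^sub>1" "\<forall>y\<in>Y. \<exists>k\<in>A\<^sub>1. E y k"
    and b: "b \<in> C" "\<forall>k\<in>A\<^sub>1. \<not> E b k"
  shows "no_odd_path V E A\<^sub>1 Y" "no_odd_path V co Y A\<^sub>1" "no_odd_path V E A\<^sub>2 Y" "no_odd_path V co Y A\<^sub>2"
proof -
  interpret co: prismless_graph V co by (rule prismless_graph_co)
  have sub: "A\<^sub>1 \<subseteq> V" "A\<^sub>2 \<subseteq> V" "C \<subseteq> V" "Y \<subseteq> V" and bV: "b \<in> V"
    using S b by (auto simp: skew4_def)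
  show n1: "no_odd_path V E A\<^sub>1 Y"
    by (rule no_odd_path_cone[of b]) (use S b bV in \<open>auto simp: skew4_def\<close>)
  show "no_odd_path V co Y A\<^sub>1"
    by (rule co.no_odd_path_cone[of b]) (use S b bV sub in \<open>auto simp: skew4_def compl_def\<close>)
  show "no_odd_path V E A\<^sub>2 Y"
    by (rule no_odd_path_transfer[OF sub(1) A _ _ _ n1]) (use S in \<open>auto simp: skew4_def\<close>)
  show "no_odd_path V co Y A\<^sub>2"
  proof (rule co.no_odd_path_complete[OF sub(1)])
    show "A\<^sub>1 \<noteq> {}" using S by (simp add: skew4_def)
    show "\<forall>a\<in>A\<^sub>2. \<forall>a'\<in>A\<^sub>1. co a a'"
      using skew4_co[OF skew4_swap_left[OF S]] by (simp add: skew4_def)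
    show "\<forall>y\<in>Y. \<exists>k\<in>A\<^sub>1. \<not> co y k" using A(2) by (auto simp: compl_def)
  qed (use A n1 S in \<open>auto simp: co_co skew4_def\<close>)
qed

section \<open>Star cutsets and vertices without neighbours in a component\<close>

text \<open>This is a star cutset with centre \<open>b\<close>. If \<open>b\<close> is adjacent to
  all other vertices, the parts \<open>{x}\<close>, \<open>{y}\<close>, \<open>{b}\<close> make
  every pair trivial. Otherwise let \<open>K\<close> be a component of the non-neighbours of
  \<open>b\<close> on one side and let its neighbourhood \<open>Y\<close> become the fourth part: by
  construction every vertex of \<open>Y\<close> has a neighbour in \<open>K\<close> and
  \<open>b\<close> has none, so \<open>no_odd_path_if_loose\<close> applies.\<close>

lemma balanced_if_singleton_anticomponent:
  assumes S: "skew4 V E A\<^sub>1 A\<^sub>2 {b} B"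
  shows "\<exists>A B. balanced_skew_partition V E A B"
proof (cases "\<forall>a\<in>A\<^sub>1 \<union> A\<^sub>2. E b a")
  case True
  obtain x y where xy: "x \<in> A\<^sub>1" "y \<in> A\<^sub>2" using S by (auto simp: skew4_def)
  have "skew4 V E {x} {y} {b} (V - {x, y, b})"
    unfolding skew4_def
  proof (intro conjI)
    show "V - {x, y, b} \<noteq> {}" "{x} \<union> {y} \<union> {b} \<union> (V - {x, y, b}) = V"
      using S xy by (auto simp: skew4_def)
  qed (use S xy True in \<open>auto simp: skew4_def\<close>)
  then show ?thesis
    by (rule balanced_skew4) (rule no_odd_path_single_end no_odd_path_single_interior)+
next
  case False
  have "\<exists>A B. balanced_skew_partition V E A B"
    if S: "skew4 V E A\<^sub>1 A\<^sub>2 {b} B" and m: "m \<in> A\<^sub>1" "\<not> E b m" for A\<^sub>1 A\<^sub>2 m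
  proof -
    have S': "A\<^sub>2 \<noteq> {}" "B \<noteq> {}" "V = A\<^sub>1 \<union> A\<^sub>2 \<union> {b} \<union> B" "A\<^sub>1 \<inter> A\<^sub>2 = {}" "b \<notin> B"
      "(A\<^sub>1 \<union> A\<^sub>2) \<inter> ({b} \<union> B) = {}" "\<forall>a\<in>A\<^sub>1. \<forall>a'\<in>A\<^sub>2. \<not> E a a'" "\<forall>y\<in>B. E b y"
      using S by (simp_all add: skew4_def)
    define M where "M = {a \<in> A\<^sub>1. \<not> E b a}"
    have "M \<subseteq> V" "m \<in> M" using S m by (auto simp: M_def skew4_def)
    then obtain K where K: "m \<in> K" "K \<subseteq> M" "\<not> disconnected_on E K"
        "\<And>x y. x \<in> K \<Longrightarrow> y \<in> M - K \<Longrightarrow> \<not> E x y"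
      by (rule connected_on_component) blast
    have KA: "K \<subseteq> A\<^sub>1" "\<forall>k\<in>K. \<not> E b k" using K(2) by (auto simp: M_def)
    have bV: "b \<in> V" "b \<notin> A\<^sub>1" "b \<notin> A\<^sub>2" "b \<notin> B" using S by (auto simp: skew4_def)
    define Y where "Y = {v \<in> V - K. \<exists>k\<in>K. E v k}"
    \<comment> \<open>A neighbour of \<open>K\<close> in \<open>A\<^sub>1\<close> that is
      nonadjacent to \<open>b\<close> would belong to the component \<open>K\<close> itself.\<close>
    have YE: "E b y" if y: "y \<in> Y" for y
    proof -
      obtain k where k: "k \<in> K" "E y k" "y \<in> V - K" using y by (auto simp: Y_def)
      have "y \<notin> A\<^sub>2" using S'(7) k KA(1) sym[OF k(2)] by blast
      moreover have "y \<noteq> b" using k KA(2) by auto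
      moreover have "E b y" if "y \<in> A\<^sub>1"
        using that K(4)[OF k(1), of y] k(3) sym[OF k(2)] by (auto simp: M_def)
      ultimately show ?thesis using S'(3,8) k(3) by blast
    qed
    have YA: "Y \<inter> A\<^sub>2 = {}"
    proof (rule equals0I)
      fix y assume y: "y \<in> Y \<inter> A\<^sub>2"
      then obtain k where "k \<in> K" "E k y" using sym by (auto simp: Y_def)
      then show False using S'(7) KA(1) y by blast
    qed
    show ?thesis
    proof (cases "Y = {}")
      case True
      \<comment> \<open>\<open>K\<close> has no neighbours outside, so any \<open>b'\<close> in
        \<open>B\<close> can form the fourth part, and every pair of parts then contains a
        singleton.\<close>
      obtain b' where b': "b' \<in> B" using S by (auto simp: skew4_def)
      have "skew4 V E K (V - K - {b, b'}) {b} {b'}"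
        unfolding skew4_def
      proof (intro conjI)
        have "A\<^sub>2 \<subseteq> V - K - {b, b'}" "A\<^sub>2 \<noteq> {}" using S'(1,3,4,6) KA(1) b' by blast+
        then show "V - K - {b, b'} \<noteq> {}" by blast
        show "K \<union> (V - K - {b, b'}) \<union> {b} \<union> {b'} = V" using S'(3) KA(1) b' by blast
        show "\<forall>a\<in>K. \<forall>a'\<in>V - K - {b, b'}. \<not> E a a'"
          using True sym unfolding Y_def by blast
        show "(K \<union> (V - K - {b, b'})) \<inter> ({b} \<union> {b'}) = {}" using S'(6) KA(1) b' by blast
      qed (use S' K(1) b' in auto)
      then show ?thesis
        by (rule balanced_skew4) (rule no_odd_path_single_end no_odd_path_single_interior)+
    next
      case False
      have S': "skew4 V E K (V - K - Y - {b}) {b} Y"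
        unfolding skew4_def
      proof (intro conjI)
        have "A\<^sub>2 \<subseteq> V - K - Y - {b}" "A\<^sub>2 \<noteq> {}" using S'(1,3,4,6) KA(1) YA by blast+
        then show "V - K - Y - {b} \<noteq> {}" by blast
        show "K \<union> (V - K - Y - {b}) \<union> {b} \<union> Y = V" using S'(3) KA(1) Y_def by blast
        show "\<forall>a\<in>K. \<forall>a'\<in>V - K - Y - {b}. \<not> E a a'"
          using sym unfolding Y_def by blast
        show "(K \<union> (V - K - Y - {b})) \<inter> ({b} \<union> Y) = {}" using KA(1) bV by (auto simp: Y_def)
        show "{b} \<inter> Y = {}" using YE irr by blast
        show "\<forall>b\<in>{b}. \<forall>b'\<in>Y. E b b'" using YE by blast
      qed (use K(1) False in auto)
      have Y: "\<forall>y\<in>Y. \<exists>k\<in>K. E y k" by (auto simp: Y_def)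
      note n = no_odd_path_if_loose[OF S' K(3) Y _ KA(2)]
      show ?thesis
        by (rule balanced_skew4[OF S']) (use n in \<open>auto intro: no_odd_path_single_end no_odd_path_single_interior\<close>)
    qed
  qed
  then show ?thesis using False S skew4_swap_left[OF S] by blast
qed

lemma balanced_if_singleton_component:
  assumes "skew4 V E {a} A B\<^sub>1 B\<^sub>2"
  shows "\<exists>A B. balanced_skew_partition V E A B"
proof -
  interpret co: prismless_graph V co by (rule prismless_graph_co)
  have "skew4 V co B\<^sub>1 B\<^sub>2 {a} A" by (rule skew4_co[OF assms])
  then show ?thesis using co.balanced_if_singleton_anticomponent balanced_co by blast
qed

text \<open>Minimise \<open>card Y\<close> first and \<open>card (A\<^sub>1 \<union> A\<^sub>2)\<close> second: a vertex of \<open>Y\<close> without neighbour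
  in \<open>A\<^sub>1\<close> can be moved to \<open>A\<^sub>2\<close>, and a \<open>Y\<close>-complete vertex of \<open>A\<^sub>1 \<union> A\<^sub>2\<close> can be moved to \<open>C\<close>,
  unless a part becomes empty, in which case there is a star cutset.\<close>

lemma balanced_if_loose_anticomponent:
  assumes "skew4 V E A\<^sub>1 A\<^sub>2 C Y" "\<not> disconnected_on E A\<^sub>1" "\<not> disconnected_on co Y"
    and "b \<in> C" "\<forall>k\<in>A\<^sub>1. \<not> E b k"
  shows "\<exists>A B. balanced_skew_partition V E A B"
  using assms
\<comment> \<open>The factor \<open>Suc (card V)\<close> encodes the lexicographic order, as the
  second summand is at most \<open>card V\<close>.\<close>
proof (induction "card Y * Suc (card V) + card (A\<^sub>1 \<union> A\<^sub>2)" arbitrary: A\<^sub>1 A\<^sub>2 C Y rule: less_induct)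
  case less
  interpret co: prismless_graph V co by (rule prismless_graph_co)
  note S = less.prems(1) and conn = less.prems(2) and coconn = less.prems(3) and b = less.prems(4,5)
  have S': "A\<^sub>1 \<noteq> {}" "A\<^sub>2 \<noteq> {}" "C \<noteq> {}" "Y \<noteq> {}" "V = A\<^sub>1 \<union> A\<^sub>2 \<union> C \<union> Y" "A\<^sub>1 \<inter> A\<^sub>2 = {}" "C \<inter> Y = {}"
    "(A\<^sub>1 \<union> A\<^sub>2) \<inter> (C \<union> Y) = {}" "\<forall>a\<in>A\<^sub>1. \<forall>a'\<in>A\<^sub>2. \<not> E a a'" "\<forall>c\<in>C. \<forall>y\<in>Y. E c y"
    using S by (simp_all add: skew4_def)
  have sub: "A\<^sub>1 \<subseteq> V" "A\<^sub>2 \<subseteq> V" "C \<subseteq> V" "Y \<subseteq> V" using S'(5) by blast+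
  have fins: "finite Y" "finite (A\<^sub>1 \<union> A\<^sub>2)" using sub fin finite_subset by blast+
  show ?case
  proof (cases "\<exists>y\<in>Y. \<forall>k\<in>A\<^sub>1. \<not> E y k")
    case True
    then obtain y where y: "y \<in> Y" "\<forall>k\<in>A\<^sub>1. \<not> E y k" by blast
    show ?thesis
    proof (cases "Y = {y}")
      case True
      then show ?thesis using balanced_if_singleton_anticomponent[OF skew4_swap_right] S by blast
    next
      case False
      then obtain z where z: "z \<in> Y - {y}" using y by blast
      have "Y - {y} \<subseteq> V" using sub by blast
      \<comment> \<open>\<open>Y - {y}\<close> may fail to be anticonnected; one anticomponent is
        kept as the new \<open>Y\<close> and the rest, being complete to it, joins
        \<open>C\<close>.\<close>
      then obtain Y' where Y': "z \<in> Y'" "Y' \<subseteq> Y - {y}" "\<not> disconnected_on co Y'"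
          "\<And>u v. u \<in> Y' \<Longrightarrow> v \<in> Y - {y} - Y' \<Longrightarrow> \<not> co u v"
        using z by (rule co.connected_on_component) blast
      have comp: "E v u" if "u \<in> Y'" "v \<in> Y - {y} - Y'" for u v
      proof -
        have "E u v" using Y'(4)[OF that] that Y'(2) sub(4) by (auto simp: compl_def)
        then show ?thesis by (rule sym)
      qed
      have S2: "skew4 V E A\<^sub>1 (insert y A\<^sub>2) (C \<union> (Y - {y} - Y')) Y'"
        unfolding skew4_def
      proof (intro conjI)
        show "A\<^sub>1 \<union> insert y A\<^sub>2 \<union> (C \<union> (Y - {y} - Y')) \<union> Y' = V" using S'(5) y(1) Y'(2) by blast
        show "A\<^sub>1 \<inter> insert y A\<^sub>2 = {}" using S'(6,8) y(1) by blast
        show "(C \<union> (Y - {y} - Y')) \<inter> Y' = {}" using S'(7) Y'(2) by blast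
        show "(A\<^sub>1 \<union> insert y A\<^sub>2) \<inter> (C \<union> (Y - {y} - Y') \<union> Y') = {}" using S'(7,8) Y'(2) y(1) by blast
        show "\<forall>a\<in>A\<^sub>1. \<forall>a'\<in>insert y A\<^sub>2. \<not> E a a'" using S'(9) y(2) sym by blast
        show "\<forall>c\<in>C \<union> (Y - {y} - Y'). \<forall>u\<in>Y'. E c u" using S'(10) comp Y'(2) by blast
      qed (use S' Y'(1) in auto)
      have "card Y' < card Y" using Y'(2) y(1) fins(1) by (intro psubset_card_mono) auto
      then have "Suc (card Y') * Suc (card V) \<le> card Y * Suc (card V)" by (intro mult_right_mono) auto
      moreover have "card (A\<^sub>1 \<union> insert y A\<^sub>2) \<le> card V"
        using sub y(1) by (intro card_mono fin) auto
      ultimately have "card Y' * Suc (card V) + card (A\<^sub>1 \<union> insert y A\<^sub>2) < card Y * Suc (card V) + card (A\<^sub>1 \<union> A\<^sub>2)"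
        by simp
      from less.hyps[OF this S2 conn Y'(3) _ b(2)] b(1) show ?thesis by blast
    qed
  next
    case False
    then have nb: "\<forall>y\<in>Y. \<exists>k\<in>A\<^sub>1. E y k" by blast
    show ?thesis
    proof (cases "\<exists>a\<in>A\<^sub>1 \<union> A\<^sub>2. \<forall>y\<in>Y. E a y")
      case True
      then obtain a where a: "a \<in> A\<^sub>1 \<union> A\<^sub>2" "\<forall>y\<in>Y. E a y" by blast
      \<comment> \<open>Removing \<open>a\<close> may disconnect \<open>A\<^sub>1\<close>. Then
        \<open>K\<close> is a component of what is left, and \<open>b\<close> still has no neighbour
        in it.\<close>
      have move: ?thesis
        if X: "K \<noteq> {}" "L \<noteq> {}" "\<not> disconnected_on E K" "K \<subseteq> A\<^sub>1" "K \<union> L = A\<^sub>1 \<union> A\<^sub>2 - {a}" "K \<inter> L = {}"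
          "\<forall>k\<in>K. \<forall>l\<in>L. \<not> E k l" for K L
      proof -
        have S2: "skew4 V E K L (insert a C) Y"
          unfolding skew4_def
        proof (intro conjI)
          show "K \<union> L \<union> insert a C \<union> Y = V" using X(5) S'(5) a(1) by blast
          show "insert a C \<inter> Y = {}" using S'(7,8) a(1) by blast
          show "(K \<union> L) \<inter> (insert a C \<union> Y) = {}" using X(5) S'(8) by blast
          show "\<forall>c\<in>insert a C. \<forall>y\<in>Y. E c y" using a(2) S'(10) by blast
        qed (use X S' in auto)
        have "card (K \<union> L) < card (A\<^sub>1 \<union> A\<^sub>2)"
          using X(5) a(1) fins(2) by (intro psubset_card_mono) auto
        then have "card Y * Suc (card V) + card (K \<union> L) < card Y * Suc (card V) + card (A\<^sub>1 \<union> A\<^sub>2)"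
          by simp
        from less.hyps[OF this S2 X(3) coconn] b X(4) show ?thesis by blast
      qed
      show ?thesis
      proof (cases "a \<in> A\<^sub>1")
        case a1: True
        show ?thesis
        proof (cases "A\<^sub>1 = {a}")
          case True
          then show ?thesis using balanced_if_singleton_component S by blast
        next
          case False
          then obtain z where z: "z \<in> A\<^sub>1 - {a}" using a1 by blast
          have "A\<^sub>1 - {a} \<subseteq> V" using sub by blast
          then obtain K where K: "z \<in> K" "K \<subseteq> A\<^sub>1 - {a}" "\<not> disconnected_on E K"
              "\<And>u v. u \<in> K \<Longrightarrow> v \<in> A\<^sub>1 - {a} - K \<Longrightarrow> \<not> E u v"
            using z by (rule connected_on_component) blast
          show ?thesis
          proof (rule move[of K "A\<^sub>2 \<union> (A\<^sub>1 - {a} - K)"])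
            show "K \<union> (A\<^sub>2 \<union> (A\<^sub>1 - {a} - K)) = A\<^sub>1 \<union> A\<^sub>2 - {a}" using K(2) a1 S'(6) by blast
            show "K \<inter> (A\<^sub>2 \<union> (A\<^sub>1 - {a} - K)) = {}" using K(2) S'(6) by blast
            show "\<forall>k\<in>K. \<forall>l\<in>A\<^sub>2 \<union> (A\<^sub>1 - {a} - K). \<not> E k l" using K(2,4) S'(9) by blast
          qed (use K S' in auto)
        qed
      next
        case a2: False
        show ?thesis
        proof (cases "A\<^sub>2 = {a}")
          case True
          then show ?thesis using balanced_if_singleton_component skew4_swap_left S by blast
        next
          case False
          show ?thesis
            by (rule move[of A\<^sub>1 "A\<^sub>2 - {a}"]) (use False a2 a S' conn in auto)
        qed
      qed
    next
      case False
      then have non: "\<forall>a\<in>A\<^sub>1 \<union> A\<^sub>2. \<exists>y\<in>Y. \<not> E a y" by blast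
      note n = no_odd_path_if_loose[OF S conn nb b]
      \<comment> \<open>Neither move is possible now. The pairs with \<open>Y\<close> are settled
        through \<open>b\<close>; those with \<open>C\<close> are inherited from them, since
        \<open>Y\<close> is anticonnected, complete to \<open>C\<close>, and misses no vertex of
        \<open>A\<^sub>1 \<union> A\<^sub>2\<close> in the complement.\<close>
      have nA: "no_odd_path V E A C" if "no_odd_path V co Y A" "A \<subseteq> A\<^sub>1 \<union> A\<^sub>2" for A
        by (rule no_odd_path_complete[OF sub(4) S'(4) coconn S'(10) _ _ that(1)])
          (use that(2) non S'(8) in blast)+
      have nC: "no_odd_path V co C A" if A: "no_odd_path V co Y A" "A \<subseteq> A\<^sub>1 \<union> A\<^sub>2" for A
      proof (rule co.no_odd_path_transfer[OF sub(4) coconn _ _ _ _ A(1)])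
        show "\<forall>a\<in>A. \<exists>y\<in>Y. co a y"
        proof
          fix a assume "a \<in> A"
          then obtain y where "y \<in> Y" "\<not> E a y" "a \<in> A\<^sub>1 \<union> A\<^sub>2" using non A(2) by blast
          moreover then have "a \<noteq> y" "a \<in> V" "y \<in> V" using S'(8) sub by auto
          ultimately show "\<exists>y\<in>Y. co a y" by (auto simp: compl_def)
        qed
        show "\<forall>y\<in>Y. \<forall>c\<in>C. \<not> co y c" using S'(10) sym by (auto simp: compl_def)
      qed (use S' A(2) in auto)
      show ?thesis
        by (rule balanced_skew4[OF S nA n(1) nA n(3) nC nC n(2) n(4)]) (use n in auto)
    qed
  qed
qed

text \<open>Regrouping reduces this to the previous case: \<open>K\<close> becomes the first part,
  and an anticomponent of the half of \<open>B\<close> not containing \<open>b\<close> becomes the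
  last one.\<close>

lemma balanced_if_loose:
  assumes S: "skew4 V E A\<^sub>1 A\<^sub>2 B\<^sub>1 B\<^sub>2" and K: "K \<subseteq> A\<^sub>1 \<union> A\<^sub>2" "K \<noteq> {}" "K \<noteq> A\<^sub>1 \<union> A\<^sub>2" "\<not> disconnected_on E K"
    "\<And>x y. x \<in> K \<Longrightarrow> y \<in> A\<^sub>1 \<union> A\<^sub>2 - K \<Longrightarrow> \<not> E x y"
    and b: "b \<in> B\<^sub>1 \<union> B\<^sub>2" "\<forall>k\<in>K. \<not> E b k"
  shows "\<exists>A B. balanced_skew_partition V E A B"
proof -
  have "\<exists>A B. balanced_skew_partition V E A B"
    if S: "skew4 V E A\<^sub>1 A\<^sub>2 B\<^sub>1 B\<^sub>2" and b1: "b \<in> B\<^sub>1" for B\<^sub>1 B\<^sub>2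
  proof -
    interpret co: prismless_graph V co by (rule prismless_graph_co)
    have S': "B\<^sub>1 \<noteq> {}" "B\<^sub>2 \<noteq> {}" "V = A\<^sub>1 \<union> A\<^sub>2 \<union> B\<^sub>1 \<union> B\<^sub>2" "B\<^sub>1 \<inter> B\<^sub>2 = {}"
      "(A\<^sub>1 \<union> A\<^sub>2) \<inter> (B\<^sub>1 \<union> B\<^sub>2) = {}" "\<forall>c\<in>B\<^sub>1. \<forall>y\<in>B\<^sub>2. E c y"
      using S by (simp_all add: skew4_def)
    obtain z where "z \<in> B\<^sub>2" using S'(2) by blast
    moreover have "B\<^sub>2 \<subseteq> V" using S'(3) by blast
    ultimately obtain Y where Y: "z \<in> Y" "Y \<subseteq> B\<^sub>2" "\<not> disconnected_on co Y"
        "\<And>u v. u \<in> Y \<Longrightarrow> v \<in> B\<^sub>2 - Y \<Longrightarrow> \<not> co u v"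
      using co.connected_on_component[of B\<^sub>2 z] by blast
    have comp: "E v u" if "u \<in> Y" "v \<in> B\<^sub>2 - Y" for u v
    proof -
      have "E u v" using Y(4)[OF that] that Y(2) S'(3) by (auto simp: compl_def)
      then show ?thesis by (rule sym)
    qed
    have "skew4 V E K (A\<^sub>1 \<union> A\<^sub>2 - K) (B\<^sub>1 \<union> (B\<^sub>2 - Y)) Y"
      unfolding skew4_def
    proof (intro conjI)
      show "K \<union> (A\<^sub>1 \<union> A\<^sub>2 - K) \<union> (B\<^sub>1 \<union> (B\<^sub>2 - Y)) \<union> Y = V" using S'(3) K(1) Y(2) by blast
      show "(B\<^sub>1 \<union> (B\<^sub>2 - Y)) \<inter> Y = {}" using S'(4) Y(2) by blast
      show "(K \<union> (A\<^sub>1 \<union> A\<^sub>2 - K)) \<inter> (B\<^sub>1 \<union> (B\<^sub>2 - Y) \<union> Y) = {}" using S'(5) K(1) Y(2) by blast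
      show "\<forall>c\<in>B\<^sub>1 \<union> (B\<^sub>2 - Y). \<forall>u\<in>Y. E c u" using S'(6) comp Y(2) by blast
      show "\<forall>x\<in>K. \<forall>y\<in>A\<^sub>1 \<union> A\<^sub>2 - K. \<not> E x y" using K(5) by blast
      show "A\<^sub>1 \<union> A\<^sub>2 - K \<noteq> {}" using K(1,3) by blast
    qed (use K(2) S'(1) Y(1) in auto)
    then show ?thesis
      by (rule balanced_if_loose_anticomponent[OF _ K(4) Y(3) _ b(2)]) (use b1 in blast)
  qed
  then show ?thesis using b(1) S skew4_swap_right[OF S] by blast
qed

end

section \<open>The eight-vertex configurations\<close>

context sgraph
begin

lemma induced_path4I:
  assumes "distinct [a, b, c, d]" "{a, b, c, d} \<subseteq> V" "E a b" "E b c" "E c d" "\<not> E a c" "\<not> E a d" "\<not> E b d"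
  shows "induced_path V E [a, b, c, d]"
proof -
  have "induced_path V E [d]" using assms irr by (simp add: induced_path_def)
  then have "induced_path V E [c, d]" by (rule induced_path_Cons) (use assms in auto)
  then have "induced_path V E [b, c, d]" by (rule induced_path_Cons) (use assms in auto)
  then show ?thesis by (rule induced_path_Cons) (use assms in auto)
qed

lemma induced_path4D:
  assumes "induced_path V E P" "length P = 4"
  shows "P = [P!0, P!1, P!2, P!3]" "distinct [P!0, P!1, P!2, P!3]" "{P!0, P!1, P!2, P!3} \<subseteq> V"
    "E (P!0) (P!1)" "E (P!1) (P!2)" "E (P!2) (P!3)" "\<not> E (P!0) (P!2)" "\<not> E (P!0) (P!3)" "\<not> E (P!1) (P!3)"
    "P!1 \<in> interior P" "P!2 \<in> interior P" "hd P = P!0" "last P = P!3"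
proof -
  show P: "P = [P!0, P!1, P!2, P!3]" by (rule list4[OF assms(2)])
  show "distinct [P!0, P!1, P!2, P!3]" "{P!0, P!1, P!2, P!3} \<subseteq> V"
    using assms by (auto simp: induced_path_eq induced_path_def)
  show "E (P!0) (P!1)" "E (P!1) (P!2)" "E (P!2) (P!3)" "\<not> E (P!0) (P!2)" "\<not> E (P!0) (P!3)" "\<not> E (P!1) (P!3)"
    using induced_path_adj[OF assms(1)] assms(2) by simp_all
  show "P!1 \<in> interior P" "P!2 \<in> interior P"
    using assms(2) unfolding set_interior by force+
  show "hd P = P!0" "last P = P!3"
    using induced_path_hd_last[OF assms(1)] assms(2) by simp_all
qed

lemma contains_double_diamond:
  assumes "distinct [a1, a2, a3, a4, b1, b2, b3, b4]" "{a1, a2, a3, a4, b1, b2, b3, b4} \<subseteq> V"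
    and e: "E a1 a2" "E a1 a3" "E a1 a4" "E a2 a3" "E a2 a4" "E b1 b2" "E b1 b3" "E b1 b4" "E b2 b3" "E b2 b4"
      "E a1 b1" "E a2 b2" "E a3 b3" "E a4 b4"
    and n: "\<not> E a3 a4" "\<not> E b3 b4" "\<not> E a1 b2" "\<not> E a1 b3" "\<not> E a1 b4" "\<not> E a2 b1" "\<not> E a2 b3" "\<not> E a2 b4"
      "\<not> E a3 b1" "\<not> E a3 b2" "\<not> E a3 b4" "\<not> E a4 b1" "\<not> E a4 b2" "\<not> E a4 b3"
  shows "contains_induced dd_V dd_E V E"
proof -
  have V8: "dd_V = {1, 2, 3, 4, 5, 6, 7, 8}" by (auto simp: dd_V_def)
  note e' = e[THEN sym]
  have n': "\<not> E y x" if "\<not> E x y" for x y using that sym by blast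
  define f where "f k = [a1, a2, a3, a4, b1, b2, b3, b4] ! (k - 1)" for k
  have f: "f 1 = a1" "f 2 = a2" "f 3 = a3" "f 4 = a4" "f 5 = b1" "f 6 = b2" "f 7 = b3" "f 8 = b4"
    by (simp_all add: f_def)
  \<comment> \<open>The reversed list yields each inequation in the opposite orientation, so that
    \<open>simp\<close> has both.\<close>
  have "distinct (rev [a1, a2, a3, a4, b1, b2, b3, b4])"
    using assms(1) by (simp only: distinct_rev)
  with assms(1) have "inj_on f dd_V" unfolding V8 by (simp add: inj_on_def f del: One_nat_def)
  moreover have "f ` dd_V \<subseteq> V" using assms(2) unfolding V8 by (simp add: f del: One_nat_def)
  moreover have "\<forall>x\<in>dd_V. \<forall>y\<in>dd_V. E (f x) (f y) \<longleftrightarrow> dd_E x y"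
    unfolding dd_E_def V8 using e e' n n[THEN n'] irr by (simp add: f doubleton_eq_iff del: One_nat_def)
  ultimately show ?thesis unfolding contains_induced_def by blast
qed

text \<open>The vertices form a 3 by 3 grid without one corner, adjacency meaning a common row or
  column.\<close>

lemma contains_line_graph:
  assumes "distinct [x00, x01, x02, x10, x11, x12, x20, x21]" "{x00, x01, x02, x10, x11, x12, x20, x21} \<subseteq> V"
    and e: "E x00 x01" "E x00 x02" "E x01 x02" "E x10 x11" "E x10 x12" "E x11 x12" "E x20 x21"
      "E x00 x10" "E x00 x20" "E x10 x20" "E x01 x11" "E x01 x21" "E x11 x21" "E x02 x12"
    and n: "\<not> E x00 x11" "\<not> E x00 x12" "\<not> E x00 x21" "\<not> E x01 x10" "\<not> E x01 x12" "\<not> E x01 x20"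
      "\<not> E x02 x10" "\<not> E x02 x11" "\<not> E x02 x20" "\<not> E x02 x21" "\<not> E x10 x21" "\<not> E x11 x20" "\<not> E x12 x20" "\<not> E x12 x21"
  shows "contains_induced lk_V lk_E V E"
proof -
  have V8: "lk_V = {(0,0), (0,1), (0,2), (1,0), (1,1), (1,2), (2,0), (2,1)}" by (auto simp: lk_V_def)
  note e' = e[THEN sym]
  have n': "\<not> E y x" if "\<not> E x y" for x y using that sym by blast
  define f where "f = (\<lambda>(i, j). [[x00, x01, x02], [x10, x11, x12], [x20, x21]] ! i ! j)"
  have f: "f (0,0) = x00" "f (0,1) = x01" "f (0,2) = x02" "f (1,0) = x10" "f (1,1) = x11" "f (1,2) = x12"
      "f (2,0) = x20" "f (2,1) = x21"
    by (simp_all add: f_def)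
  have "distinct (rev [x00, x01, x02, x10, x11, x12, x20, x21])"
    using assms(1) by (simp only: distinct_rev)
  with assms(1) have "inj_on f lk_V" unfolding V8 by (simp add: inj_on_def f del: One_nat_def)
  moreover have "f ` lk_V \<subseteq> V" using assms(2) unfolding V8 by (simp add: f del: One_nat_def)
  moreover have "\<forall>x\<in>lk_V. \<forall>y\<in>lk_V. E (f x) (f y) \<longleftrightarrow> lk_E x y"
    unfolding lk_E_def V8 using e e' n n[THEN n'] irr by (simp add: f del: One_nat_def)
  ultimately show ?thesis unfolding contains_induced_def by blast
qed

end

section \<open>From an odd path to one of the two configurations\<close>

context prismless_graph
begin

text \<open>As no balanced partition exists, \<open>balanced_if_loose\<close> and its dual give
  every vertex of \<open>B\<close> a neighbour in the component \<open>Z\<close> and every vertex of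
  \<open>A\<close> a non-neighbour in the anticomponent \<open>Y\<close>. So
  \<open>odd_path_antipath\<close> is available in the graph with \<open>Y\<close> and in the
  complement with \<open>Z\<close>. Each is applied twice: once to find a new antipath or path, once
  to show that one has four vertices.\<close>

lemma odd_path_config:
  assumes nb: "\<not> (\<exists>A B. balanced_skew_partition V E A B)"
    and S: "skew4 V E A\<^sub>1 A\<^sub>2 B\<^sub>1 B\<^sub>2"
    and P: "induced_path V E P" "hd P \<in> B\<^sub>1" "last P \<in> B\<^sub>1" "interior P \<subseteq> A\<^sub>1" "even (length P)" "4 \<le> length P"
  shows "contains_induced dd_V dd_E V E \<or> contains_induced lk_V lk_E V E"
proof -
  interpret co: prismless_graph V co by (rule prismless_graph_co)
  have S': "A\<^sub>1 \<noteq> {}" "A\<^sub>2 \<noteq> {}" "B\<^sub>1 \<noteq> {}" "B\<^sub>2 \<noteq> {}" "V = A\<^sub>1 \<union> A\<^sub>2 \<union> B\<^sub>1 \<union> B\<^sub>2" "A\<^sub>1 \<inter> A\<^sub>2 = {}" "B\<^sub>1 \<inter> B\<^sub>2 = {}"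
    "(A\<^sub>1 \<union> A\<^sub>2) \<inter> (B\<^sub>1 \<union> B\<^sub>2) = {}" "\<forall>a\<in>A\<^sub>1. \<forall>a'\<in>A\<^sub>2. \<not> E a a'" "\<forall>c\<in>B\<^sub>1. \<forall>y\<in>B\<^sub>2. E c y"
    using S by (simp_all add: skew4_def)
  have sub: "A\<^sub>1 \<subseteq> V" "A\<^sub>2 \<subseteq> V" "B\<^sub>1 \<subseteq> V" "B\<^sub>2 \<subseteq> V" using S'(5) by blast+
  obtain z y where zy: "z \<in> A\<^sub>2" "y \<in> B\<^sub>2" using S' by blast
  obtain Z where Z: "z \<in> Z" "Z \<subseteq> A\<^sub>2" "\<not> disconnected_on E Z" "\<And>u v. u \<in> Z \<Longrightarrow> v \<in> A\<^sub>2 - Z \<Longrightarrow> \<not> E u v"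
    using connected_on_component[OF sub(2) zy(1)] by blast
  obtain Y where Y: "y \<in> Y" "Y \<subseteq> B\<^sub>2" "\<not> disconnected_on co Y" "\<And>u v. u \<in> Y \<Longrightarrow> v \<in> B\<^sub>2 - Y \<Longrightarrow> \<not> co u v"
    using co.connected_on_component[OF sub(4) zy(2)] by blast
  have nbZ: "\<exists>k\<in>Z. E b k" if "b \<in> B\<^sub>1 \<union> B\<^sub>2" for b
  proof (rule ccontr)
    assume "\<not> (\<exists>k\<in>Z. E b k)"
    moreover have "\<not> E u v" if "u \<in> Z" "v \<in> A\<^sub>1 \<union> A\<^sub>2 - Z" for u v
      using that Z(2,4) S'(9) sym by blast
    moreover have "Z \<noteq> A\<^sub>1 \<union> A\<^sub>2" "Z \<subseteq> A\<^sub>1 \<union> A\<^sub>2" "Z \<noteq> {}" using Z(1,2) S'(1,6) by blast+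
    ultimately show False using balanced_if_loose[OF S _ _ _ Z(3) _ that] nb by blast
  qed
  have nbY: "\<exists>k\<in>Y. \<not> E a k" if "a \<in> A\<^sub>1 \<union> A\<^sub>2" for a
  proof (rule ccontr)
    assume "\<not> (\<exists>k\<in>Y. \<not> E a k)"
    then have "\<forall>k\<in>Y. \<not> co a k" by (auto simp: compl_def)
    moreover have "\<not> co u v" if "u \<in> Y" "v \<in> B\<^sub>1 \<union> B\<^sub>2 - Y" for u v
    proof (cases "v \<in> B\<^sub>1")
      case True
      then have "E v u" using S'(10) Y(2) that(1) by blast
      then show ?thesis using sym[of v u] by (simp add: compl_def)
    next
      case False
      then show ?thesis using Y(4) that by blast
    qed
    moreover have "Y \<noteq> B\<^sub>1 \<union> B\<^sub>2" "Y \<subseteq> B\<^sub>1 \<union> B\<^sub>2" "Y \<noteq> {}" using Y(1,2) S'(3,7) by blast+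
    ultimately have "\<exists>A B. balanced_skew_partition V co A B"
      using co.balanced_if_loose[OF skew4_co[OF S] _ _ _ Y(3) _ that] by blast
    then show False using balanced_co nb by blast
  qed
  have Yc: "Y \<subseteq> V" "Y \<noteq> {}" "\<forall>b\<in>B\<^sub>1. \<forall>y\<in>Y. E b y"
    using Y(1,2) sub(4) S'(10) by blast+
  have Zc: "Z \<subseteq> V" "Z \<noteq> {}" "\<forall>a\<in>A\<^sub>1. \<forall>z\<in>Z. co a z"
  proof -
    show "Z \<subseteq> V" "Z \<noteq> {}" using Z(1,2) sub(2) by blast+
    have "\<forall>a\<in>A\<^sub>1. \<forall>z\<in>A\<^sub>2. co a z"
      using skew4_co[OF S] by (simp add: skew4_def)
    then show "\<forall>a\<in>A\<^sub>1. \<forall>z\<in>Z. co a z" using Z(2) by blast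
  qed
  note path = odd_path_antipath[OF Yc(1,2) Y(3) Yc(3)]
  have Z3: "\<not> disconnected_on (compl V co) Z" using Z(3) by (simp add: co_co)
  note antipath = co.odd_path_antipath[OF Zc(1,2) Z3 Zc(3), unfolded co_co]
  have nbY': "\<forall>a\<in>A\<^sub>1. \<exists>k\<in>Y. \<not> E a k" "\<forall>a\<in>Z. \<exists>k\<in>Y. \<not> E a k"
    using nbY Z(2) by auto
  have notco: "\<forall>b\<in>Y. \<exists>k\<in>Z. \<not> co b k" "\<forall>b\<in>B\<^sub>1. \<exists>k\<in>Z. \<not> co b k"
    using nbZ Y(2) by (fastforce simp: compl_def)+
  have disj: "A\<^sub>1 \<inter> Y = {}" "Z \<inter> Y = {}" "Y \<inter> Z = {}" "B\<^sub>1 \<inter> Z = {}"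
    using S'(8) Y(2) Z(2) by blast+
  obtain Q where P4: "length P = 4" and Q: "induced_path V co Q" "hd Q = P ! 1" "last Q = P ! 2"
      "interior Q \<subseteq> Y" "even (length Q)"
    by (rule path[OF nbY'(1) disj(1) P])
  define b1 a1 a1' b1' where "b1 = P ! 0" and "a1 = P ! 1" and "a1' = P ! 2" and "b1' = P ! 3"
  note Pd = induced_path4D[OF P(1) P4, folded b1_def a1_def a1'_def b1'_def]
  have Qe: "hd Q = a1" "last Q = a1'" using Q(2,3) by (simp_all add: a1_def a1'_def)
  have inA1: "a1 \<in> A\<^sub>1" "a1' \<in> A\<^sub>1" and inB1: "b1 \<in> B\<^sub>1" "b1' \<in> B\<^sub>1" using Pd(10-13) P(2-4) by auto
  have lenQ: "4 \<le> length Q"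
  proof -
    have "3 \<le> length Q"
      by (rule induced_path_length3[OF Q(1)]) (use Qe Pd(2,5) in \<open>auto simp: compl_def\<close>)
    then show ?thesis using Q(5) by presburger
  qed
  have Q4: "length Q = 4"
    by (rule antipath[OF notco(1) disj(3) Q(1) _ _ Q(4,5) lenQ])
      (use Qe inA1 in simp_all)
  define b2' b2 where "b2' = Q ! 1" and "b2 = Q ! 2"
  have Q03: "Q ! 0 = a1" "Q ! 3 = a1'"
    using co.induced_path4D(12,13)[OF Q(1) Q4] Qe by simp_all
  note Qd = co.induced_path4D[OF Q(1) Q4, folded b2'_def b2_def, unfolded Q03]
  have inB2: "b2 \<in> Y" "b2' \<in> Y" using Qd(10,11) Q(4) by auto
  \<comment> \<open>A path on four vertices is self-complementary, so in the complement the vertices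
    of \<open>P\<close> form an odd path with ends in \<open>A\<^sub>1\<close> and interior in
    \<open>B\<^sub>1\<close>.\<close>
  define P' where "P' = [a1, b1', b1, a1']"
  have P': "induced_path V co P'"
    unfolding P'_def
    by (rule co.induced_path4I) (use Pd(2-9) sym in \<open>auto simp: compl_def\<close>)
  obtain R where R: "induced_path V E R" "hd R = b1'" "last R = b1" "interior R \<subseteq> Z" "even (length R)"
  proof (rule antipath[OF notco(2) disj(4) P'])
    show "hd P' \<in> A\<^sub>1" "last P' \<in> A\<^sub>1" "interior P' \<subseteq> B\<^sub>1" "even (length P')" "4 \<le> length P'"
      using inA1 inB1 by (simp_all add: P'_def interior_def)
    fix R assume "induced_path V E R" "hd R = P' ! 1" "last R = P' ! 2" "interior R \<subseteq> Z" "even (length R)"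
    then show thesis by (intro that) (simp_all add: P'_def)
  qed
  have lenR: "4 \<le> length R"
  proof -
    have "3 \<le> length R"
      by (rule induced_path_length3[OF R(1)]) (use R(2,3) Pd(2,8) sym in auto)
    then show ?thesis using R(5) by presburger
  qed
  have R4: "length R = 4"
    by (rule path[OF nbY'(2) disj(2) R(1) _ _ R(4,5) lenR]) (use R(2,3) inB1 in simp_all)
  define a2' a2 where "a2' = R ! 1" and "a2 = R ! 2"
  have R03: "R ! 0 = b1'" "R ! 3 = b1"
    using induced_path4D(12,13)[OF R(1) R4] R(2,3) by simp_all
  note Rd = induced_path4D[OF R(1) R4, folded a2'_def a2_def, unfolded R03]
  have inA2: "a2 \<in> Z" "a2' \<in> Z" using Rd(10,11) R(4) by auto
  have aa: "\<not> E u v" if "u \<in> {a1, a1'}" "v \<in> {a2, a2'}" for u v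
    using that inA1 inA2 Z(2) S'(9) by auto
  have bb: "E u v" if "u \<in> {b1, b1'}" "v \<in> {b2, b2'}" for u v
    using that inB1 inB2 Y(2) S'(10) by auto
  \<comment> \<open>\<open>w\<close> is adjacent to both ends of \<open>R\<close>; missing both
    inner vertices, it would form a 5-hole with \<open>R\<close>.\<close>
  have hit: "E w a2 \<or> E w a2'" if "w \<in> Y" for w
  proof (rule ccontr)
    assume no: "\<not> ?thesis"
    have "odd (length R)"
    proof (rule odd_apex[OF R(1), where w = w])
      have "E w b1" "E w b1'" using that inB1 Yc(3) sym by blast+
      moreover have set: "set R = {b1', a2', a2, b1}" by (subst Rd(1)) simp
      ultimately show "E w v \<longleftrightarrow> v = hd R \<or> v = last R" if "v \<in> set R" for v
        using that no R(2,3) by auto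
      show "w \<notin> set R" unfolding set using \<open>w \<in> Y\<close> Y(2) Z(2) inA2 inB1 S' by auto
    qed (use that Yc R4 in auto)
    then show False using R4 by simp
  qed
  \<comment> \<open>The dual of \<open>hit\<close>: \<open>w\<close> would form a 5-antihole with
    \<open>Q\<close>.\<close>
  have miss: "\<not> (E w b2 \<and> E w b2')" if "w \<in> Z" for w
  proof
    assume both: "E w b2 \<and> E w b2'"
    have "odd (length Q)"
    proof (rule co.odd_apex[OF Q(1), where w = w])
      have "co w a1" "co w a1'" using that inA1 Zc(3) co.sym by blast+
      moreover have "\<not> co w b2" "\<not> co w b2'" using both by (auto simp: compl_def)
      moreover have set: "set Q = {a1, b2', b2, a1'}" by (subst Qd(1)) simp
      ultimately show "co w v \<longleftrightarrow> v = hd Q \<or> v = last Q" if "v \<in> set Q" for v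
        using that Qe by auto
      show "w \<notin> set Q" unfolding set using \<open>w \<in> Z\<close> Y(2) Z(2) inB2 inA1 S' by auto
    qed (use that Zc Q4 in auto)
    then show False using Q4 by simp
  qed
  have V8: "{a1, a1', a2, a2', b1, b1', b2, b2'} \<subseteq> V"
    using inA1 inA2 inB1 inB2 Z(2) Y(2) sub by auto
  have dist: "distinct [a1, a1', a2, a2', b1, b1', b2, b2']"
  proof -
    have "a2 \<in> A\<^sub>2" "a2' \<in> A\<^sub>2" "b2 \<in> B\<^sub>2" "b2' \<in> B\<^sub>2" using inA2 inB2 Z(2) Y(2) by auto
    moreover have "a1 \<noteq> a1'" "a2 \<noteq> a2'" "b1 \<noteq> b1'" "b2 \<noteq> b2'" using Pd(2) Qd(2) Rd(2) by auto
    ultimately show ?thesis using inA1 inB1 S'(6,7,8) by auto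
  qed
  then have dist': "distinct (rev [a1, a1', a2, a2', b1, b1', b2, b2'])"
    by (simp only: distinct_rev)
  have EQ: "E b2 a1" "E b2' a1'" "\<not> E a1 b2'" "\<not> E b2 b2'" "\<not> E b2 a1'"
    using Qd(2-9) dist V8 sym by (auto simp: co_iff)
  have swap: "\<not> E y x" if "\<not> E x y" for x y using that sym by blast
  note edges = Pd(4-6) Rd(4-6) EQ(1,2) bb
  note nonedges = Pd(7-9) Rd(7-9) EQ(3-5) aa
  \<comment> \<open>By \<open>hit\<close> each of \<open>b2\<close>, \<open>b2'\<close> has a
    neighbour among \<open>a2\<close>, \<open>a2'\<close>; by \<open>miss\<close> each of
    \<open>a2\<close>, \<open>a2'\<close> has at most one among \<open>b2\<close>,
    \<open>b2'\<close>. This leaves the two perfect matchings.\<close>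
  have "(E b2 a2 \<and> \<not> E b2 a2' \<and> E b2' a2' \<and> \<not> E b2' a2) \<or> (E b2 a2' \<and> \<not> E b2 a2 \<and> E b2' a2 \<and> \<not> E b2' a2')"
    using hit[OF inB2(1)] hit[OF inB2(2)] miss[OF inA2(1)] miss[OF inA2(2)] sym by blast
  then show ?thesis
  proof
    assume "E b2 a2 \<and> \<not> E b2 a2' \<and> E b2' a2' \<and> \<not> E b2' a2"
    \<comment> \<open>The two diamonds are \<open>b1, b2, a1, a2\<close> and
      \<open>b2', b1', a1', a2'\<close>, listed in matching order with the nonadjacent pair
      last.\<close>
    then have "contains_induced dd_V dd_E V E"
      by (intro contains_double_diamond[of b1 b2 a1 a2 b2' b1' a1' a2'])
        (use V8 dist dist' in \<open>simp_all add: edges edges[THEN sym] nonedges nonedges[THEN swap]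
          sym[of b2 a2] sym[of b2 a2'] sym[of b2' a2] sym[of b2' a2']
          swap[of b2 a2] swap[of b2 a2'] swap[of b2' a2] swap[of b2' a2']\<close>)
    then show ?thesis ..
  next
    assume "E b2 a2' \<and> \<not> E b2 a2 \<and> E b2' a2 \<and> \<not> E b2' a2'"
    \<comment> \<open>The rows of the grid are \<open>b1, b2, a1\<close>, then
      \<open>b2', b1', a1'\<close>, then \<open>a2, a2'\<close>.\<close>
    then have "contains_induced lk_V lk_E V E"
      by (intro contains_line_graph[of b1 b2 a1 b2' b1' a1' a2 a2'])
        (use V8 dist dist' in \<open>simp_all add: edges edges[THEN sym] nonedges nonedges[THEN swap]
          sym[of b2 a2] sym[of b2 a2'] sym[of b2' a2] sym[of b2' a2']
          swap[of b2 a2] swap[of b2 a2'] swap[of b2' a2] swap[of b2' a2']\<close>)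
    then show ?thesis ..
  qed
qed

lemma unbalanced_config:
  assumes nb: "\<not> (\<exists>A B. balanced_skew_partition V E A B)"
    and S: "skew4 V E A\<^sub>1 A\<^sub>2 B\<^sub>1 B\<^sub>2" and n: "\<not> no_odd_path V E (A\<^sub>1 \<union> A\<^sub>2) (B\<^sub>1 \<union> B\<^sub>2)"
  shows "contains_induced dd_V dd_E V E \<or> contains_induced lk_V lk_E V E"
proof -
  have one: ?thesis
    if "skew4 V E A\<^sub>1 A\<^sub>2 B\<^sub>1 B\<^sub>2" "\<not> no_odd_path V E A\<^sub>1 B\<^sub>1" for A\<^sub>1 A\<^sub>2 B\<^sub>1 B\<^sub>2
  proof (rule ccontr)
    assume "\<not> ?thesis"
    then have "no_odd_path V E A\<^sub>1 B\<^sub>1"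
      using odd_path_config[OF nb that(1)] by (intro no_odd_pathI) blast
    then show False using that(2) by blast
  qed
  have "\<not> no_odd_path V E A\<^sub>1 B\<^sub>1 \<or> \<not> no_odd_path V E A\<^sub>1 B\<^sub>2 \<or> \<not> no_odd_path V E A\<^sub>2 B\<^sub>1 \<or> \<not> no_odd_path V E A\<^sub>2 B\<^sub>2"
    using n no_odd_path_Un[of A\<^sub>1 A\<^sub>2 B\<^sub>1 B\<^sub>2] S unfolding skew4_def by blast
  then show ?thesis
    using one S skew4_swap_left[OF S] skew4_swap_right[OF S] skew4_swap_right[OF skew4_swap_left[OF S]]
    by blast
qed

end

theorem theorem4p10:
  fixes V :: "'a set" and E :: "'a \<Rightarrow> 'a \<Rightarrow> bool"
  assumes "graph V E"
    and "berge V E"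
    and "\<exists>A B. skew_partition V E A B"
  shows "(\<exists>A B. balanced_skew_partition V E A B)
    \<or> has_long_prism V E \<or> has_long_prism V (compl V E)
    \<or> contains_induced dd_V dd_E V E \<or> contains_induced dd_V dd_E V (compl V E)
    \<or> contains_induced lk_V lk_E V E \<or> contains_induced lk_V lk_E V (compl V E)"
proof (rule ccontr)
  assume neg: "\<not> ?thesis"
  interpret prismless_graph V E
    by unfold_locales (use assms neg in auto)
  interpret co: prismless_graph V "compl V E" by (rule prismless_graph_co)
  obtain A\<^sub>1 A\<^sub>2 B\<^sub>1 B\<^sub>2 where S: "skew4 V E A\<^sub>1 A\<^sub>2 B\<^sub>1 B\<^sub>2"
    using assms(3) skew_partition_skew4 by metis
  have nb: "\<not> (\<exists>A B. balanced_skew_partition V E A B)" using neg by blast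
  then have nb': "\<not> (\<exists>A B. balanced_skew_partition V (compl V E) A B)"
    using balanced_co by blast
  have "\<not> no_odd_path V E (A\<^sub>1 \<union> A\<^sub>2) (B\<^sub>1 \<union> B\<^sub>2) \<or> \<not> no_odd_path V (compl V E) (B\<^sub>1 \<union> B\<^sub>2) (A\<^sub>1 \<union> A\<^sub>2)"
    using nb skew4_partition[OF S] balanced_iff by blast
  then show False
    using unbalanced_config[OF nb S] co.unbalanced_config[OF nb' skew4_co[OF S]] neg by blast
qed

end
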